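(* Let $\mathcal{C}=\mathrm{O}^{\epsilon}(n,q)$ and $\Omega=\Omega^{\epsilon}(n,q)$, with $n$ and $q$ even and $\epsilon\in\{+,-\}$. A complete set of representatives for the conjugacy classes of $\Omega$ is described by all pairs of matrices $(SU,B)$ defined by $$S=\begin{pmatrix}S_1&&\\&\ddots&\\&&S_h\end{pmatrix},\quad U=\begin{pmatrix}U_{1,j}&&\\&\ddots&\\&&U_{h,j}\end{pmatrix},\quad B=\begin{pmatrix}B_1&&\\&\ddots&\\&&B_h\end{pmatrix},$$ where $(S,B)$ runs over all representatives of the semisimple conjugacy classes of $\mathcal{C}$ (in the block form described in the context) and, for every such $(S,B)$, $U_{i,j}$ runs (independently for each $i$) over all representatives of the unipotent conjugacy classes of $C_{\Omega(B_i)}(S_i)$ (if $f_i=t+1$) or of $C_{\mathcal{C}(B_i)}(S_i)$ (if $f_i\in\Phi_2\cup\Phi_3$). Moreover, if $f_i\in\Phi_2\cup\Phi_3$ for all $i$, then the element $((SU)^Z,B)$ must be added to the set of representatives for each $SU$, where $Z$ is a fixed element of $\mathcal{C}(B)\setminus\Omega(B)$.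
   Context: $F=\mathbb{F}_q$, $q$ even; row vectors are used. For a matrix $B$ defining a non-singular quadratic form $Q(v)=vBv^{\mathrm t}$ (i.e. $\beta_Q(u,v)=Q(u+v)-Q(u)-Q(v)$ is non-degenerate), $\mathcal{C}(B)$ is its isometry group, and $\Omega(B)$ is the kernel of the spinor norm $\theta:\mathcal{C}(B)\to\mathbb{F}_2$, $\theta(x)=\mathrm{rank}(x+\mathbf 1)\bmod 2$. $\mathrm{O}^{\pm}(n,q)$, $\Omega^{\pm}(n,q)$ are these groups for $Q$ of plus/minus type. Semisimple: odd order; unipotent: order a power of $2$; the unipotent conjugacy classes of a group $H$ are the $H$-classes of its unipotent elements. $X^Z=Z^{-1}XZ$. For monic $f$ of degree $d$ with $f(0)\ne0$, $f^*(t)=f(0)^{-1}t^df(t^{-1})$. $\Phi_1=\{t+1\}$; $\Phi_2$: $f=gg^*$, $g\ne g^*$ monic irreducible; $\Phi_3$: monic irreducible $f=f^*$ of degree $>1$; $\Phi=\Phi_1\cup\Phi_2\cup\Phi_3$. For semisimple $S\in\mathcal{C}(B)$, its generalized elementary divisors are the distinct $f_1,\dots,f_h\in\Phi$ whose product is the minimal polynomial of $S$. The pairs $(S,B)$, one for each semisimple class of $\mathcal{C}$, are written in a basis adapted to $V=\bigoplus_i\ker f_i(S)$, so that $S=\mathrm{diag}(S_1,\dots,S_h)$ and $B=\mathrm{diag}(B_1,\dots,B_h)$, where $S_i,B_i$ are the matrices of the restrictions of $S$ and of the quadratic form to $\ker f_i(S)$. Pairs: let $B_0$ be a matrix of the quadratic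 form defining $\mathcal{C}$. For each chosen semisimple representative $(S,B)$ fix $P\in\mathrm{GL}(V)$ with $PB_0P^{\mathrm t}-B$ alternating; then $(S,B)$ represents the $\mathcal{C}$-class of $P^{-1}SP$, and a pair $(X,B)$ with $X\in\Omega(B)$ represents the $\Omega$-class of $P^{-1}XP$. *)

theory Defs
  imports
    "HOL-Library.Cardinality"
    "HOL-Algebra.Multiplicative_Group"
    "Jordan_Normal_Form.DL_Rank"
    "Jordan_Normal_Form.Matrix_Kernel"
begin

text \<open>Vectors are row vectors, so the product of a vector \<open>v\<close> with a matrix \<open>X\<close> on its right is
  \<open>X\<^sup>T *\<^sub>v v\<close> in terms of the library's column action. A square matrix \<open>B\<close> stands for a
  quadratic form on \<open>F\<^sup>n\<close> with \<open>n = dim_row B\<close>.\<close>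

definition row_mult :: "'a::comm_semiring_1 vec \<Rightarrow> 'a mat \<Rightarrow> 'a vec" (infixl "\<lhd>\<^sub>m" 70) where
  "v \<lhd>\<^sub>m X = X\<^sup>T *\<^sub>v v"

definition quad :: "'a::field mat \<Rightarrow> 'a vec \<Rightarrow> 'a" where
  "quad B v = (v \<lhd>\<^sub>m B) \<bullet> v"

definition polar :: "'a::field mat \<Rightarrow> 'a vec \<Rightarrow> 'a vec \<Rightarrow> 'a" where
  "polar B u v = quad B (u + v) - quad B u - quad B v"

definition nonsingular :: "'a::field mat \<Rightarrow> bool" where
  "nonsingular B \<longleftrightarrow> (\<forall>u\<in>carrier_vec (dim_row B).
     (\<forall>v\<in>carrier_vec (dim_row B). polar B u v = 0) \<longrightarrow> u = 0\<^sub>v (dim_row B))"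

definition alternating_mat :: "'a::field mat \<Rightarrow> bool" where
  "alternating_mat A \<longleftrightarrow> square_mat A \<and> A\<^sup>T = - A \<and> (\<forall>i<dim_row A. A $$ (i, i) = 0)"

definition totally_singular :: "'a::field mat \<Rightarrow> 'a vec set \<Rightarrow> bool" where
  "totally_singular B W \<longleftrightarrow>
     subspace class_ring W (module_vec TYPE('a) (dim_row B)) \<and> (\<forall>w\<in>W. quad B w = 0)"

definition witt_index :: "'a::field mat \<Rightarrow> nat" where
  "witt_index B = Max {vectorspace.dim class_ring (module_vec TYPE('a) (dim_row B)\<lparr>carrier := W\<rparr>) | W.
     totally_singular B W}"

datatype form_type = Plus_Type | Minus_Type

text \<open>The type of a non-singular form on a space of even positive dimension \<open>n\<close>: Witt index
  \<open>n/2\<close> for plus type and \<open>n/2 - 1\<close> for minus type.\<close>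

fun has_type :: "form_type \<Rightarrow> 'a::field mat \<Rightarrow> bool" where
  "has_type Plus_Type B \<longleftrightarrow> 2 * witt_index B = dim_row B"
| "has_type Minus_Type B \<longleftrightarrow> 2 * (witt_index B + 1) = dim_row B"

definition GL :: "nat \<Rightarrow> 'a::field mat monoid" where
  "GL n = units_of (ring_mat TYPE('a) n ())"

definition mat_conj :: "'a::field mat \<Rightarrow> 'a mat \<Rightarrow> 'a mat" where
  "mat_conj X Z = inv\<^bsub>GL (dim_row Z)\<^esub> Z * X * Z"

definition isometry_group :: "'a::field mat \<Rightarrow> 'a mat monoid" where
  "isometry_group B = GL (dim_row B)
     \<lparr>carrier := {X \<in> carrier (GL (dim_row B)).
        \<forall>v\<in>carrier_vec (dim_row B). quad B (v \<lhd>\<^sub>m X) = quad B v}\<rparr>"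

definition spinor_norm :: "'a::field mat \<Rightarrow> nat" where
  "spinor_norm X = vec_space.rank (dim_row X) (X + 1\<^sub>m (dim_row X)) mod 2"

definition Omega :: "'a::field mat \<Rightarrow> 'a mat monoid" where
  "Omega B = (isometry_group B)
     \<lparr>carrier := {X \<in> carrier (isometry_group B). spinor_norm X = 0}\<rparr>"

definition centralizer :: "('b, 'c) monoid_scheme \<Rightarrow> 'b \<Rightarrow> ('b, 'c) monoid_scheme" where
  "centralizer G x = G\<lparr>carrier := {y \<in> carrier G. y \<otimes>\<^bsub>G\<^esub> x = x \<otimes>\<^bsub>G\<^esub> y}\<rparr>"

definition conj_class :: "('b, 'c) monoid_scheme \<Rightarrow> 'b \<Rightarrow> 'b set" where
  "conj_class G x = {inv\<^bsub>G\<^esub> g \<otimes>\<^bsub>G\<^esub> x \<otimes>\<^bsub>G\<^esub> g | g. g \<in> carrier G}"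

definition semisimple_elems :: "('b, 'c) monoid_scheme \<Rightarrow> 'b set" where
  "semisimple_elems G = {x \<in> carrier G. odd (group.ord G x)}"

definition unipotent_elems :: "('b, 'c) monoid_scheme \<Rightarrow> 'b set" where
  "unipotent_elems G = {x \<in> carrier G. \<exists>k. group.ord G x = 2 ^ k}"

definition class_reps :: "('b, 'c) monoid_scheme \<Rightarrow> 'b set \<Rightarrow> 'b set \<Rightarrow> bool" where
  "class_reps G A W \<longleftrightarrow> W \<subseteq> A \<and> bij_betw (conj_class G) W (conj_class G ` A)"

definition poly_star :: "'a::field poly \<Rightarrow> 'a poly" where
  "poly_star f = Polynomial.smult (inverse (poly f 0)) (reflect_poly f)"

definition Phi1 :: "'a::field poly set" where
  "Phi1 = {[:1, 1:]}"

definition Phi2 :: "'a::field poly set" where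
  "Phi2 = {g * poly_star g | g.
     lead_coeff g = 1 \<and> irreducible g \<and> poly g 0 \<noteq> 0 \<and> g \<noteq> poly_star g}"

definition Phi3 :: "'a::field poly set" where
  "Phi3 = {f. lead_coeff f = 1 \<and> irreducible f \<and> poly f 0 \<noteq> 0 \<and> f = poly_star f \<and> degree f > 1}"

definition Phi :: "'a::field poly set" where
  "Phi = Phi1 \<union> Phi2 \<union> Phi3"

definition mat_poly :: "'a::field poly \<Rightarrow> 'a mat \<Rightarrow> 'a mat" where
  "mat_poly f A = mat (dim_row A) (dim_row A)
     (\<lambda>(i, j). \<Sum>k\<le>degree f. coeff f k * (A ^\<^sub>m k) $$ (i, j))"

definition is_min_poly :: "'a::field mat \<Rightarrow> 'a poly \<Rightarrow> bool" where
  "is_min_poly A f \<longleftrightarrow> lead_coeff f = 1 \<and> mat_poly f A = 0\<^sub>m (dim_row A) (dim_row A) \<and>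
     (\<forall>g. g \<noteq> 0 \<and> mat_poly g A = 0\<^sub>m (dim_row A) (dim_row A) \<longrightarrow> degree f \<le> degree g)"

text \<open>A pair \<open>(S, B)\<close> in block form is the list of the triples \<open>(f\<^sub>i, S\<^sub>i, B\<^sub>i)\<close>, where the
  \<open>f\<^sub>i\<close> are the generalized elementary divisors of \<open>S\<close>.\<close>

type_synonym 'a blocks = "('a poly \<times> 'a mat \<times> 'a mat) list"

definition eldivs :: "'a::field blocks \<Rightarrow> 'a poly list" where
  "eldivs r = map fst r"

definition S_blocks :: "'a::field blocks \<Rightarrow> 'a mat list" where
  "S_blocks r = map (fst \<circ> snd) r"

definition B_blocks :: "'a::field blocks \<Rightarrow> 'a mat list" where
  "B_blocks r = map (snd \<circ> snd) r"

abbreviation S_mat :: "'a::field blocks \<Rightarrow> 'a mat" where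
  "S_mat r \<equiv> diag_block_mat (S_blocks r)"

abbreviation B_mat :: "'a::field blocks \<Rightarrow> 'a mat" where
  "B_mat r \<equiv> diag_block_mat (B_blocks r)"

text \<open>The subspace of \<open>F\<^sup>n\<close> spanned by the basis vectors belonging to the \<open>i\<close>-th block.\<close>

definition block_space :: "'a::field blocks \<Rightarrow> nat \<Rightarrow> 'a vec set" where
  "block_space r i = {v \<in> carrier_vec (dim_row (S_mat r)). \<forall>j<dim_row (S_mat r).
     j \<notin> {sum_list (map dim_row (take i (S_blocks r))) ..<
           sum_list (map dim_row (take (Suc i) (S_blocks r)))} \<longrightarrow> v $ j = 0}"

definition adapted :: "nat \<Rightarrow> 'a::field blocks \<Rightarrow> bool" where
  "adapted n r \<longleftrightarrow>
     (\<forall>(f, S, B)\<in>set r. \<exists>m. S \<in> carrier_mat m m \<and> B \<in> carrier_mat m m) \<and>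
     S_mat r \<in> carrier_mat n n \<and>
     distinct (eldivs r) \<and> set (eldivs r) \<subseteq> Phi \<and> is_min_poly (S_mat r) (prod_list (eldivs r)) \<and>
     (\<forall>i<length r. {v \<in> carrier_vec n. v \<lhd>\<^sub>m mat_poly (eldivs r ! i) (S_mat r) = 0\<^sub>v n}
        = block_space r i)"

text \<open>\<open>P\<close> carries the form of \<open>B\<^sub>0\<close> to the form of \<open>B\<close>: two matrices define the same quadratic
  form iff their difference is alternating.\<close>

definition transports :: "'a::field mat \<Rightarrow> 'a mat \<Rightarrow> 'a mat \<Rightarrow> bool" where
  "transports B0 P B \<longleftrightarrow> P \<in> carrier (GL (dim_row B0)) \<and> B \<in> carrier_mat (dim_row B0) (dim_row B0) \<and>
     alternating_mat (P * B0 * P\<^sup>T - B)"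

text \<open>\<open>R\<close> is a system of pairs \<open>(S, B)\<close>, one for each semisimple class of the isometry group of
  \<open>B\<^sub>0\<close>; the class represented by \<open>r \<in> R\<close> is read off with the fixed matrix \<open>P r\<close>.\<close>

definition semisimple_reps :: "'a::field mat \<Rightarrow> 'a blocks set \<Rightarrow> ('a blocks \<Rightarrow> 'a mat) \<Rightarrow> bool" where
  "semisimple_reps B0 R P \<longleftrightarrow>
     (\<forall>r\<in>R. adapted (dim_row B0) r \<and> transports B0 (P r) (B_mat r) \<and>
        S_mat r \<in> semisimple_elems (isometry_group (B_mat r))) \<and>
     bij_betw (\<lambda>r. conj_class (isometry_group B0) (mat_conj (S_mat r) (P r))) R
       (conj_class (isometry_group B0) ` semisimple_elems (isometry_group B0))"

fun block_group :: "'a::field poly \<times> 'a mat \<times> 'a mat \<Rightarrow> 'a mat monoid" where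
  "block_group (f, S, B) = centralizer (if f \<in> Phi1 then Omega B else isometry_group B) S"

text \<open>The products \<open>SU\<close>, where \<open>W i\<close> is the chosen set of unipotent representatives for the
  \<open>i\<close>-th block.\<close>

definition SU_set :: "'a::field blocks \<Rightarrow> (nat \<Rightarrow> 'a mat set) \<Rightarrow> 'a mat set" where
  "SU_set r W = {S_mat r * diag_block_mat Us | Us.
     length Us = length r \<and> (\<forall>i<length r. Us ! i \<in> W i)}"

text \<open>The listed pairs \<open>(X, B)\<close>. An entry \<open>(r, X)\<close> stands for \<open>(X, B_mat r)\<close>; recording \<open>r\<close> also
  fixes the matrix \<open>P r\<close> with which the class represented by the pair is read off.\<close>

definition class_pairs ::
  "'a::field blocks set \<Rightarrow> ('a blocks \<Rightarrow> nat \<Rightarrow> 'a mat set) \<Rightarrow> ('a blocks \<Rightarrow> 'a mat) \<Rightarrow>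
   ('a blocks \<times> 'a mat) set" where
  "class_pairs R W Z =
     {(r, X) | r X. r \<in> R \<and> X \<in> SU_set r (W r)} \<union>
     {(r, mat_conj X (Z r)) | r X. r \<in> R \<and> set (eldivs r) \<subseteq> Phi2 \<union> Phi3 \<and> X \<in> SU_set r (W r)}"

end

theory Submission
  imports
    Defs
    "HOL-Library.Product_Plus"
    "HOL-Library.Function_Algebras"
    "HOL-Algebra.Product_Groups"
begin

text \<open>The spinor norm is a homomorphism: for isometries \<open>x\<close>, \<open>y\<close> Wall's form restricted to the space
  \<open>{(u, v). u(x + 1) = v(y + 1)}\<close> is alternating, hence of even rank, and its radical is built from the
  fixed spaces of \<open>x\<close>, \<open>y\<close> and \<open>xy\<close>. Dimensions are read off from cardinalities. It follows that \<open>\<Omega>\<close> is a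
  subgroup of index at most two.

  By the Jordan decomposition an element of \<open>\<Omega>\<close> is a product of commuting semisimple and unipotent parts,
  both powers of the element. The \<open>\<C>\<close>-class of a semisimple \<open>S\<close> is a single \<open>\<Omega>\<close>-class if the
  centralizer of \<open>S\<close> meets \<open>\<C> - \<Omega>\<close>, and splits in two, interchanged by \<open>Z\<close>, otherwise. The
  centralizer is the direct product of the centralizers on the blocks. On a block with \<open>f \<noteq> t + 1\<close> it lies in the kernel
  of the spinor norm: a unipotent \<open>Y\<close> commuting with \<open>S\<close> has \<open>\<theta>(Y) = \<theta>(SY)\<close>, and \<open>SY\<close> fixes no non-zero vector
  of the even-dimensional block. On the block with \<open>f = t + 1\<close> the centralizer is the full isometry group, which contains
  reflections.\<close>

section \<open>Counting in finite vector spaces\<close>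

text \<open>Ranks matter only through their parity, and a parity is visible in an exponent of q =
  CARD('a). So dimension arguments become identities between cardinalities; the decisive one is |V|
  |Fix x \<inter> Fix y|^2 = q^(2k) |Fix x| |Fix y| |Fix xy|. As the spinor norm of x is n + dim Fix
  x modulo two, comparing exponents makes it additive. The recipe for the blocks looks mixed: a
  centralizer in \<Omega> for t + 1, in the full isometry group otherwise. Both describe one object,
  the centralizer of S in \<Omega>. The divisors are distinct, so at most one block can contribute a
  non-zero spinor norm, and the total vanishes exactly when that block lies in its own \<Omega>. The
  passage from \<C> to \<Omega> is pure group theory. Elements of odd order lie in \<Omega>
  automatically; the \<Omega>-classes inside the \<C>-class of S correspond to the double cosets of
  C(S) and \<Omega>, of which there are one or two; and the unipotent part is classified inside the
  centralizer of S in \<Omega>. The pairs stay tagged by their block data because the matrix that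
  reads off the class depends on them.\<close>

locale scaled_subspace =
  fixes sc :: "'a::{field,finite} \<Rightarrow> 'b::ab_group_add \<Rightarrow> 'b" and A :: "'b set"
  assumes finite_space: "finite A"
    and zero_mem: "0 \<in> A"
    and add_mem: "\<And>x y. x \<in> A \<Longrightarrow> y \<in> A \<Longrightarrow> x + y \<in> A"
    and diff_mem: "\<And>x y. x \<in> A \<Longrightarrow> y \<in> A \<Longrightarrow> x - y \<in> A"
    and scale_mem: "\<And>c x. x \<in> A \<Longrightarrow> sc c x \<in> A"

text \<open>Linearity is relative to a subset and to a given scaling, so that one notion serves
  functions as well as pairs and triples of them, and restricts to subspaces.\<close>

definition lin_on :: "('a::{field,finite} \<Rightarrow> 'b::ab_group_add \<Rightarrow> 'b) \<Rightarrow> 'b set \<Rightarrow> ('b \<Rightarrow> 'a) \<Rightarrow> bool" where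
  "lin_on sc A f \<longleftrightarrow> (\<forall>x\<in>A. \<forall>y\<in>A. f (x + y) = f x + f y) \<and> (\<forall>x\<in>A. \<forall>c. f (sc c x) = c * f x)"

lemma lin_on_subset: "lin_on sc A f \<Longrightarrow> A' \<subseteq> A \<Longrightarrow> lin_on sc A' f"
  unfolding lin_on_def by blast

context scaled_subspace
begin

lemma lin_on_diff:
  assumes "lin_on sc A f" "x \<in> A" "y \<in> A"
  shows "f (x - y) = f x - f y"
proof -
  have "f x = f ((x - y) + y)" by simp
  also have "\<dots> = f (x - y) + f y"
    using assms diff_mem unfolding lin_on_def by blast
  finally show ?thesis by simp
qed

lemma lin_on_zero: "lin_on sc A f \<Longrightarrow> f 0 = 0"
  using lin_on_diff[of f 0 0] zero_mem by simp

lemma kernel_subspace: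
  assumes "lin_on sc A f"
  shows "scaled_subspace sc {x \<in> A. f x = 0}"
proof
  fix x y assume "x \<in> {x \<in> A. f x = 0}" "y \<in> {x \<in> A. f x = 0}"
  then show "x + y \<in> {x \<in> A. f x = 0}" "x - y \<in> {x \<in> A. f x = 0}"
    using assms lin_on_diff[OF assms] add_mem diff_mem unfolding lin_on_def by auto
next
  fix c x assume "x \<in> {x \<in> A. f x = 0}"
  then show "sc c x \<in> {x \<in> A. f x = 0}"
    using assms scale_mem unfolding lin_on_def by auto
qed (use finite_space zero_mem lin_on_zero[OF assms] in auto)

lemma exists_one:
  assumes "lin_on sc A f" "a \<in> A" "f a \<noteq> 0"
  obtains e where "e \<in> A" "f e = 1"
proof
  show "sc (inverse (f a)) a \<in> A" using assms scale_mem by blast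
  show "f (sc (inverse (f a)) a) = 1" using assms unfolding lin_on_def by auto
qed

text \<open>If \<open>f e = 1\<close>, then subtracting \<open>sc (f x) e\<close> projects onto the
  kernel, so \<open>A\<close> is in bijection with the field times the kernel. This is the unit step
  that replaces dimension.\<close>

lemma card_kernel:
  assumes f: "lin_on sc A f" and a: "a \<in> A" "f a \<noteq> 0"
  shows "card A = CARD('a) * card {x \<in> A. f x = 0}"
proof -
  obtain e where e: "e \<in> A" "f e = 1" using exists_one[OF assms] .
  have fsc: "f (sc c e) = c" for c using f e unfolding lin_on_def by auto
  have "bij_betw (\<lambda>x. (f x, x - sc (f x) e)) A (UNIV \<times> {x \<in> A. f x = 0})"
  proof (rule bij_betwI[where g = "\<lambda>(c, k). k + sc c e"])
    show "(\<lambda>x. (f x, x - sc (f x) e)) \<in> A \<rightarrow> UNIV \<times> {x \<in> A. f x = 0}"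
      using e scale_mem diff_mem lin_on_diff[OF f] fsc by auto
    show "(\<lambda>(c, k). k + sc c e) \<in> UNIV \<times> {x \<in> A. f x = 0} \<rightarrow> A"
      using e scale_mem add_mem by auto
    show "(case (f x, x - sc (f x) e) of (c, k) \<Rightarrow> k + sc c e) = x" if "x \<in> A" for x by simp
    fix y :: "'a \<times> 'b" assume y: "y \<in> UNIV \<times> {x \<in> A. f x = 0}"
    then show "(f (case y of (c, k) \<Rightarrow> k + sc c e), (case y of (c, k) \<Rightarrow> k + sc c e) - sc (f (case y of (c, k) \<Rightarrow> k + sc c e)) e) = y"
      using f e scale_mem fsc unfolding lin_on_def by auto
  qed
  then have "card A = card ((UNIV :: 'a set) \<times> {x \<in> A. f x = 0})"
    by (rule bij_betw_same_card)
  then show ?thesis by (simp add: card_cartesian_product)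
qed

end

text \<open>The quotients of \<open>A\<close> and \<open>B\<close> by the two radicals are dual to
  each other, hence of equal size. If \<open>g a e = 1\<close>, the induction passes to the vectors
  of \<open>A\<close> orthogonal to \<open>e\<close> and those of \<open>B\<close> orthogonal to
  \<open>a\<close>: each cardinality loses a factor CARD('a), and neither radical changes.\<close>

lemma card_pairing:
  fixes sc :: "'a::{field,finite} \<Rightarrow> 'b::ab_group_add \<Rightarrow> 'b" and sc' :: "'a \<Rightarrow> 'c::ab_group_add \<Rightarrow> 'c"
  assumes "scaled_subspace sc A" and "scaled_subspace sc' B"
    and "\<And>b. b \<in> B \<Longrightarrow> lin_on sc A (\<lambda>a. g a b)"
    and "\<And>a. a \<in> A \<Longrightarrow> lin_on sc' B (g a)"
  shows "card A * card {b \<in> B. \<forall>a\<in>A. g a b = 0} = card B * card {a \<in> A. \<forall>b\<in>B. g a b = 0}"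
  using assms
proof (induction "card A" arbitrary: A B rule: less_induct)
  case less
  interpret A: scaled_subspace sc A by fact
  interpret B: scaled_subspace sc' B by fact
  show ?case
  proof (cases "\<forall>a\<in>A. \<forall>b\<in>B. g a b = 0")
    case True
    then have "{b \<in> B. \<forall>a\<in>A. g a b = 0} = B" "{a \<in> A. \<forall>b\<in>B. g a b = 0} = A" by auto
    then show ?thesis by simp
  next
    case False
    then obtain a b where ab: "a \<in> A" "b \<in> B" "g a b \<noteq> 0" by blast
    obtain e where e: "e \<in> B" "g a e = 1"
      using B.exists_one[OF less.prems(4)[OF ab(1)] ab(2,3)] .
    have gae: "g a e \<noteq> 0" using e by simp
    define A' where "A' = {x \<in> A. g x e = 0}"
    define B' where "B' = {y \<in> B. g a y = 0}"
    have sub: "A' \<subseteq> A" "B' \<subseteq> B" unfolding A'_def B'_def by auto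
    have cA: "card A = CARD('a) * card A'"
      unfolding A'_def by (rule A.card_kernel[OF less.prems(3)[OF e(1)] ab(1) gae])
    have cB: "card B = CARD('a) * card B'"
      unfolding B'_def by (rule B.card_kernel[OF less.prems(4)[OF ab(1)] e(1) gae])
    have sA: "scaled_subspace sc A'"
      unfolding A'_def by (rule A.kernel_subspace[OF less.prems(3)[OF e(1)]])
    have sB: "scaled_subspace sc' B'"
      unfolding B'_def by (rule B.kernel_subspace[OF less.prems(4)[OF ab(1)]])
    have lt: "card A' < card A"
      by (rule psubset_card_mono[OF A.finite_space]) (use sub ab gae in \<open>unfold A'_def, blast\<close>)
    have IH: "card A' * card {b \<in> B'. \<forall>a\<in>A'. g a b = 0} = card B' * card {a \<in> A'. \<forall>b\<in>B'. g a b = 0}"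
      by (rule less.hyps[OF lt sA sB]) (use less.prems sub lin_on_subset in blast)+
    \<comment> \<open>A vector of the smaller radical is orthogonal to \<open>A'\<close> and to
      \<open>a\<close>, and every vector of \<open>A\<close> is the sum of a multiple of
      \<open>a\<close> and a vector of \<open>A'\<close>.\<close>
    have "{b \<in> B'. \<forall>a\<in>A'. g a b = 0} = {b \<in> B. \<forall>a\<in>A. g a b = 0}"
    proof (intro equalityI subsetI)
      fix b' assume b': "b' \<in> {b \<in> B'. \<forall>a\<in>A'. g a b = 0}"
      have "g x b' = 0" if x: "x \<in> A" for x
      proof -
        let ?k = "sc (g x e) a"
        have kA: "?k \<in> A" using A.scale_mem ab by blast
        have "g ?k e = g x e * g a e"
          using less.prems(3)[OF e(1)] ab unfolding lin_on_def by blast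
        then have "g (x - ?k) e = 0"
          using A.lin_on_diff[OF less.prems(3)[OF e(1)] x kA] e by simp
        then have "x - ?k \<in> A'" using A.diff_mem x kA unfolding A'_def by blast
        then have "g (x - ?k) b' = 0" using b' by blast
        moreover have "b' \<in> B" "g a b' = 0" using b' unfolding B'_def by auto
        moreover have "g ?k b' = g x e * g a b'"
          using less.prems(3)[OF \<open>b' \<in> B\<close>] ab unfolding lin_on_def by blast
        ultimately show ?thesis using A.lin_on_diff[OF less.prems(3)[OF \<open>b' \<in> B\<close>] x kA] by simp
      qed
      then show "b' \<in> {b \<in> B. \<forall>a\<in>A. g a b = 0}" using b' sub by blast
    qed (use sub ab in \<open>auto simp: B'_def\<close>)
    moreover have "{a \<in> A'. \<forall>b\<in>B'. g a b = 0} = {a \<in> A. \<forall>b\<in>B. g a b = 0}"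
    proof (intro equalityI subsetI)
      fix a' assume a': "a' \<in> {a \<in> A'. \<forall>b\<in>B'. g a b = 0}"
      have "g a' y = 0" if y: "y \<in> B" for y
      proof -
        let ?k = "sc' (g a y) e"
        have kB: "?k \<in> B" using B.scale_mem e by blast
        have "g a ?k = g a y * g a e"
          using less.prems(4)[OF ab(1)] e unfolding lin_on_def by blast
        then have "g a (y - ?k) = 0"
          using B.lin_on_diff[OF less.prems(4)[OF ab(1)] y kB] e by simp
        then have "y - ?k \<in> B'" using B.diff_mem y kB unfolding B'_def by blast
        then have "g a' (y - ?k) = 0" using a' by blast
        moreover have "a' \<in> A" "g a' e = 0" using a' unfolding A'_def by auto
        moreover have "g a' ?k = g a y * g a' e"
          using less.prems(4)[OF \<open>a' \<in> A\<close>] e unfolding lin_on_def by blast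
        ultimately show ?thesis using B.lin_on_diff[OF less.prems(4)[OF \<open>a' \<in> A\<close>] y kB] by simp
      qed
      then show "a' \<in> {a \<in> A. \<forall>b\<in>B. g a b = 0}" using a' sub by blast
    qed (use sub e in \<open>auto simp: A'_def\<close>)
    ultimately show ?thesis using IH cA cB by simp
  qed
qed

text \<open>Hyperbolic planes split off: if \<open>g a e = 1\<close>, the vectors orthogonal to both
  \<open>a\<close> and \<open>e\<close> form a subspace of index CARD('a)^2 with the same radical.
  Hence the exponent, the rank of the form, is even.\<close>

lemma card_alternating:
  fixes sc :: "'a::{field,finite} \<Rightarrow> 'b::ab_group_add \<Rightarrow> 'b"
  assumes "scaled_subspace sc A"
    and "\<And>b. b \<in> A \<Longrightarrow> lin_on sc A (\<lambda>a. g a b)"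
    and "\<And>a. a \<in> A \<Longrightarrow> lin_on sc A (g a)"
    and "\<And>a. a \<in> A \<Longrightarrow> g a a = 0"
  shows "\<exists>k. card A = CARD('a) ^ (2 * k) * card {a \<in> A. \<forall>b\<in>A. g a b = 0}"
  using assms
proof (induction "card A" arbitrary: A rule: less_induct)
  case less
  interpret A: scaled_subspace sc A by fact
  show ?case
  proof (cases "\<forall>a\<in>A. \<forall>b\<in>A. g a b = 0")
    case True
    then have "{a \<in> A. \<forall>b\<in>A. g a b = 0} = A" by auto
    then show ?thesis by (intro exI[of _ 0]) simp
  next
    case False
    then obtain a b where ab: "a \<in> A" "b \<in> A" "g a b \<noteq> 0" by blast
    obtain e where e: "e \<in> A" "g a e = 1"
      using A.exists_one[OF less.prems(3)[OF ab(1)] ab(2,3)] .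
    have skew: "g y x = - g x y" if "x \<in> A" "y \<in> A" for x y
    proof -
      have "0 = g (x + y) (x + y)" using less.prems(4) A.add_mem that by simp
      also have "\<dots> = g (x + y) x + g (x + y) y"
        using less.prems(3)[OF A.add_mem[OF that]] that unfolding lin_on_def by blast
      also have "\<dots> = (g x x + g y x) + (g x y + g y y)"
        using less.prems(2)[OF that(1)] less.prems(2)[OF that(2)] that unfolding lin_on_def by metis
      finally have "g y x + g x y = 0" using less.prems(4) that by simp
      then show ?thesis by (simp add: eq_neg_iff_add_eq_0)
    qed
    have aa: "g a a = 0" "g e e = 0" "g e a = -1" using less.prems(4) ab e skew[OF ab(1) e(1)] by auto
    define A1 where "A1 = {x \<in> A. g x e = 0}"
    interpret A1: scaled_subspace sc A1
      unfolding A1_def by (rule A.kernel_subspace[OF less.prems(2)[OF e(1)]])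
    have c1: "card A = CARD('a) * card A1"
      unfolding A1_def by (rule A.card_kernel[OF less.prems(2)[OF e(1)] ab(1)]) (use e in simp)
    define A2 where "A2 = {x \<in> A1. g x a = 0}"
    have s1: "A1 \<subseteq> A" unfolding A1_def by auto
    have l1: "lin_on sc A1 (\<lambda>x. g x a)" using less.prems(2)[OF ab(1)] s1 lin_on_subset by blast
    have eA1: "e \<in> A1" using e aa unfolding A1_def by auto
    have c2: "card A1 = CARD('a) * card A2"
      unfolding A2_def by (rule A1.card_kernel[OF l1 eA1]) (use aa in simp)
    have sA2: "scaled_subspace sc A2" unfolding A2_def by (rule A1.kernel_subspace[OF l1])
    have s2: "A2 \<subseteq> A" unfolding A2_def A1_def by auto
    have "a \<notin> A2" using e unfolding A2_def A1_def by simp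
    then have s3: "A2 \<subset> A" using s2 ab by blast
    have lt: "card A2 < card A" by (rule psubset_card_mono[OF A.finite_space s3])
    obtain k where k: "card A2 = CARD('a) ^ (2 * k) * card {a \<in> A2. \<forall>b\<in>A2. g a b = 0}"
      using less.hyps[OF lt sA2] less.prems s2 lin_on_subset by (metis (no_types, lifting) subsetD)
    have "{a \<in> A2. \<forall>b\<in>A2. g a b = 0} = {a \<in> A. \<forall>b\<in>A. g a b = 0}"
    proof (intro equalityI subsetI)
      fix r assume r: "r \<in> {a \<in> A2. \<forall>b\<in>A2. g a b = 0}"
      then have rA: "r \<in> A" "g r e = 0" "g r a = 0" using s2 unfolding A2_def A1_def by auto
      have "g r y = 0" if y: "y \<in> A" for y
      proof -
        \<comment> \<open>The sum of \<open>p\<close> and \<open>p'\<close> is the component of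
          \<open>y\<close> in the plane spanned by \<open>a\<close> and \<open>e\<close>: the
          difference \<open>y'\<close> is orthogonal to both.\<close>
        define p where "p = sc (g y e) a"
        define p' where "p' = sc (g a y) e"
        have pA: "p \<in> A" "p' \<in> A" unfolding p_def p'_def using A.scale_mem ab e by auto
        have gp: "g p x = g y e * g a x" "g p' x = g a y * g e x" if "x \<in> A" for x
          using less.prems(2)[OF that] ab e unfolding p_def p'_def lin_on_def by auto
        have gr: "g r p = g y e * g r a" "g r p' = g a y * g r e"
          using less.prems(3)[OF rA(1)] ab e unfolding p_def p'_def lin_on_def by auto
        define y' where "y' = y - p - p'"
        have y'A: "y' \<in> A" unfolding y'_def using A.diff_mem y pA by blast
        have gy': "g y' x = g y x - g p x - g p' x" if "x \<in> A" for x
          unfolding y'_def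
          using A.lin_on_diff[OF less.prems(2)[OF that]] A.diff_mem y pA by auto
        have "g y' e = 0" using gy'[OF e(1)] gp[OF e(1)] e aa by simp
        moreover have "g y' a = 0" using gy'[OF ab(1)] gp[OF ab(1)] aa skew[OF ab(1) y] by simp
        ultimately have "y' \<in> A2" using y'A unfolding A2_def A1_def by auto
        then have "g r y' = 0" using r by blast
        moreover have "g r y' = g r y - g r p - g r p'"
          unfolding y'_def using A.lin_on_diff[OF less.prems(3)[OF rA(1)]] A.diff_mem y pA by auto
        ultimately show ?thesis using gr rA by simp
      qed
      then show "r \<in> {a \<in> A. \<forall>b\<in>A. g a b = 0}" using rA by blast
    next
      fix r assume "r \<in> {a \<in> A. \<forall>b\<in>A. g a b = 0}"
      then show "r \<in> {a \<in> A2. \<forall>b\<in>A2. g a b = 0}"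
        using s2 ab e unfolding A2_def A1_def by auto
    qed
    then have "card A = CARD('a) ^ (2 * Suc k) * card {a \<in> A. \<forall>b\<in>A. g a b = 0}"
      using c1 c2 k by simp
    then show ?thesis by blast
  qed
qed

section \<open>Isometries of a quadratic space in characteristic two\<close>

definition prod_scale where
  "prod_scale s t = (\<lambda>c (u, v). (s c u, t c v))"

lemma scaled_subspace_Times:
  assumes "scaled_subspace s A" "scaled_subspace t B"
  shows "scaled_subspace (prod_scale s t) (A \<times> B)"
proof -
  interpret A: scaled_subspace s A by fact
  interpret B: scaled_subspace t B by fact
  show ?thesis
    by unfold_locales (auto simp: prod_scale_def zero_prod_def A.finite_space B.finite_space A.zero_mem B.zero_mem
      A.add_mem B.add_mem A.diff_mem B.diff_mem A.scale_mem B.scale_mem)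
qed

text \<open>Every fibre over the image is a translate of the kernel.\<close>

lemma (in scaled_subspace) card_image_kernel:
  fixes f :: "'b \<Rightarrow> 'c::ab_group_add"
  assumes add: "\<And>x y. x \<in> A \<Longrightarrow> y \<in> A \<Longrightarrow> f (x + y) = f x + f y"
  shows "card A = card (f ` A) * card {x \<in> A. f x = 0}"
proof -
  have fd: "f (x - y) = f x - f y" if "x \<in> A" "y \<in> A" for x y
    using add[OF diff_mem[OF that] that(2)] by (simp add: algebra_simps)
  have "card {x \<in> A. f x = f a} = card {x \<in> A. f x = 0}" if a: "a \<in> A" for a
    by (rule bij_betw_same_card[of "\<lambda>x. x - a"], rule bij_betwI[where g = "\<lambda>x. x + a"])
      (use a fd add add_mem diff_mem in auto)
  then have "card {x \<in> A. f x = y} = card {x \<in> A. f x = 0}" if "y \<in> f ` A" for y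
    using that by blast
  moreover have "card A = (\<Sum>y\<in>f ` A. card {x \<in> A. f x = y})"
    using sum.group[of A "f ` A" f "\<lambda>_. 1 :: nat"] finite_space by simp
  ultimately show ?thesis by simp
qed

text \<open>The polar form is a parameter of its own, tied to \<open>Q\<close> by
  \<open>Q_add\<close>, so that \<open>polar B\<close> can be substituted directly. In
  characteristic two it is symmetric and alternating, and signs disappear.\<close>

locale quadratic_space = scaled_subspace sc V
  for sc :: "'a::{field,finite} \<Rightarrow> 'b::ab_group_add \<Rightarrow> 'b" and V :: "'b set" +
  fixes Q :: "'b \<Rightarrow> 'a" and b :: "'b \<Rightarrow> 'b \<Rightarrow> 'a"
  assumes char2: "(c::'a) + c = 0"
    and sc_add: "u \<in> V \<Longrightarrow> v \<in> V \<Longrightarrow> sc c (u + v) = sc c u + sc c v"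
    and double: "v \<in> V \<Longrightarrow> v + v = 0"
    and Q_add: "u \<in> V \<Longrightarrow> v \<in> V \<Longrightarrow> Q (u + v) = Q u + Q v + b u v"
    and b_lin: "u \<in> V \<Longrightarrow> lin_on sc V (b u)"
    and b_sym: "u \<in> V \<Longrightarrow> v \<in> V \<Longrightarrow> b u v = b v u"
    and b_alt: "v \<in> V \<Longrightarrow> b v v = 0"
    and nondeg: "u \<in> V \<Longrightarrow> (\<And>v. v \<in> V \<Longrightarrow> b u v = 0) \<Longrightarrow> u = 0"
begin

lemma b_lin2: "v \<in> V \<Longrightarrow> lin_on sc V (\<lambda>u. b u v)"
  using b_lin[of v] b_sym[of _ v] add_mem scale_mem unfolding lin_on_def by simp

lemma b_add:
  assumes "u \<in> V" "v \<in> V" "w \<in> V"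
  shows "b u (v + w) = b u v + b u w" "b (v + w) u = b v u + b w u"
  using assms b_lin[of u] b_lin2[of u] unfolding lin_on_def by auto

lemma add_add_cancel: "v \<in> V \<Longrightarrow> w + v + v = w" "v \<in> V \<Longrightarrow> v + (v + w) = w"
  using double[of v] add.assoc[of v v w] by (simp_all add: add.assoc)

lemma add_eq_zeroD: "v \<in> V \<Longrightarrow> u + v = 0 \<Longrightarrow> u = v"
  using add_add_cancel(1)[of v u] by simp

section \<open>Orthogonal complements\<close>

definition perp :: "'b set \<Rightarrow> 'b set" where
  "perp W = {v \<in> V. \<forall>w\<in>W. b w v = 0}"

lemma perp_subspace: 
  assumes "W \<subseteq> V" shows "scaled_subspace sc (perp W)"
proof
  show "finite (perp W)" using finite_space unfolding perp_def by simp
  show "0 \<in> perp W" using zero_mem assms lin_on_zero[OF b_lin] unfolding perp_def by blast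
next
  fix x y assume "x \<in> perp W" "y \<in> perp W"
  then show "x + y \<in> perp W" "x - y \<in> perp W"
    using assms add_mem diff_mem b_add lin_on_diff[OF b_lin] unfolding perp_def by (auto simp: subset_iff)
next
  fix c x assume "x \<in> perp W"
  then show "sc c x \<in> perp W"
    using assms scale_mem b_lin unfolding perp_def lin_on_def by (auto simp: subset_iff)
qed

text \<open>In the pairing of \<open>W\<close> with \<open>V\<close> one radical is the complement
  of \<open>W\<close>, and the other is zero by non-degeneracy.\<close>

lemma card_perp:
  assumes "scaled_subspace sc W" "W \<subseteq> V"
  shows "card W * card (perp W) = card V"
proof -
  interpret W: scaled_subspace sc W by fact
  have "card W * card {v \<in> V. \<forall>w\<in>W. b w v = 0} = card V * card {w \<in> W. \<forall>v\<in>V. b w v = 0}"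
    by (rule card_pairing[OF assms(1) scaled_subspace_axioms])
      (use assms b_lin b_lin2 lin_on_subset in blast)+
  moreover have "{w \<in> W. \<forall>v\<in>V. b w v = 0} = {0}"
    using assms(2) nondeg W.zero_mem lin_on_zero[OF b_lin2] by auto
  ultimately show ?thesis unfolding perp_def by simp
qed

lemma perp_perp:
  assumes "scaled_subspace sc W" "W \<subseteq> V"
  shows "perp (perp W) = W"
proof (rule sym, rule card_subset_eq)
  show "finite (perp (perp W))" using finite_space unfolding perp_def by simp
  show "W \<subseteq> perp (perp W)" using assms b_sym unfolding perp_def by (auto simp: subset_iff)
  have pV: "perp W \<subseteq> V" unfolding perp_def by auto
  have 1: "card (perp W) * card (perp (perp W)) = card V"
    by (rule card_perp[OF perp_subspace[OF assms(2)] pV])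
  have "card V \<noteq> 0" using finite_space zero_mem by auto
  with 1 card_perp[OF assms] show "card W = card (perp (perp W))"
    by (metis mult.commute mult_cancel_left mult_is_0)
qed

section \<open>Isometries, their fixed spaces and the images of x + 1\<close>

definition isometry :: "('b \<Rightarrow> 'b) \<Rightarrow> bool" where
  "isometry x \<longleftrightarrow> (\<forall>v\<in>V. x v \<in> V \<and> Q (x v) = Q v) \<and>
     (\<forall>u\<in>V. \<forall>v\<in>V. x (u + v) = x u + x v) \<and> (\<forall>c. \<forall>v\<in>V. x (sc c v) = sc c (x v)) \<and>
     x ` V = V"

lemma isometryD:
  assumes "isometry x" "u \<in> V" "v \<in> V"
  shows "x v \<in> V" "Q (x v) = Q v" "x (u + v) = x u + x v" "x (sc c v) = sc c (x v)"
    "b (x u) (x v) = b u v"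
proof -
  show "x v \<in> V" "Q (x v) = Q v" "x (u + v) = x u + x v" "x (sc c v) = sc c (x v)"
    using assms unfolding isometry_def by auto
  have "Q (x u + x v) = Q (u + v)" "Q (x u) = Q u" "Q (x v) = Q v" "x u \<in> V" "x v \<in> V"
    using assms add_mem[OF assms(2,3)] unfolding isometry_def by metis+
  then show "b (x u) (x v) = b u v" using Q_add assms by simp
qed

definition fixed :: "('b \<Rightarrow> 'b) \<Rightarrow> 'b set" where
  "fixed x = {v \<in> V. x v = v}"

text \<open>In characteristic two this is x - 1: its kernel is the fixed space, and its image is the
  space on which Wall's form lives.\<close>

abbreviation moved :: "('b \<Rightarrow> 'b) \<Rightarrow> 'b \<Rightarrow> 'b" where
  "moved x v \<equiv> x v + v"

lemma moved_mem: "isometry x \<Longrightarrow> v \<in> V \<Longrightarrow> moved x v \<in> V"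
  using isometryD(1)[of x v v] add_mem by blast

lemma moved_add: "isometry x \<Longrightarrow> u \<in> V \<Longrightarrow> v \<in> V \<Longrightarrow> moved x (u + v) = moved x u + moved x v"
  using isometryD(3)[of x u v] by (simp add: algebra_simps)

lemma fixed_subspace:
  assumes "isometry x"
  shows "scaled_subspace sc (fixed x)"
proof
  show "finite (fixed x)" using finite_space unfolding fixed_def by simp
  have xd: "x (u - v) = x u - x v" if "u \<in> V" "v \<in> V" for u v
    using isometryD(3)[OF assms diff_mem[OF that] that(2)] by (simp add: algebra_simps)
  show "0 \<in> fixed x" using xd[of 0 0] zero_mem unfolding fixed_def by auto
  fix u v assume "u \<in> fixed x" "v \<in> fixed x"
  then show "u + v \<in> fixed x" "u - v \<in> fixed x"
    using isometryD(3)[OF assms] xd add_mem diff_mem unfolding fixed_def by auto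
next
  fix c v assume "v \<in> fixed x"
  then show "sc c v \<in> fixed x"
    using isometryD(4)[OF assms] scale_mem unfolding fixed_def by auto
qed

lemma moved_subspace:
  assumes "isometry x"
  shows "scaled_subspace sc (moved x ` V)"
proof
  show "finite (moved x ` V)" using finite_space by simp
  have md: "moved x (u - v) = moved x u - moved x v" if "u \<in> V" "v \<in> V" for u v
    using moved_add[OF assms diff_mem[OF that] that(2)] by (simp add: algebra_simps)
  show "0 \<in> moved x ` V" using md[of 0 0] zero_mem image_eqI[of 0 "moved x" 0 V] by simp
  fix u v assume "u \<in> moved x ` V" "v \<in> moved x ` V"
  then obtain u' v' where *: "u' \<in> V" "v' \<in> V" "u = moved x u'" "v = moved x v'" by blast
  show "u + v \<in> moved x ` V" 
    by (rule image_eqI[of _ _ "u' + v'"]) (use * moved_add[OF assms *(1,2)] add_mem[OF *(1,2)] in \<open>simp_all only:\<close>)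
  show "u - v \<in> moved x ` V" 
    by (rule image_eqI[of _ _ "u' - v'"]) (use * md[OF *(1,2)] diff_mem[OF *(1,2)] in \<open>simp_all only:\<close>)
next
  fix c v assume "v \<in> moved x ` V"
  then obtain v' where "v' \<in> V" "v = moved x v'" by blast
  then have "sc c v = moved x (sc c v')" "sc c v' \<in> V"
    using isometryD(4)[OF assms] isometryD(1)[OF assms] sc_add scale_mem by auto
  then show "sc c v \<in> moved x ` V" by blast
qed

text \<open>Because b w u = b (x w) (x u), the operator x + 1 moves to the other argument: b w
  (moved x u) = b (moved x w) (x u). Here \<open>x u\<close> runs through all of \<open>V\<close>,
  so non-degeneracy applies.\<close>

lemma perp_moved_iff:
  assumes x: "isometry x" and w: "w \<in> V"
  shows "(\<forall>u\<in>V. b w (moved x u) = 0) \<longleftrightarrow> x w = w"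
proof -
  have eq: "b w (moved x u) = b (moved x w) (x u)" if u: "u \<in> V" for u
  proof -
    have "b w (moved x u) = b w (x u) + b (x w) (x u)"
      using b_add(1)[OF w isometryD(1)[OF x u u] u] isometryD(5)[OF x w u] by simp
    also have "\<dots> = b (moved x w) (x u)"
      using b_add(2)[OF isometryD(1)[OF x u u] isometryD(1)[OF x w w] w] by (simp add: add.commute)
    finally show ?thesis .
  qed
  show ?thesis
  proof
    assume *: "\<forall>u\<in>V. b w (moved x u) = 0"
    have "b (moved x w) v = 0" if "v \<in> V" for v
    proof -
      obtain u where "u \<in> V" "v = x u" using x \<open>v \<in> V\<close> unfolding isometry_def by blast
      then show ?thesis using * eq by simp
    qed
    then have "moved x w = 0" using nondeg moved_mem[OF x w] by blast
    then show "x w = w" using add_eq_zeroD[OF w] by blast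
  next
    assume "x w = w"
    then have "moved x w = 0" using double[OF w] by simp
    then show "\<forall>u\<in>V. b w (moved x u) = 0"
      using eq lin_on_zero[OF b_lin2] isometryD(1)[OF x] by auto
  qed
qed

lemma perp_moved: "isometry x \<Longrightarrow> perp (moved x ` V) = fixed x"
proof -
  assume x: "isometry x"
  have "(\<forall>w\<in>moved x ` V. b w v = 0) \<longleftrightarrow> x v = v" if "v \<in> V" for v
    using perp_moved_iff[OF x that] b_sym[OF that moved_mem[OF x]] by simp
  then show ?thesis unfolding perp_def fixed_def by blast
qed

lemma perp_fixed: "isometry x \<Longrightarrow> perp (fixed x) = moved x ` V"
  using perp_perp[OF moved_subspace[of x]] perp_moved[of x] moved_mem[of x] by (simp add: image_subset_iff)

text \<open>Each image of x + 1 is the complement of a fixed space, so the intersection of two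
  images is the complement of the sum of the fixed spaces; taking complements once more returns the
  sum.\<close>

lemma perp_moved_Int:
  assumes x: "isometry x" and y: "isometry y"
  shows "perp (moved x ` V \<inter> moved y ` V) = {p + r | p r. p \<in> fixed x \<and> r \<in> fixed y}" (is "_ = ?W")
proof -
  interpret X: scaled_subspace sc "fixed x" by (rule fixed_subspace[OF x])
  interpret Y: scaled_subspace sc "fixed y" by (rule fixed_subspace[OF y])
  have fV: "fixed x \<subseteq> V" "fixed y \<subseteq> V" unfolding fixed_def by auto
  have WV: "?W \<subseteq> V" using fV add_mem by auto
  have xW: "fixed x \<subseteq> ?W" "fixed y \<subseteq> ?W" using X.zero_mem Y.zero_mem by force+
  have "perp ?W = perp (fixed x) \<inter> perp (fixed y)"
  proof
    show "perp ?W \<subseteq> perp (fixed x) \<inter> perp (fixed y)" using xW unfolding perp_def by blast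
    show "perp (fixed x) \<inter> perp (fixed y) \<subseteq> perp ?W"
      using fV b_add(2) unfolding perp_def by (auto simp: subset_iff)
  qed
  then have 1: "perp ?W = moved x ` V \<inter> moved y ` V" using perp_fixed x y by simp
  have sW: "scaled_subspace sc ?W"
  proof
    show "finite ?W" using finite_space WV finite_subset by blast
    show "0 \<in> ?W" using xW X.zero_mem by blast
    fix c v assume "v \<in> ?W"
    then obtain p r where "v = p + r" "p \<in> fixed x" "r \<in> fixed y" by blast
    moreover from this have "sc c v = sc c p + sc c r" using sc_add fV by blast
    ultimately show "sc c v \<in> ?W" using X.scale_mem Y.scale_mem by blast
  next
    fix u v assume "u \<in> ?W" "v \<in> ?W"
    then obtain p r p' r' where *: "v = p + r" "p \<in> fixed x" "r \<in> fixed y" "u = p' + r'" "p' \<in> fixed x" "r' \<in> fixed y"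
      by blast
    then have "u + v = (p' + p) + (r' + r)" "u - v = (p' - p) + (r' - r)" by (simp_all add: algebra_simps)
    then show "u + v \<in> ?W" "u - v \<in> ?W"
      using * X.add_mem Y.add_mem X.diff_mem Y.diff_mem by blast+
  qed
  show ?thesis using perp_perp[OF sW WV] 1 by simp
qed


text \<open>The space \<open>K\<close> is counted twice. As the kernel of \<open>s\<close> it has
  |V| |Fix x \<inter> Fix y| elements; carrying the alternating form \<open>g\<close>, it has q^(2k)
  times as many elements as its radical. The radical is the image of Fix(yx) \<times> Fix x \<times>
  Fix y under \<open>m\<close>, whose kernel is a copy of Fix x \<inter> Fix y.\<close>

theorem card_fixed_comp:
  assumes x: "isometry x" and y: "isometry y"
  shows "\<exists>k. card V * card (fixed x \<inter> fixed y) ^ 2 =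
    CARD('a) ^ (2 * k) * (card (fixed x) * card (fixed y) * card (fixed (y \<circ> x)))"
proof -
  let ?sc2 = "prod_scale sc sc"
  define z where "z = y \<circ> x"
  have z: "isometry z"
  proof -
    have "z ` V = y ` (x ` V)" unfolding z_def by (rule image_comp[symmetric])
    then have "z ` V = V" using x y unfolding isometry_def by simp
    then show ?thesis using x y unfolding isometry_def z_def by simp
  qed
  \<comment> \<open>A pair in \<open>K\<close> is an element of the intersection of the two images
    together with a preimage under each operator; on such pairs both Wall forms can be written down
    without choosing preimages.\<close>
  define K where "K = {(u, v) \<in> V \<times> V. moved x u = moved y v}"
  define g :: "'b \<times> 'b \<Rightarrow> 'b \<times> 'b \<Rightarrow> 'a" where "g = (\<lambda>(u, v) (u', v'). b (x u + v) (moved y v'))"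
  \<comment> \<open>With \<open>W\<^sub>x (moved x u) (moved x u') = b u (moved x u')\<close> Wall's form of \<open>x\<close>, this is
    \<open>W\<^sub>x + W\<^sub>y + b (moved x u) (moved y v')\<close> on pairs with equal images; its value on the diagonal is
    \<open>2 Q (moved x u) = 0\<close>.\<close>
  define s where "s = (\<lambda>(u, v). moved x u + moved y v)"
  interpret VV: scaled_subspace ?sc2 "V \<times> V"
    by (rule scaled_subspace_Times[OF scaled_subspace_axioms scaled_subspace_axioms])
  have Xm: "x u \<in> V" "moved x u \<in> V" and Ym: "y u \<in> V" "moved y u \<in> V" if "u \<in> V" for u
    using isometryD(1)[OF x that that] isometryD(1)[OF y that that] moved_mem[OF x that] moved_mem[OF y that] by auto
  have xsc: "x (sc c u) = sc c (x u)" "moved x (sc c u) = sc c (moved x u)"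
    and ysc: "moved y (sc c u) = sc c (moved y u)" if "u \<in> V" for c u
    using isometryD(4)[OF x that that] isometryD(4)[OF y that that] sc_add[OF Xm(1)[OF that] that]
      sc_add[OF Ym(1)[OF that] that] by auto
  have xadd: "x (u + v) = x u + x v" if "u \<in> V" "v \<in> V" for u v using isometryD(3)[OF x that] .
  have bsc: "b u (sc c v) = c * b u v" "b (sc c u) v = c * b u v" if "u \<in> V" "v \<in> V" for c u v
    using b_lin[of u] b_lin2[of v] that unfolding lin_on_def by auto
  have sV: "s e \<in> V" if "e \<in> V \<times> V" for e
    using that add_mem Xm Ym unfolding s_def by auto
  have sadd: "s (e + e') = s e + s e'" if "e \<in> V \<times> V" "e' \<in> V \<times> V" for e e'
    using that moved_add[OF x] moved_add[OF y] unfolding s_def by (auto simp: algebra_simps)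
  have ssc: "s (?sc2 c e) = sc c (s e)" if "e \<in> V \<times> V" for c e
    using that xsc ysc sc_add Xm Ym unfolding s_def prod_scale_def by auto
  have K_eq: "K = {e \<in> V \<times> V. s e = 0}"
    using add_eq_zeroD Ym double unfolding K_def s_def by auto
  have KV: "K \<subseteq> V \<times> V" unfolding K_eq by auto
  have sK: "scaled_subspace ?sc2 K"
  proof
    have sd: "s (e - e') = s e - s e'" if "e \<in> V \<times> V" "e' \<in> V \<times> V" for e e'
      using sadd[OF VV.diff_mem[OF that] that(2)] by (simp only: diff_add_cancel) (simp add: algebra_simps)
    have s0: "s 0 = 0" using sd[OF VV.zero_mem VV.zero_mem] by simp
    show "finite K" using KV VV.finite_space finite_subset by blast
    show "0 \<in> K" using s0 VV.zero_mem unfolding K_eq by blast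
    fix e e' assume "e \<in> K" "e' \<in> K"
    then show "e + e' \<in> K" "e - e' \<in> K"
      using sadd sd VV.add_mem VV.diff_mem unfolding K_eq by auto
  next
    fix c e assume "e \<in> K"
    moreover have "sc c 0 = 0" using sc_add[OF zero_mem zero_mem, of c] by simp
    ultimately show "?sc2 c e \<in> K" using ssc VV.scale_mem unfolding K_eq by auto
  qed

  \<comment> \<open>\<open>K\<close> is the kernel of \<open>s\<close>, and the vectors orthogonal
    to the image of \<open>s\<close> are the common fixed vectors. Pairing \<open>w\<close> with
    \<open>s e\<close> compares the two.\<close>
  have cK: "card K = card V * card (fixed x \<inter> fixed y)"
  proof -
    have "card (V \<times> V) * card {w \<in> V. \<forall>e\<in>V \<times> V. b w (s e) = 0}
        = card V * card {e \<in> V \<times> V. \<forall>w\<in>V. b w (s e) = 0}"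
    proof (rule card_pairing[OF VV.scaled_subspace_axioms scaled_subspace_axioms])
      show "lin_on ?sc2 (V \<times> V) (\<lambda>e. b w (s e))" if "w \<in> V" for w
        unfolding lin_on_def using that sadd ssc sV b_add(1) bsc(1) by auto
      show "lin_on sc V (\<lambda>w. b w (s e))" if "e \<in> V \<times> V" for e
        using b_lin2 sV that by blast
    qed
    moreover have "{w \<in> V. \<forall>e\<in>V \<times> V. b w (s e) = 0} = fixed x \<inter> fixed y"
    proof -
      have "(\<forall>e\<in>V \<times> V. b w (s e) = 0) \<longleftrightarrow> x w = w \<and> y w = w" if w: "w \<in> V" for w
      proof -
        have bs: "b w (s (u, v)) = b w (moved x u) + b w (moved y v)" if "u \<in> V" "v \<in> V" for u v
          using b_add(1)[OF w] Xm Ym that unfolding s_def by simp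
        have m0: "moved x 0 = 0" "moved y 0 = 0"
          using moved_add[OF x zero_mem zero_mem] moved_add[OF y zero_mem zero_mem] by auto
        have b0: "b w 0 = 0" using lin_on_zero[OF b_lin[OF w]] .
        have "(\<forall>e\<in>V \<times> V. b w (s e) = 0) \<longleftrightarrow>
          (\<forall>u\<in>V. b w (moved x u) = 0) \<and> (\<forall>v\<in>V. b w (moved y v) = 0)" (is "?l \<longleftrightarrow> ?r")
        proof
          assume l: ?l
          have "b w (moved x u) = 0" if "u \<in> V" for u
            using l[rule_format, of "(u, 0)"] bs[OF that zero_mem] that zero_mem m0 b0 by simp
          moreover have "b w (moved y v) = 0" if "v \<in> V" for v
            using l[rule_format, of "(0, v)"] bs[OF zero_mem that] that zero_mem m0 b0 by simp
          ultimately show ?r by blast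
        qed (use bs in auto)
        then show ?thesis using perp_moved_iff[OF x w] perp_moved_iff[OF y w] by simp
      qed
      then show ?thesis unfolding fixed_def by blast
    qed
    moreover have "{e \<in> V \<times> V. \<forall>w\<in>V. b w (s e) = 0} = K"
    proof -
      have "(\<forall>w\<in>V. b w (s e) = 0) \<longleftrightarrow> s e = 0" if e: "e \<in> V \<times> V" for e
        using nondeg[OF sV[OF e]] b_sym[OF sV[OF e]] lin_on_zero[OF b_lin] by metis
      then show ?thesis unfolding K_eq by blast
    qed
    ultimately have "card V * (card V * card (fixed x \<inter> fixed y)) = card V * card K"
      by (simp add: card_cartesian_product mult.assoc)
    moreover have "card V \<noteq> 0" using finite_space zero_mem by auto
    ultimately show ?thesis by simp
  qed

  have "\<exists>k. card K = CARD('a) ^ (2 * k) * card {e \<in> K. \<forall>e'\<in>K. g e e' = 0}"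
  proof (rule card_alternating[OF sK])
    show "lin_on ?sc2 K (\<lambda>e. g e e')" if mem: "e' \<in> K" for e'
    proof -
      obtain u' v' where e': "e' = (u', v')" "u' \<in> V" "v' \<in> V" using mem KV by blast
      have t: "x (u1 + u2) + (v1 + v2) = (x u1 + v1) + (x u2 + v2)" if "u1 \<in> V" "u2 \<in> V" for u1 u2 v1 v2
        using xadd[OF that] by (simp add: algebra_simps)
      have t': "x (sc c u) + sc c v = sc c (x u + v)" if "u \<in> V" "v \<in> V" for c u v
        using xsc(1)[OF that(1)] sc_add[OF Xm(1)[OF that(1)] that(2)] by simp
      show ?thesis unfolding lin_on_def g_def prod_scale_def
        using KV e' t t' Xm(1) Ym(2) b_add(2) bsc(2) add_mem by (auto simp: subset_iff)
    qed
    show "lin_on ?sc2 K (g e)" if mem: "e \<in> K" for e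
    proof -
      obtain u v where e: "e = (u, v)" "u \<in> V" "v \<in> V" using mem KV by blast
      then have w: "x u + v \<in> V" using Xm(1) add_mem by blast
      have t: "b (x u + v) (moved y (v1 + v2)) = b (x u + v) (moved y v1) + b (x u + v) (moved y v2)"
        if "v1 \<in> V" "v2 \<in> V" for v1 v2
        unfolding moved_add[OF y that] by (rule b_add(1)[OF w Ym(2)[OF that(1)] Ym(2)[OF that(2)]])
      show ?thesis unfolding lin_on_def g_def prod_scale_def
        using KV e t ysc bsc(1)[OF w] Ym(2) by (auto simp: subset_iff)
    qed
    show "g e e = 0" if mem: "e \<in> K" for e
    proof -
      obtain u v where e: "e = (u, v)" "u \<in> V" "v \<in> V" "moved x u = moved y v"
        using mem unfolding K_def by blast
      \<comment> \<open>The left side is b (x u) u, and Q (x u + u) = Q (x u) + Q u + b (x u) u,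
        where the first two terms are equal and cancel.\<close>
      have Qm: "b (x u) (moved x u) = Q (moved x u)" if "isometry x" "u \<in> V" for x u
        using b_add(1)[of "x u" "x u" u] b_alt[of "x u"] isometryD(1,2)[OF that(1) that(2) that(2)]
          Q_add[of "x u" u] that(2) char2[of "Q u"] by simp
      have Qm': "b v (moved y v) = Q (moved y v)"
        using b_add(1)[of v "y v" v] b_alt[of v] b_sym[of v "y v"] isometryD(1,2)[OF y e(3) e(3)]
          Q_add[of "y v" v] e(3) char2[of "Q v"] by simp
      have "g e e = b (x u) (moved y v) + b v (moved y v)"
        unfolding g_def using e b_add(2)[OF Ym(2)[OF e(3)] Xm(1)[OF e(2)] e(3)] by simp
      also have "\<dots> = Q (moved y v) + Q (moved y v)"
        using Qm[OF x e(2)] Qm' e(4) by simp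
      finally show ?thesis using char2 by simp
    qed
  qed
  then obtain k where k: "card K = CARD('a) ^ (2 * k) * card {e \<in> K. \<forall>e'\<in>K. g e e' = 0}" ..

  interpret X: scaled_subspace sc "fixed x" by (rule fixed_subspace[OF x])
  interpret Y: scaled_subspace sc "fixed y" by (rule fixed_subspace[OF y])
  interpret T: scaled_subspace "prod_scale sc (prod_scale sc sc)" "fixed z \<times> fixed x \<times> fixed y"
    by (intro scaled_subspace_Times fixed_subspace x y z)
  \<comment> \<open>Three kinds of pairs lie in the radical for evident reasons: (u, x u) with
    \<open>u\<close> fixed by \<open>y \<circ> x\<close>, (p, 0) with \<open>p\<close> fixed by
    \<open>x\<close>, and (0, r) with \<open>r\<close> fixed by \<open>y\<close>. \<open>m\<close>
    adds them up.\<close>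
  define m where "m = (\<lambda>(u, p, r). (u + p, x u + r))"
  have fV: "fixed x \<subseteq> V" "fixed y \<subseteq> V" "fixed z \<subseteq> V" unfolding fixed_def by auto
  have rad: "{e \<in> K. \<forall>e'\<in>K. g e e' = 0} = m ` (fixed z \<times> fixed x \<times> fixed y)" 
  proof (intro equalityI subsetI)
    fix e assume e: "e \<in> {e \<in> K. \<forall>e'\<in>K. g e e' = 0}"
    then obtain u v where uv: "e = (u, v)" "u \<in> V" "v \<in> V" "moved x u = moved y v"
      unfolding K_def by blast
    have wV: "x u + v \<in> V" using add_mem Xm uv by blast
    have "x u + v \<in> perp (moved x ` V \<inter> moved y ` V)"
    proof -
      have "b a (x u + v) = 0" if a: "a \<in> moved x ` V \<inter> moved y ` V" for a
      proof -
        obtain u' v' where *: "u' \<in> V" "v' \<in> V" "a = moved x u'" "a = moved y v'" using a by blast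
        then have "(u', v') \<in> K" unfolding K_def by auto
        then have "g e (u', v') = 0" using e by blast
        then have "b (x u + v) a = 0" using * uv unfolding g_def by simp
        then show ?thesis using b_sym[OF wV Ym(2)[OF *(2)]] * by simp
      qed
      then show ?thesis using wV unfolding perp_def by blast
    qed
    then obtain p r where pr: "p \<in> fixed x" "r \<in> fixed y" "x u + v = p + r"
      using perp_moved_Int[OF x y] by blast
    have prV: "p \<in> V" "r \<in> V" "x p = p" "y r = r" using pr unfolding fixed_def by auto
    \<comment> \<open>Removing (p, r) from (u, v) leaves (u1, x u1), which is still in
      \<open>K\<close>; equality of the two images then says that
      \<open>y (x u1) = u1\<close>.\<close>
    define u1 where "u1 = u + p"
    have u1V: "u1 \<in> V" unfolding u1_def using add_mem uv prV by blast
    have xu1: "x u1 = v + r"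
    proof -
      have "x u1 = x u + p" using xadd uv prV unfolding u1_def by simp
      moreover have "x u = p + r + v" using pr(3) add_add_cancel(1)[OF uv(3), of "x u"] by simp
      ultimately show ?thesis using add_add_cancel(2)[OF prV(1), of "r + v"] by (simp add: algebra_simps)
    qed
    have "moved x u1 = moved x u" using moved_add[OF x uv(2) prV(1)] prV double unfolding u1_def by simp
    also have "\<dots> = moved y v" by (rule uv)
    also have "\<dots> = moved y (v + r)" using moved_add[OF y uv(3) prV(2)] prV double by simp
    also have "\<dots> = y (x u1) + x u1" using xu1 by simp
    finally have "y (x u1) = u1" by (simp add: add.commute)
    then have "u1 \<in> fixed z" using u1V unfolding fixed_def z_def by simp
    moreover have "e = m (u1, p, r)"
      using uv xu1 add_add_cancel(1)[OF prV(1), of u] add_add_cancel(1)[OF prV(2), of v] unfolding m_def u1_def by simp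
    ultimately show "e \<in> m ` (fixed z \<times> fixed x \<times> fixed y)" using pr by blast
  next
    fix e assume "e \<in> m ` (fixed z \<times> fixed x \<times> fixed y)"
    then obtain u p r where *: "u \<in> fixed z" "p \<in> fixed x" "r \<in> fixed y" "e = (u + p, x u + r)"
      unfolding m_def by auto
    then have V: "u \<in> V" "p \<in> V" "r \<in> V" and eqs: "y (x u) = u" "x p = p" "y r = r"
      unfolding fixed_def z_def by auto
    have 1: "moved x (u + p) = moved x u" "moved y (x u + r) = moved y (x u)"
      using moved_add[OF x V(1,2)] moved_add[OF y Xm(1)[OF V(1)] V(3)] eqs V double by auto
    have "moved x (u + p) = moved y (x u + r)"
      unfolding 1 using eqs by (simp add: add.commute)
    then have eK: "e \<in> K" unfolding K_def *(4)
      using V add_mem Xm(1) by simp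
    have "g e e' = 0" if mem: "e' \<in> K" for e'
    proof -
      obtain u' v' where e': "e' = (u', v')" "u' \<in> V" "v' \<in> V" "moved x u' = moved y v'"
        using mem unfolding K_def by blast
      have "x (u + p) + (x u + r) = p + r"
        using xadd[OF V(1,2)] eqs add_add_cancel(2)[OF Xm(1)[OF V(1)], of "p + r"] by (simp add: algebra_simps)
      then have "g e e' = b (p + r) (moved y v')" unfolding g_def *(4) e'(1) by (simp only: prod.case)
      also have "\<dots> = b p (moved x u') + b r (moved y v')"
        using b_add(2)[OF Ym(2)[OF e'(3)] V(2,3)] e'(4) by simp
      also have "\<dots> = 0"
      proof -
        have "b p (moved x u') = 0" "b r (moved y v') = 0"
          using perp_moved_iff[OF x V(2)] perp_moved_iff[OF y V(3)] eqs e' by blast+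
        then show ?thesis by simp
      qed
      finally show ?thesis .
    qed
    then show "e \<in> {e \<in> K. \<forall>e'\<in>K. g e e' = 0}" using eK by blast
  qed
  have "card (fixed z \<times> fixed x \<times> fixed y) = card (m ` (fixed z \<times> fixed x \<times> fixed y)) *
      card {t \<in> fixed z \<times> fixed x \<times> fixed y. m t = 0}"
    by (rule T.card_image_kernel) (use xadd fV in \<open>auto simp: m_def algebra_simps subset_iff\<close>)
  moreover have "card {t \<in> fixed z \<times> fixed x \<times> fixed y. m t = 0} = card (fixed x \<inter> fixed y)"
  proof -
    \<comment> \<open>From \<open>u + p = 0\<close> follows \<open>u = p\<close>, fixed by
      \<open>x\<close>; then \<open>r = x u = u\<close>. So the kernel is the diagonal over the
      common fixed space.\<close>
    have "{t \<in> fixed z \<times> fixed x \<times> fixed y. m t = 0} = (\<lambda>u. (u, u, u)) ` (fixed x \<inter> fixed y)"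
    proof (intro equalityI subsetI)
      fix t assume "t \<in> {t \<in> fixed z \<times> fixed x \<times> fixed y. m t = 0}"
      then obtain u p r where *: "t = (u, p, r)" "u \<in> fixed z" "p \<in> fixed x" "r \<in> fixed y" "u + p = 0" "x u + r = 0"
        unfolding m_def zero_prod_def by auto
      then have "u = p" "x u = r" using add_eq_zeroD fV by blast+
      then show "t \<in> (\<lambda>u. (u, u, u)) ` (fixed x \<inter> fixed y)" using * unfolding fixed_def by auto
    next
      fix t assume "t \<in> (\<lambda>u. (u, u, u)) ` (fixed x \<inter> fixed y)"
      then show "t \<in> {t \<in> fixed z \<times> fixed x \<times> fixed y. m t = 0}"
        using double unfolding fixed_def z_def m_def zero_prod_def by auto
    qed
    then show ?thesis by (simp add: card_image inj_on_def)
  qed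
  ultimately have c: "card (fixed z) * (card (fixed x) * card (fixed y)) =
      card {e \<in> K. \<forall>e'\<in>K. g e e' = 0} * card (fixed x \<inter> fixed y)"
    using rad by (simp add: card_cartesian_product)
  have "card V * card (fixed x \<inter> fixed y) ^ 2 = card K * card (fixed x \<inter> fixed y)"
    using cK by (simp add: power2_eq_square)
  also have "\<dots> = CARD('a) ^ (2 * k) * (card {e \<in> K. \<forall>e'\<in>K. g e e' = 0} * card (fixed x \<inter> fixed y))"
    using k by simp
  also have "\<dots> = CARD('a) ^ (2 * k) * (card (fixed x) * card (fixed y) * card (fixed z))"
    using c by (simp add: mult_ac)
  finally show ?thesis unfolding z_def by blast
qed

end

section \<open>Rank and kernel of a matrix over a finite field\<close>

text \<open>If 2 were non-zero, no non-zero \<open>x\<close> would equal \<open>- x\<close>, the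
  pairs {x, - x} would partition the non-zero elements, and the field would have odd size.\<close>

lemma char_two_if_even_card:
  assumes "even CARD('a::{field,finite})"
  shows "(c::'a) + c = 0"
proof (rule ccontr)
  assume c: "c + c \<noteq> 0"
  have two: "(2::'a) \<noteq> 0" using c mult_2[of c] by (metis mult_zero_left)
  have ne: "x \<noteq> - x" if "x \<noteq> 0" for x :: 'a
  proof
    assume "x = - x"
    then have "x + x = 0" by (simp only: eq_neg_iff_add_eq_0)
    then have "2 * x = 0" unfolding mult_2 .
    then show False using two that by simp
  qed
  let ?P = "(\<lambda>x::'a. {x, - x}) ` (UNIV - {0})"
  have U: "\<Union>?P = UNIV - {0}" by auto
  have "2 * card ?P = card (\<Union>?P)"
  proof (rule card_partition)
    fix c assume "c \<in> ?P"
    then obtain x where x: "x \<noteq> 0" "c = {x, - x}" by blast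
    then show "card c = 2" using ne[OF x(1)] by (simp only: card_2_iff) blast
  next
    fix c c' assume c: "c \<in> ?P" "c' \<in> ?P" "c \<noteq> c'"
    have "c = {z, - z}" if "c \<in> ?P" "z \<in> c" for c z using that by auto
    then show "c \<inter> c' = {}" using c by blast
  qed simp_all
  then have "even (card (UNIV - {0 :: 'a}))" unfolding U by (metis dvd_triv_left)
  moreover have "CARD('a) = Suc (card (UNIV - {0 :: 'a}))"
    by (metis UNIV_I card.remove finite)
  ultimately show False using assms by (metis even_Suc)
qed

section \<open>Coordinate vectors as functions on the natural numbers\<close>

definition fun_scale :: "'a::times \<Rightarrow> ('i \<Rightarrow> 'a) \<Rightarrow> ('i \<Rightarrow> 'a)" where
  "fun_scale c f = (\<lambda>i. c * f i)"

text \<open>Vectors of all dimensions share one type, which is therefore not a group under addition.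
  Functions vanishing from \<open>n\<close> on do lie in a group, so the counting results apply to
  them, and \<open>fun_of_vec\<close> carries these back to vectors.\<close>

definition fun_space :: "nat \<Rightarrow> (nat \<Rightarrow> 'a::zero) set" where
  "fun_space n = {f. \<forall>i\<ge>n. f i = 0}"

definition fun_of_vec :: "'a::zero vec \<Rightarrow> (nat \<Rightarrow> 'a)" where
  "fun_of_vec v = (\<lambda>i. if i < dim_vec v then v $ i else 0)"

lemma fun_of_vec_mem: "v \<in> carrier_vec n \<Longrightarrow> fun_of_vec v \<in> fun_space n"
  unfolding fun_of_vec_def fun_space_def by auto

lemma vec_fun_of_vec: "v \<in> carrier_vec n \<Longrightarrow> vec n (fun_of_vec v) = v"
  unfolding fun_of_vec_def by auto

lemma fun_of_vec_vec: "f \<in> fun_space n \<Longrightarrow> fun_of_vec (vec n f) = f"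
  unfolding fun_of_vec_def fun_space_def by (auto simp: fun_eq_iff)

lemma vec_add_fun: "vec n (f + g) = vec n f + vec n g"
  by auto

lemma vec_scale_fun: "vec n (fun_scale c f) = c \<cdot>\<^sub>v vec n f"
  unfolding fun_scale_def by auto

lemma fun_of_vec_add: "u \<in> carrier_vec n \<Longrightarrow> v \<in> carrier_vec n \<Longrightarrow> 
    fun_of_vec (u + v) = fun_of_vec u + fun_of_vec (v :: 'a::monoid_add vec)"
  unfolding fun_of_vec_def by (auto simp: fun_eq_iff)

lemma fun_of_vec_scale: "fun_of_vec (c \<cdot>\<^sub>v v) = fun_scale c (fun_of_vec (v :: 'a::mult_zero vec))"
  unfolding fun_of_vec_def fun_scale_def by (auto simp: fun_eq_iff)

lemma bij_fun_of_vec: "bij_betw fun_of_vec (carrier_vec n) (fun_space n)"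
  by (rule bij_betwI[where g = "vec n"]) (auto simp: fun_of_vec_mem vec_fun_of_vec fun_of_vec_vec)

lemma finite_fun_space: "finite (fun_space n :: (nat \<Rightarrow> 'a::{zero,finite}) set)"
proof -
  have "fun_space n = {f. \<forall>x. (x \<in> {..<n} \<longrightarrow> f x \<in> (UNIV::'a set)) \<and> (x \<notin> {..<n} \<longrightarrow> f x = 0)}"
    unfolding fun_space_def by auto
  then show ?thesis using finite_set_of_finite_funs[of "{..<n}" "UNIV :: 'a set" 0] by simp
qed

lemma finite_carrier_vec': "finite (carrier_vec n :: 'a::{zero,finite} vec set)"
  using bij_betw_finite[OF bij_fun_of_vec] finite_fun_space by blast

lemma fun_space_subspace: "scaled_subspace (fun_scale :: 'a::{field,finite} \<Rightarrow> _) (fun_space n)"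
  by unfold_locales (auto simp: finite_fun_space, auto simp: fun_space_def fun_scale_def)

lemma lin_on_coordinate: "lin_on fun_scale W (\<lambda>f. f i)"
  unfolding lin_on_def fun_scale_def by auto

lemma card_fun_space: "card (fun_space n :: (nat \<Rightarrow> 'a::{field,finite}) set) = CARD('a) ^ n"
proof (induction n)
  case 0
  have "fun_space 0 = {\<lambda>_. 0 :: 'a}" unfolding fun_space_def by auto
  then show ?case by simp
next
  case (Suc n)
  interpret scaled_subspace "fun_scale :: 'a \<Rightarrow> _" "fun_space (Suc n)" by (rule fun_space_subspace)
  have "card (fun_space (Suc n) :: (nat \<Rightarrow> 'a) set) = CARD('a) * card {f \<in> fun_space (Suc n). f n = (0::'a)}"
    by (rule card_kernel[OF lin_on_coordinate, of "\<lambda>i. if i = n then 1 else 0"]) (auto simp: fun_space_def)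
  moreover have "{f \<in> fun_space (Suc n). f n = (0::'a)} = fun_space n"
    unfolding fun_space_def by (auto simp: Suc_le_eq) (metis le_neq_implies_less)
  ultimately show ?case using Suc by simp
qed

lemma card_carrier_vec': "card (carrier_vec n :: 'a::{field,finite} vec set) = CARD('a) ^ n"
  using bij_betw_same_card[OF bij_fun_of_vec] card_fun_space by metis

text \<open>A non-zero vector has a non-zero coordinate, and the kernel of that coordinate is
  smaller by exactly one factor CARD('a). The exponent is the dimension.\<close>

lemma card_subspace_power:
  assumes "scaled_subspace (fun_scale :: 'a::{field,finite} \<Rightarrow> _) W"
  shows "\<exists>d. card W = CARD('a) ^ d"
  using assms
proof (induction "card W" arbitrary: W rule: less_induct)
  case less
  interpret scaled_subspace fun_scale W by fact
  show ?case
  proof (cases "W = {0}")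
    case True
    then show ?thesis by (intro exI[of _ 0]) simp
  next
    case False
    then obtain w where w: "w \<in> W" "w \<noteq> 0" using zero_mem by blast
    then obtain i where i: "w i \<noteq> 0" by (auto simp: fun_eq_iff)
    have 1: "card W = CARD('a) * card {f \<in> W. f i = 0}"
      by (rule card_kernel[OF lin_on_coordinate w(1) i])
    have "{f \<in> W. f i = 0} \<subset> W" using w i by blast
    then have "card {f \<in> W. f i = 0} < card W" using finite_space psubset_card_mono by blast
    then obtain d where "card {f \<in> W. f i = 0} = CARD('a) ^ d"
      using less.hyps kernel_subspace[OF lin_on_coordinate] by blast
    then have "card W = CARD('a) ^ Suc d" using 1 by simp
    then show ?thesis by blast
  qed
qed

text \<open>The two kernels are the two radicals of the pairing of \<open>a\<close> and
  \<open>b\<close> by the scalar product of \<open>a\<close> with \<open>A b\<close>, and the paired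
  spaces have the same size.\<close>

lemma card_row_kernel_col_kernel:
  assumes A: "(A :: 'a::{field,finite} mat) \<in> carrier_mat n n"
  shows "card {v \<in> carrier_vec n. A\<^sup>T *\<^sub>v v = 0\<^sub>v n} = card {v \<in> carrier_vec n. A *\<^sub>v v = 0\<^sub>v n}"
proof -
  define g where "g = (\<lambda>a b. vec n a \<bullet> (A *\<^sub>v vec n b))"
  have g2: "g a b = (A\<^sup>T *\<^sub>v vec n a) \<bullet> vec n b" for a b
    unfolding g_def using A by (subst transpose_vec_mult_scalar[of A n n]) auto
  have "card (fun_space n :: (nat \<Rightarrow> 'a) set) * card {b \<in> fun_space n. \<forall>a\<in>fun_space n. g a b = 0}
    = card (fun_space n :: (nat \<Rightarrow> 'a) set) * card {a \<in> fun_space n. \<forall>b\<in>fun_space n. g a b = 0}"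
  proof (rule card_pairing[OF fun_space_subspace fun_space_subspace])
    show "lin_on fun_scale (fun_space n) (\<lambda>a. g a b)" for b
      unfolding lin_on_def g_def vec_add_fun vec_scale_fun using A
      by (auto intro!: add_scalar_prod_distrib[of _ n] smult_scalar_prod_distrib[of _ n])
    show "lin_on fun_scale (fun_space n) (g a)" for a
      unfolding lin_on_def g2 vec_add_fun vec_scale_fun using A
      by (auto intro!: scalar_prod_add_distrib[of _ n] scalar_prod_smult_distrib[of _ n])
  qed
  moreover have "card (fun_space n :: (nat \<Rightarrow> 'a) set) \<noteq> 0" by (simp add: card_fun_space)
  ultimately have eq: "card {b \<in> fun_space n. \<forall>a\<in>fun_space n. g a b = 0} = card {a \<in> fun_space n. \<forall>b\<in>fun_space n. g a b = 0}"
    by simp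
  have zero: "w = 0\<^sub>v n" if "w \<in> carrier_vec n" "\<And>i. i < n \<Longrightarrow> w \<bullet> unit_vec n i = 0" for w :: "'a vec"
    using that by (intro eq_vecI) auto
  have zero': "w = 0\<^sub>v n" if "w \<in> carrier_vec n" "\<And>i. i < n \<Longrightarrow> unit_vec n i \<bullet> w = 0" for w :: "'a vec"
    using that by (intro eq_vecI) auto
  have img: "P (vec n f)" if "\<forall>f\<in>fun_space n. P (vec n f)" for P and f :: "nat \<Rightarrow> 'a"
  proof -
    have "(\<lambda>i. if i < n then f i else 0) \<in> fun_space n" unfolding fun_space_def by simp
    moreover have "vec n (\<lambda>i. if i < n then f i else 0) = vec n f" by auto
    ultimately show ?thesis using that by metis
  qed
  have b1: "bij_betw fun_of_vec {v \<in> carrier_vec n. A *\<^sub>v v = 0\<^sub>v n} {b \<in> fun_space n. \<forall>a\<in>fun_space n. g a b = 0}"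
  proof (rule bij_betwI[where g = "vec n"])
    show "fun_of_vec \<in> {v \<in> carrier_vec n. A *\<^sub>v v = 0\<^sub>v n} \<rightarrow> {b \<in> fun_space n. \<forall>a\<in>fun_space n. g a b = 0}"
      unfolding g_def by (auto simp: fun_of_vec_mem vec_fun_of_vec)
    show "vec n \<in> {b \<in> fun_space n. \<forall>a\<in>fun_space n. g a b = 0} \<rightarrow> {v \<in> carrier_vec n. A *\<^sub>v v = 0\<^sub>v n}"
    proof
      fix b assume b: "b \<in> {b \<in> fun_space n. \<forall>a\<in>fun_space n. g a b = 0}"
      then have "vec n f \<bullet> (A *\<^sub>v vec n b) = 0" for f
        by (intro img[of "\<lambda>v. v \<bullet> (A *\<^sub>v vec n b) = 0"]) (auto simp: g_def)
      then have u: "unit_vec n i \<bullet> (A *\<^sub>v vec n b) = 0" for i unfolding unit_vec_def by blast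
      have "A *\<^sub>v vec n b = 0\<^sub>v n" by (rule zero') (use A u in auto)
      then show "vec n b \<in> {v \<in> carrier_vec n. A *\<^sub>v v = 0\<^sub>v n}" by simp
    qed
  qed (auto simp: vec_fun_of_vec fun_of_vec_vec)
  have b2: "bij_betw fun_of_vec {v \<in> carrier_vec n. A\<^sup>T *\<^sub>v v = 0\<^sub>v n} {a \<in> fun_space n. \<forall>b\<in>fun_space n. g a b = 0}"
  proof (rule bij_betwI[where g = "vec n"])
    show "fun_of_vec \<in> {v \<in> carrier_vec n. A\<^sup>T *\<^sub>v v = 0\<^sub>v n} \<rightarrow> {b \<in> fun_space n. \<forall>a\<in>fun_space n. g b a = 0}"
      unfolding g2 by (auto simp: fun_of_vec_mem vec_fun_of_vec)
    show "vec n \<in> {b \<in> fun_space n. \<forall>a\<in>fun_space n. g b a = 0} \<rightarrow> {v \<in> carrier_vec n. A\<^sup>T *\<^sub>v v = 0\<^sub>v n}"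
    proof
      fix b assume b: "b \<in> {b \<in> fun_space n. \<forall>a\<in>fun_space n. g b a = 0}"
      then have "(A\<^sup>T *\<^sub>v vec n b) \<bullet> vec n f = 0" for f
        by (intro img[of "\<lambda>v. (A\<^sup>T *\<^sub>v vec n b) \<bullet> v = 0"]) (auto simp: g2)
      then have u: "(A\<^sup>T *\<^sub>v vec n b) \<bullet> unit_vec n i = 0" for i unfolding unit_vec_def by blast
      have "A\<^sup>T *\<^sub>v vec n b = 0\<^sub>v n" by (rule zero) (use A u in auto)
      then show "vec n b \<in> {v \<in> carrier_vec n. A\<^sup>T *\<^sub>v v = 0\<^sub>v n}" by simp
    qed
  qed (auto simp: vec_fun_of_vec fun_of_vec_vec)
  show ?thesis using eq bij_betw_same_card[OF b1] bij_betw_same_card[OF b2] by simp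
qed

lemma card_image_mat:
  assumes A: "(A :: 'a::{field,finite} mat) \<in> carrier_mat n n"
  shows "card ((*\<^sub>v) A ` carrier_vec n) * card {v \<in> carrier_vec n. A *\<^sub>v v = 0\<^sub>v n} = CARD('a) ^ n"
proof -
  interpret scaled_subspace "fun_scale :: 'a \<Rightarrow> _" "fun_space n" by (rule fun_space_subspace)
  let ?f = "\<lambda>a. fun_of_vec (A *\<^sub>v vec n a)"
  have "card (fun_space n :: (nat \<Rightarrow> 'a) set) = card (?f ` fun_space n) * card {a \<in> fun_space n. ?f a = 0}"
  proof (rule card_image_kernel)
    show "?f (x + y) = ?f x + ?f y" for x y
      unfolding vec_add_fun using A
      by (subst mult_add_distrib_mat_vec[of A n n]) (auto intro!: fun_of_vec_add[of _ n])
  qed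
  moreover have "card (?f ` fun_space n) = card ((*\<^sub>v) A ` carrier_vec n)"
  proof -
    have "?f ` fun_space n = fun_of_vec ` ((*\<^sub>v) A ` (vec n ` fun_space n))" by auto
    also have "vec n ` fun_space n = (carrier_vec n :: 'a vec set)"
      by (rule bij_betw_imp_surj_on[OF bij_betwI[where g = fun_of_vec]])
        (auto simp: fun_of_vec_mem vec_fun_of_vec fun_of_vec_vec)
    moreover have "inj_on fun_of_vec ((*\<^sub>v) A ` carrier_vec n)"
      by (rule inj_on_subset[OF bij_betw_imp_inj_on[OF bij_fun_of_vec[of n]]]) (use A in auto)
    ultimately show ?thesis by (simp add: card_image)
  qed
  moreover have "card {a \<in> fun_space n. ?f a = 0} = card {v \<in> carrier_vec n. A *\<^sub>v v = 0\<^sub>v n}"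
  proof (rule sym, rule bij_betw_same_card, rule bij_betwI[where f = fun_of_vec and g = "vec n"])
    have z: "fun_of_vec (0\<^sub>v n) = (0 :: nat \<Rightarrow> 'a)" unfolding fun_of_vec_def by auto
    then show "fun_of_vec \<in> {v \<in> carrier_vec n. A *\<^sub>v v = 0\<^sub>v n} \<rightarrow> {a \<in> fun_space n. ?f a = 0}"
      by (auto simp: fun_of_vec_mem vec_fun_of_vec)
    have "w = 0\<^sub>v n" if "w \<in> carrier_vec n" "fun_of_vec w = 0" for w :: "'a vec"
      using inj_onD[OF bij_betw_imp_inj_on[OF bij_fun_of_vec], of w "0\<^sub>v n" n] that z by simp
    then show "vec n \<in> {a \<in> fun_space n. ?f a = 0} \<rightarrow> {v \<in> carrier_vec n. A *\<^sub>v v = 0\<^sub>v n}"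
      using A by auto
  qed (auto simp: vec_fun_of_vec fun_of_vec_vec)
  ultimately show ?thesis by (simp add: card_fun_space)
qed

text \<open>A maximal independent set of columns forms a matrix \<open>M\<close> with the same image
  as \<open>A\<close>. Multiplication by \<open>M\<close> is injective, so the image has as many
  elements as the coordinate space of dimension \<open>rank A\<close>.\<close>

lemma card_image_rank:
  assumes A: "(A :: 'a::{field,finite} mat) \<in> carrier_mat n n"
  shows "card ((*\<^sub>v) A ` carrier_vec n) = CARD('a) ^ vec_space.rank n A"
proof -
  interpret vec_space "TYPE('a)" n .
  have cA: "set (cols A) \<subseteq> carrier_vec n" using cols_dim A by blast
  have li0: "lin_indpt {}" unfolding lin_dep_def by auto
  obtain S where S: "maximal S (\<lambda>T. T \<subseteq> set (cols A) \<and> lin_indpt T)"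
    using maximal_exists_superset[of "set (cols A)" "\<lambda>T. T \<subseteq> set (cols A) \<and> lin_indpt T" "{}"] li0 by auto
  have r: "rank A = card S" by (rule rank_card_indpt[OF A S])
  have SA: "S \<subseteq> set (cols A)" and liS: "lin_indpt S" using S unfolding maximal_def by auto
  have Sc: "S \<subseteq> carrier_vec n" and finS: "finite S" using SA cA finite_subset by auto
  obtain bs where bs: "set bs = S" "distinct bs" using finite_distinct_list[OF finS] by blast
  define M where "M = mat_of_cols n bs"
  define k where "k = length bs"
  have M: "M \<in> carrier_mat n k" unfolding M_def k_def by simp
  have colsM: "cols M = bs" unfolding M_def using bs Sc by (intro cols_mat_of_cols) auto
  have k: "k = card S" unfolding k_def using bs distinct_card by metis
  have inS: "v \<in> span S" if v: "v \<in> set (cols A)" for v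
  proof (rule ccontr)
    assume nv: "v \<notin> span S"
    then have "v \<notin> S" using span_mem Sc by auto
    moreover have "lin_indpt (S \<union> {v})" using lin_dep_iff_in_span[of S v] Sc cA liS v nv \<open>v \<notin> S\<close> by auto
    ultimately show False using S SA v unfolding maximal_def by auto
  qed
  have Mimg: "\<exists>y\<in>carrier_vec k. v = M *\<^sub>v y" if v: "v \<in> set (cols A)" for v
  proof -
    obtain a where "v = lincomb a S" using inS[OF v] finite_span[OF finS] Sc by auto
    then have "v = M *\<^sub>v vec k (\<lambda>i. a (col M i))"
      using mat_mult_eq_lincomb[OF M] colsM bs by simp
    then show ?thesis by auto
  qed
  have "(*\<^sub>v) A ` carrier_vec n = (*\<^sub>v) M ` carrier_vec k"
  proof
    obtain y where y: "\<And>v. v \<in> set (cols A) \<Longrightarrow> y v \<in> carrier_vec k \<and> v = M *\<^sub>v y v"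
      using Mimg by metis
    \<comment> \<open>The columns of \<open>C\<close> hold the coordinates of the columns of
      \<open>A\<close> in the chosen basis, so that \<open>A = M * C\<close>.\<close>
    define C where "C = mat_of_cols k (map y (cols A))"
    have C: "C \<in> carrier_mat k n" unfolding C_def using A by auto
    have "A = M * C"
    proof (rule mat_col_eqI)
      fix i assume i: "i < dim_col (M * C)"
      then have i: "i < n" using C by simp
      have "col A i \<in> set (cols A)" using i A by (metis carrier_matD(2) cols_length cols_nth nth_mem)
      moreover have "col C i = y (col A i)"
        unfolding C_def using i A y \<open>col A i \<in> set (cols A)\<close> by (subst col_mat_of_cols) auto
      moreover have "col (M * C) i = M *\<^sub>v col C i" using M C i by (intro col_mult2)
      ultimately show "col A i = col (M * C) i" using y by simp
    qed (use A M C in auto)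
    then show "(*\<^sub>v) A ` carrier_vec n \<subseteq> (*\<^sub>v) M ` carrier_vec k"
      using M C by (auto simp: assoc_mult_mat_vec[of M n k C n])
    \<comment> \<open>\<open>E\<close> selects columns: for each basis vector it picks some index at
      which that vector occurs as a column of \<open>A\<close>, so that
      \<open>M = A * E\<close>.\<close>
    define E :: "'a mat" where "E = mat_of_cols n (map (\<lambda>v. unit_vec n (SOME j. j < n \<and> col A j = v)) bs)"
    have E: "E \<in> carrier_mat n k" unfolding E_def k_def by auto
    have "M = A * E"
    proof (rule mat_col_eqI)
      fix i assume i: "i < dim_col (A * E)"
      then have i: "i < k" using E by simp
      define j where "j = (SOME j. j < n \<and> col A j = bs ! i)"
      have "bs ! i \<in> set (cols A)" using i bs SA unfolding k_def by auto
      then have "\<exists>j. j < n \<and> col A j = bs ! i"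
        using A by (metis carrier_matD(2) cols_length cols_nth in_set_conv_nth)
      then have j: "j < n" "col A j = bs ! i" using someI_ex unfolding j_def by (metis (mono_tags, lifting))+
      have "col E i = unit_vec n j" unfolding E_def j_def using i unfolding k_def by (subst col_mat_of_cols) auto
      moreover have "A *\<^sub>v unit_vec n j = col A j" using A j(1) by (intro eq_vecI) auto
      moreover have "col (A * E) i = A *\<^sub>v col E i" using A E i by (intro col_mult2)
      moreover have "col M i = bs ! i" using colsM i unfolding k_def by (metis M carrier_matD(2) cols_nth k_def)
      ultimately show "col M i = col (A * E) i" using j by simp
    qed (use A M E in auto)
    then show "(*\<^sub>v) M ` carrier_vec k \<subseteq> (*\<^sub>v) A ` carrier_vec n"
      using A E by (auto simp: assoc_mult_mat_vec[of A n n E k])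
  qed
  moreover have "inj_on ((*\<^sub>v) M) (carrier_vec k)"
  proof
    fix u v assume u: "u \<in> carrier_vec k" and v: "v \<in> carrier_vec k" and eq: "M *\<^sub>v u = M *\<^sub>v v"
    have "M *\<^sub>v (u - v) = 0\<^sub>v n"
      using eq M u v by (simp add: mult_minus_distrib_mat_vec[of M n k])
    then have "u - v = 0\<^sub>v k"
      using lin_depI[OF M, of "u - v"] u v liS colsM bs by auto
    then show "u = v" using u v by (metis eq_iff_diff_eq_0 index_minus_vec(1) index_zero_vec(1) carrier_vecD eq_vecI)
  qed
  ultimately show ?thesis using r k by (simp add: card_image card_carrier_vec')
qed

text \<open>The spinor norm is defined by a column rank, whereas the action is on rows; equality of
  the two kernel sizes bridges the gap.\<close>

lemma card_row_kernel_rank: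
  assumes A: "(A :: 'a::{field,finite} mat) \<in> carrier_mat n n"
  shows "CARD('a) ^ vec_space.rank n A * card {v \<in> carrier_vec n. A\<^sup>T *\<^sub>v v = 0\<^sub>v n} = CARD('a) ^ n"
  using card_image_mat[OF A] card_image_rank[OF A] card_row_kernel_col_kernel[OF A] by simp

section \<open>Isometry groups of matrices and the spinor norm\<close>

lemma row_mult_carrier [simp]: "X \<in> carrier_mat n m \<Longrightarrow> v \<lhd>\<^sub>m X \<in> carrier_vec m"
  unfolding row_mult_def by (auto intro: carrier_vecI)

lemma row_mult_mult:
  assumes "X \<in> carrier_mat n m" "Y \<in> carrier_mat m k" "v \<in> carrier_vec n"
  shows "v \<lhd>\<^sub>m (X * Y) = (v \<lhd>\<^sub>m X) \<lhd>\<^sub>m Y"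
  unfolding row_mult_def using assms
  by (simp add: transpose_mult[OF assms(1,2)] assoc_mult_mat_vec[of _ k m _ n])

lemma row_mult_one [simp]: "v \<in> carrier_vec n \<Longrightarrow> v \<lhd>\<^sub>m 1\<^sub>m n = v"
  unfolding row_mult_def by simp

lemma row_mult_add:
  "X \<in> carrier_mat n m \<Longrightarrow> u \<in> carrier_vec n \<Longrightarrow> v \<in> carrier_vec n \<Longrightarrow> (u + v) \<lhd>\<^sub>m X = u \<lhd>\<^sub>m X + v \<lhd>\<^sub>m X"
  unfolding row_mult_def by (rule mult_add_distrib_mat_vec[of _ m n]) auto

lemma row_mult_scale:
  "X \<in> carrier_mat n m \<Longrightarrow> v \<in> carrier_vec n \<Longrightarrow> (c \<cdot>\<^sub>v v) \<lhd>\<^sub>m X = c \<cdot>\<^sub>v (v \<lhd>\<^sub>m X)"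
  unfolding row_mult_def by (intro eq_vecI) auto

lemma row_mult_mat_add:
  "X \<in> carrier_mat n m \<Longrightarrow> Y \<in> carrier_mat n m \<Longrightarrow> v \<in> carrier_vec n \<Longrightarrow> v \<lhd>\<^sub>m (X + Y) = v \<lhd>\<^sub>m X + v \<lhd>\<^sub>m Y"
  unfolding row_mult_def by (simp add: transpose_add[of X n m] add_mult_distrib_mat_vec[of _ m n])

lemma row_mult_unit:
  assumes "X \<in> carrier_mat n m" "i < n"
  shows "unit_vec n i \<lhd>\<^sub>m X = row X i"
  unfolding row_mult_def using assms by (intro eq_vecI) auto

lemma mat_eq_row_multI:
  assumes "X \<in> carrier_mat n m" "Y \<in> carrier_mat n m"
    and "\<And>v. v \<in> carrier_vec n \<Longrightarrow> v \<lhd>\<^sub>m X = v \<lhd>\<^sub>m Y"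
  shows "X = Y"
proof (rule eq_rowI)
  fix i assume "i < dim_row Y"
  then have "i < n" using assms(2) by simp
  then show "row X i = row Y i"
    using assms(3)[of "unit_vec n i"] row_mult_unit[OF assms(1)] row_mult_unit[OF assms(2)] by simp
qed (use assms(1,2) in auto)

section \<open>The general linear group\<close>

lemma GL_simps:
  "carrier (GL n) = {X \<in> carrier_mat n n. \<exists>Y\<in>carrier_mat n n. Y * X = 1\<^sub>m n \<and> X * Y = 1\<^sub>m n}"
  "X \<otimes>\<^bsub>GL n\<^esub> Y = X * Y" "\<one>\<^bsub>GL n\<^esub> = 1\<^sub>m n"
  unfolding GL_def units_of_def Units_def ring_mat_def by auto

lemma GL_carrier_mat: "X \<in> carrier (GL n) \<Longrightarrow> X \<in> carrier_mat n n"
  by (simp add: GL_simps)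

lemma group_GL: "group (GL n :: 'a::field mat monoid)"
proof -
  interpret ring "ring_mat TYPE('a) n ()" by (rule ring_mat)
  show ?thesis unfolding GL_def by (rule units_group)
qed

lemma GL_inv:
  assumes "Z \<in> carrier (GL n)"
  shows "inv\<^bsub>GL n\<^esub> Z \<in> carrier_mat n n" "inv\<^bsub>GL n\<^esub> Z * Z = 1\<^sub>m n" "Z * inv\<^bsub>GL n\<^esub> Z = 1\<^sub>m n"
proof -
  interpret group "GL n :: 'a mat monoid" by (rule group_GL)
  show "inv\<^bsub>GL n\<^esub> Z \<in> carrier_mat n n" using assms by (intro GL_carrier_mat inv_closed)
  show "inv\<^bsub>GL n\<^esub> Z * Z = 1\<^sub>m n" "Z * inv\<^bsub>GL n\<^esub> Z = 1\<^sub>m n"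
    using l_inv[OF assms] r_inv[OF assms] by (simp_all add: GL_simps)
qed

lemma row_mult_inv [simp]:
  assumes "Z \<in> carrier (GL n)" "v \<in> carrier_vec n"
  shows "(v \<lhd>\<^sub>m Z) \<lhd>\<^sub>m inv\<^bsub>GL n\<^esub> Z = v" "(v \<lhd>\<^sub>m inv\<^bsub>GL n\<^esub> Z) \<lhd>\<^sub>m Z = v"
  using assms GL_inv[OF assms(1)] GL_carrier_mat[OF assms(1)]
  by (simp_all add: row_mult_mult[symmetric, of _ n n _ n])

text \<open>The matrix of a quadratic form need not be symmetric; this is the bilinear form of the
  matrix itself, and the polar form is the sum of it and its transpose.\<close>

definition bilin :: "'a::field mat \<Rightarrow> 'a vec \<Rightarrow> 'a vec \<Rightarrow> 'a" where
  "bilin B u v = (u \<lhd>\<^sub>m B) \<bullet> v"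

lemma quad_bilin: "quad B v = bilin B v v"
  unfolding quad_def bilin_def ..

section \<open>Bilinear, quadratic and polar forms of a matrix, and the isometry group\<close>

context
  fixes B :: "'a::field mat" and n :: nat
  assumes B: "B \<in> carrier_mat n n"
begin

lemma bilin_add:
  assumes "u \<in> carrier_vec n" "v \<in> carrier_vec n" "w \<in> carrier_vec n"
  shows "bilin B (u + v) w = bilin B u w + bilin B v w" "bilin B w (u + v) = bilin B w u + bilin B w v"
  unfolding bilin_def using assms B
  by (auto simp: row_mult_add[of _ n n] intro!: add_scalar_prod_distrib[of _ n] scalar_prod_add_distrib[of _ n])

lemma bilin_scale:
  assumes "u \<in> carrier_vec n" "w \<in> carrier_vec n"
  shows "bilin B (c \<cdot>\<^sub>v u) w = c * bilin B u w" "bilin B w (c \<cdot>\<^sub>v u) = c * bilin B w u"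
  unfolding bilin_def using assms B
  by (auto simp: row_mult_scale[of _ n n] intro!: smult_scalar_prod_distrib[of _ n] scalar_prod_smult_distrib[of _ n])

lemma polar_bilin:
  assumes "u \<in> carrier_vec n" "v \<in> carrier_vec n"
  shows "polar B u v = bilin B u v + bilin B v u"
  unfolding polar_def quad_bilin using assms by (simp add: bilin_add)

lemma polar_add:
  assumes "u \<in> carrier_vec n" "v \<in> carrier_vec n" "w \<in> carrier_vec n"
  shows "polar B (u + v) w = polar B u w + polar B v w" "polar B w (u + v) = polar B w u + polar B w v"
  using assms by (simp_all add: polar_bilin bilin_add)

lemma polar_scale:
  assumes "u \<in> carrier_vec n" "w \<in> carrier_vec n"
  shows "polar B (c \<cdot>\<^sub>v u) w = c * polar B u w" "polar B w (c \<cdot>\<^sub>v u) = c * polar B w u"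
  using assms by (simp_all add: polar_bilin bilin_scale algebra_simps)

lemma quad_scale: "v \<in> carrier_vec n \<Longrightarrow> quad B (c \<cdot>\<^sub>v v) = c * c * quad B v"
  by (simp add: quad_bilin bilin_scale)

lemma polar_sym: "u \<in> carrier_vec n \<Longrightarrow> v \<in> carrier_vec n \<Longrightarrow> polar B u v = polar B v u"
  by (simp add: polar_bilin add.commute)

lemma quad_add: "quad B (u + v) = quad B u + quad B v + polar B u v"
  unfolding polar_def by simp

lemma isometry_group_simps:
  "carrier (isometry_group B) = {X \<in> carrier (GL n). \<forall>v\<in>carrier_vec n. quad B (v \<lhd>\<^sub>m X) = quad B v}"
  "X \<otimes>\<^bsub>isometry_group B\<^esub> Y = X * Y" "\<one>\<^bsub>isometry_group B\<^esub> = 1\<^sub>m n"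
  unfolding isometry_group_def using B by (auto simp: GL_simps)

lemma isometry_subgroup: "subgroup (carrier (isometry_group B)) (GL n)"
proof -
  interpret group "GL n :: 'a mat monoid" by (rule group_GL)
  show ?thesis
  proof (rule subgroupI)
    show "carrier (isometry_group B) \<subseteq> carrier (GL n)" unfolding isometry_group_simps by blast
    show "carrier (isometry_group B) \<noteq> {}"
      using one_closed unfolding isometry_group_simps by (auto simp: GL_simps intro!: exI[of _ "1\<^sub>m n"])
    fix X assume X: "X \<in> carrier (isometry_group B)"
    then have XG: "X \<in> carrier (GL n)" unfolding isometry_group_simps by blast
    show "inv\<^bsub>GL n\<^esub> X \<in> carrier (isometry_group B)"
      unfolding isometry_group_simps
    proof (intro CollectI conjI ballI)
      fix v :: "'a vec" assume v: "v \<in> carrier_vec n"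
      have "quad B ((v \<lhd>\<^sub>m inv\<^bsub>GL n\<^esub> X) \<lhd>\<^sub>m X) = quad B (v \<lhd>\<^sub>m inv\<^bsub>GL n\<^esub> X)"
        using X GL_inv(1)[OF XG] unfolding isometry_group_simps by simp
      then show "quad B (v \<lhd>\<^sub>m inv\<^bsub>GL n\<^esub> X) = quad B v" using v XG by simp
    qed (use XG in simp)
    fix Y assume Y: "Y \<in> carrier (isometry_group B)"
    then have YG: "Y \<in> carrier (GL n)" unfolding isometry_group_simps by blast
    have "X * Y \<in> carrier (GL n)" using m_closed[OF XG YG] by (simp add: GL_simps(2))
    moreover have "quad B (v \<lhd>\<^sub>m (X * Y)) = quad B v" if "v \<in> carrier_vec n" for v
      using X Y that GL_carrier_mat[OF XG] GL_carrier_mat[OF YG] unfolding isometry_group_simps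
      by (simp add: row_mult_mult[of _ n n _ n])
    ultimately show "X \<otimes>\<^bsub>GL n\<^esub> Y \<in> carrier (isometry_group B)"
      unfolding isometry_group_simps GL_simps(2) by blast
  qed
qed

text \<open>Seen as a restriction of \<open>GL n\<close>, the isometry group has the inverses of
  \<open>GL n\<close>, which are the ones occurring in \<open>mat_conj\<close>.\<close>

lemma isometry_group_eq: "isometry_group B = GL n\<lparr>carrier := carrier (isometry_group B)\<rparr>"
  unfolding isometry_group_def using B by auto

lemma group_isometry_group: "group (isometry_group B)"
  by (subst isometry_group_eq) (rule subgroup.subgroup_is_group[OF isometry_subgroup group_GL])

lemma isometry_carrier_mat: "X \<in> carrier (isometry_group B) \<Longrightarrow> X \<in> carrier_mat n n"
  unfolding isometry_group_simps using GL_carrier_mat by blast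

lemma isometry_inv:
  assumes "X \<in> carrier (isometry_group B)"
  shows "inv\<^bsub>isometry_group B\<^esub> X = inv\<^bsub>GL n\<^esub> X"
  by (subst isometry_group_eq) (rule group.m_inv_consistent[OF group_GL isometry_subgroup assms])

end

lemma finite_carrier_mat: "finite (carrier_mat n m :: 'a::{finite,zero} mat set)"
proof -
  have "finite ((\<lambda>f. mat_of_cols n (map f [0..<m])) ` ({..<m} \<rightarrow>\<^sub>E (carrier_vec n :: 'a vec set)))"
    by (intro finite_imageI finite_PiE finite_carrier_vec') auto
  moreover have "carrier_mat n m \<subseteq> (\<lambda>f. mat_of_cols n (map f [0..<m])) ` ({..<m} \<rightarrow>\<^sub>E (carrier_vec n :: 'a vec set))"
  proof
    fix X :: "'a mat" assume X: "X \<in> carrier_mat n m"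
    have "X = mat_of_cols n (map (restrict (col X) {..<m}) [0..<m])"
      using X by (intro eq_matI) (auto simp: mat_of_cols_def)
    moreover have "restrict (col X) {..<m} \<in> {..<m} \<rightarrow>\<^sub>E carrier_vec n" using X by auto
    ultimately show "X \<in> (\<lambda>f. mat_of_cols n (map f [0..<m])) ` ({..<m} \<rightarrow>\<^sub>E carrier_vec n)" by blast
  qed
  ultimately show ?thesis by (rule rev_finite_subset)
qed

lemma finite_isometry_group:
  "(B :: 'a::{field,finite} mat) \<in> carrier_mat n n \<Longrightarrow> finite (carrier (isometry_group B))"
  using isometry_carrier_mat finite_carrier_mat finite_subset by (metis subsetI)

section \<open>The spinor norm through fixed vectors\<close>

definition fixed_vecs :: "'a::comm_semiring_1 mat \<Rightarrow> 'a vec set" where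
  "fixed_vecs X = {v \<in> carrier_vec (dim_row X). v \<lhd>\<^sub>m X = v}"

lemma card_field_gt_one: "CARD('a::{field,finite}) > 1"
proof -
  have "card {0, 1 :: 'a} \<le> CARD('a)" by (rule card_mono) auto
  then show ?thesis by simp
qed

locale even_field =
  fixes dummy :: "'a::{field,finite} itself"
  assumes even_card: "even CARD('a)"
begin

lemma char_two: "(c::'a) + c = 0"
  by (rule char_two_if_even_card[OF even_card])

lemma vec_double: "(v :: 'a vec) \<in> carrier_vec n \<Longrightarrow> v + v = 0\<^sub>v n"
  using char_two by (intro eq_vecI) auto

lemma add_eq_0_iff_eq: "(c::'a) + d = 0 \<longleftrightarrow> c = d"
  using char_two[of d] by (metis add_right_cancel)

lemma vec_add_eq_0_iff: "(u :: 'a vec) \<in> carrier_vec n \<Longrightarrow> v \<in> carrier_vec n \<Longrightarrow> u + v = 0\<^sub>v n \<longleftrightarrow> u = v"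
  using add_eq_0_iff_eq by (auto simp: vec_eq_iff)

lemma card_fixed_vecs:
  assumes X: "(X :: 'a mat) \<in> carrier_mat n n"
  shows "CARD('a) ^ vec_space.rank n (X + 1\<^sub>m n) * card (fixed_vecs X) = CARD('a) ^ n"
proof -
  have "fixed_vecs X = {v \<in> carrier_vec n. (X + 1\<^sub>m n)\<^sup>T *\<^sub>v v = 0\<^sub>v n}"
  proof -
    have "(X + 1\<^sub>m n)\<^sup>T *\<^sub>v v = 0\<^sub>v n \<longleftrightarrow> v \<lhd>\<^sub>m X = v" if v: "v \<in> carrier_vec n" for v
    proof -
      have "(X + 1\<^sub>m n)\<^sup>T *\<^sub>v v = v \<lhd>\<^sub>m X + v"
        using row_mult_mat_add[OF X one_carrier_mat v] v by (simp add: row_mult_def[of v "X + _"])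
      then show ?thesis using vec_add_eq_0_iff[of "v \<lhd>\<^sub>m X" n v] X v by simp
    qed
    then show ?thesis unfolding fixed_vecs_def using X by auto
  qed
  then show ?thesis using card_row_kernel_rank[of "X + 1\<^sub>m n" n] X by simp
qed

text \<open>The rank of \<open>X + 1\<close> is n - d with d the dimension of the fixed space; n + d
  has the same parity and needs no subtraction of natural numbers.\<close>

lemma spinor_norm_fixed:
  assumes X: "(X :: 'a mat) \<in> carrier_mat n n"
  obtains d where "card (fixed_vecs X) = CARD('a) ^ d" "d \<le> n" "spinor_norm X = (n + d) mod 2"
proof -
  let ?r = "vec_space.rank n (X + 1\<^sub>m n)"
  have q: "CARD('a) > 1" by (rule card_field_gt_one)
  have c: "CARD('a) ^ ?r * card (fixed_vecs X) = CARD('a) ^ n" by (rule card_fixed_vecs[OF X])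
  then have "CARD('a) ^ ?r dvd CARD('a) ^ n" by (metis dvd_triv_left)
  then have r: "?r \<le> n" using q power_dvd_imp_le by blast
  have "CARD('a) ^ n = CARD('a) ^ ?r * CARD('a) ^ (n - ?r)" using r by (simp flip: power_add)
  then have "card (fixed_vecs X) = CARD('a) ^ (n - ?r)" using c q by simp
  moreover have "spinor_norm X = (n + (n - ?r)) mod 2"
  proof -
    have "spinor_norm X = ?r mod 2" unfolding spinor_norm_def using X by simp
    moreover have "n + (n - ?r) = ?r + 2 * (n - ?r)" using r by linarith
    ultimately show ?thesis by (simp only: mod_mult_self2)
  qed
  ultimately show thesis using that[of "n - ?r"] by simp
qed

lemma spinor_norm_eqI:
  assumes X: "(X :: 'a mat) \<in> carrier_mat n n" and d: "card (fixed_vecs X) = CARD('a) ^ d"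
  shows "spinor_norm X = (n + d) mod 2"
proof -
  obtain d' where d': "card (fixed_vecs X) = CARD('a) ^ d'" "spinor_norm X = (n + d') mod 2"
    using spinor_norm_fixed[OF X] by blast
  have "CARD('a) > 1" by (rule card_field_gt_one)
  then have "d = d'" using d d' power_inject_exp by metis
  then show ?thesis using d' by simp
qed

lemma quadratic_space_vec:
  assumes B: "(B :: 'a mat) \<in> carrier_mat n n" and ns: "nonsingular B"
  shows "quadratic_space (fun_scale :: 'a \<Rightarrow> _) (fun_space n) (\<lambda>f. quad B (vec n f)) (\<lambda>f g. polar B (vec n f) (vec n g))"
proof -
  interpret scaled_subspace "fun_scale :: 'a \<Rightarrow> _" "fun_space n" by (rule fun_space_subspace)
  show ?thesis
  proof
    show "c + c = 0" for c :: 'a by (rule char_two)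
    show "v + v = 0" for v :: "nat \<Rightarrow> 'a" using char_two by (simp add: fun_eq_iff)
    show "fun_scale c (u + v) = fun_scale c u + fun_scale c v" for c :: 'a and u v
      unfolding fun_scale_def by (simp add: fun_eq_iff distrib_left)
    show "quad B (vec n (u + v)) = quad B (vec n u) + quad B (vec n v) + polar B (vec n u) (vec n v)" for u v
      unfolding vec_add_fun by (rule quad_add[OF B])
    show "lin_on fun_scale (fun_space n) (\<lambda>g. polar B (vec n u) (vec n g))" for u
      unfolding lin_on_def vec_add_fun vec_scale_fun using polar_add[OF B] polar_scale[OF B] by auto
    show "polar B (vec n u) (vec n v) = polar B (vec n v) (vec n u)" for u v
      by (rule polar_sym[OF B]) auto
    show "polar B (vec n v) (vec n v) = 0" for v
      using polar_bilin[OF B] char_two by simp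
    fix u :: "nat \<Rightarrow> 'a" assume u: "u \<in> fun_space n" and 0: "\<And>v. v \<in> fun_space n \<Longrightarrow> polar B (vec n u) (vec n v) = 0"
    have "polar B (vec n u) v = 0" if "v \<in> carrier_vec n" for v
      using 0[OF fun_of_vec_mem[OF that]] vec_fun_of_vec[OF that] by simp
    then have "vec n u = 0\<^sub>v n" using ns B unfolding nonsingular_def by simp
    then have "u = fun_of_vec (0\<^sub>v n)" using fun_of_vec_vec[OF u] by simp
    then show "u = 0" by (auto simp: fun_of_vec_def fun_eq_iff)
  qed
qed

lemma spinor_norm_mult:
  assumes B: "(B :: 'a mat) \<in> carrier_mat n n" and ns: "nonsingular B"
    and X: "X \<in> carrier (isometry_group B)" and Y: "Y \<in> carrier (isometry_group B)"
  shows "spinor_norm (X * Y) = (spinor_norm X + spinor_norm Y) mod 2"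
proof -
  interpret quadratic_space "fun_scale :: 'a \<Rightarrow> _" "fun_space n" "\<lambda>f. quad B (vec n f)" "\<lambda>f g. polar B (vec n f) (vec n g)"
    by (rule quadratic_space_vec[OF B ns])
  define act where "act = (\<lambda>(X :: 'a mat) f. fun_of_vec (vec n f \<lhd>\<^sub>m X))"
  have iso: "isometry (act X)" if X: "X \<in> carrier (isometry_group B)" for X
  proof -
    have XG: "X \<in> carrier (GL n)" using X unfolding isometry_group_simps[OF B] by blast
    note Xc = GL_carrier_mat[OF XG]
    have mem: "act X f \<in> fun_space n" if "X \<in> carrier_mat n n" for X f
      unfolding act_def using that by (intro fun_of_vec_mem) auto
    have "act X ` fun_space n = fun_space n"
    proof
      show "fun_space n \<subseteq> act X ` fun_space n"
      proof
        fix f :: "nat \<Rightarrow> 'a" assume f: "f \<in> fun_space n"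
        have "act X (act (inv\<^bsub>GL n\<^esub> X) f) = f"
          unfolding act_def using GL_inv(1)[OF XG] XG f by (simp add: vec_fun_of_vec fun_of_vec_vec)
        then show "f \<in> act X ` fun_space n" using mem[OF GL_inv(1)[OF XG]] by (metis imageI)
      qed
    qed (use mem Xc in auto)
    moreover have "quad B (vec n (act X f)) = quad B (vec n f)" for f
      using X Xc unfolding act_def isometry_group_simps[OF B] by (simp add: vec_fun_of_vec)
    moreover have "act X (f + g) = act X f + act X g" for f g
      unfolding act_def vec_add_fun using Xc by (simp add: row_mult_add[of _ n n] fun_of_vec_add[of _ n])
    moreover have "act X (fun_scale c f) = fun_scale c (act X f)" for c f
      unfolding act_def vec_scale_fun using Xc by (simp add: row_mult_scale[of _ n n] fun_of_vec_scale)
    ultimately show ?thesis unfolding isometry_def using mem[OF Xc] by simp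
  qed
  have Xc: "X \<in> carrier_mat n n" and Yc: "Y \<in> carrier_mat n n" using X Y isometry_carrier_mat[OF B] by auto
  have fx: "card (fixed (act X)) = card (fixed_vecs X)" if "X \<in> carrier_mat n n" for X
  proof (rule sym, rule bij_betw_same_card, rule bij_betwI[where f = fun_of_vec and g = "vec n"])
    show "fun_of_vec \<in> fixed_vecs X \<rightarrow> fixed (act X)"
      unfolding fixed_vecs_def fixed_def act_def using that by (auto simp: vec_fun_of_vec fun_of_vec_mem)
    show "vec n \<in> fixed (act X) \<rightarrow> fixed_vecs X"
    proof
      fix f assume f: "f \<in> fixed (act X)"
      then have "vec n (act X f) = vec n f" unfolding fixed_def by simp
      then show "vec n f \<in> fixed_vecs X"
        unfolding fixed_vecs_def act_def using that by (simp add: vec_fun_of_vec)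
    qed
  qed (use that in \<open>auto simp: vec_fun_of_vec fun_of_vec_vec fixed_vecs_def fixed_def\<close>)
  \<comment> \<open>Row vectors meet \<open>X\<close> first, so the composite
    \<open>act Y \<circ> act X\<close> is the action of \<open>X * Y\<close>.\<close>
  have comp: "fixed (act Y \<circ> act X) = fixed (act (X * Y))"
    unfolding fixed_def act_def using Xc Yc by (auto simp: vec_fun_of_vec row_mult_mult[of _ n n _ n])
  obtain k where k: "CARD('a) ^ n * card (fixed (act X) \<inter> fixed (act Y)) ^ 2 =
    CARD('a) ^ (2 * k) * (card (fixed_vecs X) * card (fixed_vecs Y) * card (fixed_vecs (X * Y)))"
    using card_fixed_comp[OF iso[OF X] iso[OF Y]] fx[OF Xc] fx[OF Yc] fx[of "X * Y"] Xc Yc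
    unfolding comp card_fun_space by auto
  have "scaled_subspace fun_scale (fixed (act X) \<inter> fixed (act Y))"
  proof -
    interpret FX: scaled_subspace fun_scale "fixed (act X)" by (rule fixed_subspace[OF iso[OF X]])
    interpret FY: scaled_subspace fun_scale "fixed (act Y)" by (rule fixed_subspace[OF iso[OF Y]])
    show ?thesis
      by unfold_locales (use FX.finite_space FX.zero_mem FY.zero_mem FX.add_mem FY.add_mem FX.diff_mem FY.diff_mem
        FX.scale_mem FY.scale_mem in auto)
  qed
  then obtain c where c: "card (fixed (act X) \<inter> fixed (act Y)) = CARD('a) ^ c" using card_subspace_power by blast
  obtain dX where dX: "card (fixed_vecs X) = CARD('a) ^ dX" "dX \<le> n" "spinor_norm X = (n + dX) mod 2"
    using spinor_norm_fixed[OF Xc] .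
  obtain dY where dY: "card (fixed_vecs Y) = CARD('a) ^ dY" "dY \<le> n" "spinor_norm Y = (n + dY) mod 2"
    using spinor_norm_fixed[OF Yc] .
  obtain dZ where dZ: "card (fixed_vecs (X * Y)) = CARD('a) ^ dZ" "dZ \<le> n" "spinor_norm (X * Y) = (n + dZ) mod 2"
    using spinor_norm_fixed[OF mult_carrier_mat[OF Xc Yc]] .
  have "CARD('a) ^ (n + 2 * c) = CARD('a) ^ (2 * k + (dX + dY + dZ))"
    using k unfolding c dX dY dZ by (simp add: power_add power_mult[symmetric] mult.commute)
  moreover have "CARD('a) > 1" by (rule card_field_gt_one)
  ultimately have "n + 2 * c = 2 * k + (dX + dY + dZ)" using power_inject_exp by blast
  \<comment> \<open>Modulo two the terms 2c and 2k vanish, leaving n = dX + dY + dZ. This is exactly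
    additivity of the parities n + d.\<close>
  then have "even (n + 2 * c) = even (2 * k + (dX + dY + dZ))" by simp
  then show ?thesis unfolding dX dY dZ by (auto simp: mod2_eq_if)
qed

text \<open>In characteristic two the polar form is alternating, and its radical is zero; hence its
  rank \<open>n\<close> is even.\<close>

lemma nonsingular_even_dim:
  assumes B: "(B :: 'a mat) \<in> carrier_mat n n" and ns: "nonsingular B"
  shows "even n"
proof -
  interpret quadratic_space "fun_scale :: 'a \<Rightarrow> _" "fun_space n" "\<lambda>f. quad B (vec n f)" "\<lambda>f g. polar B (vec n f) (vec n g)"
    by (rule quadratic_space_vec[OF B ns])
  have "\<exists>k. card (fun_space n :: (nat \<Rightarrow> 'a) set) = CARD('a) ^ (2 * k) *
     card {a \<in> fun_space n. \<forall>c\<in>fun_space n. polar B (vec n a) (vec n c) = 0}"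
    by (rule card_alternating[OF fun_space_subspace]) (use b_lin b_lin2 b_alt in auto)
  moreover have "{a \<in> fun_space n. \<forall>c\<in>fun_space n. polar B (vec n a) (vec n c) = 0} = {0}"
    using nondeg zero_mem lin_on_zero[OF b_lin2] by auto
  ultimately obtain k where "CARD('a) ^ n = CARD('a) ^ (2 * k)" by (auto simp: card_fun_space)
  moreover have "CARD('a) > 1" by (rule card_field_gt_one)
  ultimately have "n = 2 * k" using power_inject_exp by blast
  then show ?thesis by simp
qed

end

section \<open>Conjugacy classes of a subgroup of index two\<close>

context group
begin

lemma cancel_left [simp]:
  assumes "g \<in> carrier G" "y \<in> carrier G"
  shows "g \<otimes> (inv g \<otimes> y) = y" "inv g \<otimes> (g \<otimes> y) = y"
  using assms by (simp_all flip: m_assoc)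

text \<open>Conjugacy is expressed by an intertwining equation free of inverses, which passes
  through homomorphisms and direct products without further computation.\<close>

lemma conj_class_mem_iff:
  assumes x: "x \<in> carrier G"
  shows "y \<in> conj_class G x \<longleftrightarrow> y \<in> carrier G \<and> (\<exists>g\<in>carrier G. g \<otimes> y = x \<otimes> g)"
proof
  assume "y \<in> conj_class G x"
  then obtain g where "g \<in> carrier G" "y = inv g \<otimes> x \<otimes> g" unfolding conj_class_def by blast
  moreover from this have "g \<otimes> y = x \<otimes> g" using x by (simp add: m_assoc)
  ultimately show "y \<in> carrier G \<and> (\<exists>g\<in>carrier G. g \<otimes> y = x \<otimes> g)" using x by auto
next
  assume "y \<in> carrier G \<and> (\<exists>g\<in>carrier G. g \<otimes> y = x \<otimes> g)"
  then obtain g where g: "y \<in> carrier G" "g \<in> carrier G" "g \<otimes> y = x \<otimes> g" by blast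
  have "inv g \<otimes> x \<otimes> g = inv g \<otimes> (g \<otimes> y)" unfolding g(3) using x g(2) by (simp add: m_assoc)
  also have "\<dots> = y" using g(1,2) by simp
  finally show "y \<in> conj_class G x" using g unfolding conj_class_def by blast
qed

lemma conj_class_eq_iff:
  assumes x: "x \<in> carrier G" and y: "y \<in> carrier G"
  shows "conj_class G x = conj_class G y \<longleftrightarrow> (\<exists>g\<in>carrier G. g \<otimes> y = x \<otimes> g)"
proof
  have "y \<in> conj_class G y"
    unfolding conj_class_mem_iff[OF y] using y by (intro conjI bexI[of _ \<one>]) auto
  then show "conj_class G x = conj_class G y \<Longrightarrow> \<exists>g\<in>carrier G. g \<otimes> y = x \<otimes> g"
    using conj_class_mem_iff[OF x] by auto
next
  assume "\<exists>g\<in>carrier G. g \<otimes> y = x \<otimes> g"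
  then obtain g where g: "g \<in> carrier G" "g \<otimes> y = x \<otimes> g" by blast
  have "w \<in> conj_class G x \<longleftrightarrow> w \<in> conj_class G y" for w
  proof
    assume "w \<in> conj_class G x"
    then obtain h where h: "w \<in> carrier G" "h \<in> carrier G" "h \<otimes> w = x \<otimes> h"
      unfolding conj_class_mem_iff[OF x] by blast
    have "(inv g \<otimes> h) \<otimes> w = inv g \<otimes> (x \<otimes> h)" using g h by (simp add: m_assoc)
    also have "\<dots> = inv g \<otimes> (x \<otimes> g) \<otimes> (inv g \<otimes> h)" using g h x by (simp add: m_assoc)
    also have "\<dots> = y \<otimes> (inv g \<otimes> h)" unfolding g(2)[symmetric] using g(1) h y by (simp add: m_assoc)
    finally show "w \<in> conj_class G y" unfolding conj_class_mem_iff[OF y] using g h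
      by (intro conjI bexI[of _ "inv g \<otimes> h"]) auto
  next
    assume "w \<in> conj_class G y"
    then obtain h where h: "w \<in> carrier G" "h \<in> carrier G" "h \<otimes> w = y \<otimes> h"
      unfolding conj_class_mem_iff[OF y] by blast
    have "(g \<otimes> h) \<otimes> w = (g \<otimes> y) \<otimes> h" using g(1) h y by (simp add: m_assoc)
    also have "\<dots> = x \<otimes> (g \<otimes> h)" unfolding g(2) using g(1) h x by (simp add: m_assoc)
    finally show "w \<in> conj_class G x" unfolding conj_class_mem_iff[OF x] using g h
      by (intro conjI bexI[of _ "g \<otimes> h"]) auto
  qed
  then show "conj_class G x = conj_class G y" by blast
qed

text \<open>Injectivity on the representatives and surjectivity onto the classes are separated and
  phrased by intertwining elements, so that each can be checked coordinatewise in a product.\<close>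

lemma class_reps_iff:
  assumes A: "A \<subseteq> carrier G"
  shows "class_reps G A W \<longleftrightarrow> W \<subseteq> A \<and>
    (\<forall>w\<in>W. \<forall>w'\<in>W. (\<exists>g\<in>carrier G. g \<otimes> w' = w \<otimes> g) \<longrightarrow> w = w') \<and>
    (\<forall>a\<in>A. \<exists>w\<in>W. \<exists>g\<in>carrier G. g \<otimes> a = w \<otimes> g)"
proof (cases "W \<subseteq> A")
  case True
  have eq: "conj_class G w = conj_class G a \<longleftrightarrow> (\<exists>g\<in>carrier G. g \<otimes> a = w \<otimes> g)" if "w \<in> A" "a \<in> A" for w a
    using conj_class_eq_iff that A by blast
  have "inj_on (conj_class G) W \<longleftrightarrow>
      (\<forall>w\<in>W. \<forall>w'\<in>W. (\<exists>g\<in>carrier G. g \<otimes> w' = w \<otimes> g) \<longrightarrow> w = w')"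
    unfolding inj_on_def using eq True by (meson subsetD)
  moreover have "conj_class G ` W = conj_class G ` A \<longleftrightarrow> (\<forall>a\<in>A. \<exists>w\<in>W. conj_class G w = conj_class G a)"
  proof
    assume eq: "conj_class G ` W = conj_class G ` A"
    show "\<forall>a\<in>A. \<exists>w\<in>W. conj_class G w = conj_class G a"
    proof
      fix a assume "a \<in> A"
      then have "conj_class G a \<in> conj_class G ` W" using eq by blast
      then show "\<exists>w\<in>W. conj_class G w = conj_class G a" by fastforce
    qed
  next
    assume *: "\<forall>a\<in>A. \<exists>w\<in>W. conj_class G w = conj_class G a"
    show "conj_class G ` W = conj_class G ` A"
    proof
      show "conj_class G ` A \<subseteq> conj_class G ` W"
      proof
        fix c assume "c \<in> conj_class G ` A"
        then obtain a where "a \<in> A" "c = conj_class G a" by blast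
        then obtain w where "w \<in> W" "c = conj_class G w" using * by metis
        then show "c \<in> conj_class G ` W" by blast
      qed
    qed (use True in blast)
  qed
  moreover have "\<dots> \<longleftrightarrow> (\<forall>a\<in>A. \<exists>w\<in>W. \<exists>g\<in>carrier G. g \<otimes> a = w \<otimes> g)"
    using eq True by (meson subsetD)
  ultimately show ?thesis unfolding class_reps_def bij_betw_def using True by simp
qed (simp add: class_reps_def)

section \<open>Semisimple and unipotent parts\<close>

lemma unipotent_iff: "x \<in> unipotent_elems G \<longleftrightarrow> x \<in> carrier G \<and> (\<exists>k. x [^] ((2::nat) ^ k) = \<one>)"
proof -
  have "(\<exists>k. ord x = 2 ^ k) \<longleftrightarrow> (\<exists>k. ord x dvd 2 ^ k)"
    using divides_primepow_nat[OF two_is_prime_nat] by (metis dvd_refl)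
  then show ?thesis unfolding unipotent_elems_def using pow_eq_id by auto
qed

text \<open>Divisors of odd numbers are odd, so some odd power being trivial is enough. Power
  equations, unlike orders, transfer at once to subgroups, images and blocks.\<close>

lemma semisimple_iff: "x \<in> semisimple_elems G \<longleftrightarrow> x \<in> carrier G \<and> (\<exists>m::nat. odd m \<and> x [^] m = \<one>)"
proof -
  have "odd (ord x) \<longleftrightarrow> (\<exists>m. odd m \<and> ord x dvd m)" by (meson dvd_refl dvd_trans)
  then show ?thesis unfolding semisimple_elems_def using pow_eq_id by auto
qed

text \<open>One pair of exponents extracts the two parts of every element of the group. Consequently
  whatever intertwines two elements also intertwines their parts.\<close>

lemma jordan_exponents:
  assumes fin: "finite (carrier G)"
  obtains k l :: nat where
    "\<And>x. x \<in> carrier G \<Longrightarrow> x [^] k \<in> semisimple_elems G"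
    "\<And>x. x \<in> carrier G \<Longrightarrow> x [^] l \<in> unipotent_elems G"
    "\<And>x. x \<in> carrier G \<Longrightarrow> x [^] k \<otimes> x [^] l = x"
    "\<And>s u. s \<in> semisimple_elems G \<Longrightarrow> u \<in> unipotent_elems G \<Longrightarrow> s \<otimes> u = u \<otimes> s \<Longrightarrow> (s \<otimes> u) [^] k = s"
    "\<And>s u. s \<in> semisimple_elems G \<Longrightarrow> u \<in> unipotent_elems G \<Longrightarrow> s \<otimes> u = u \<otimes> s \<Longrightarrow> (s \<otimes> u) [^] l = u"
proof -
  have "Coset.order G \<noteq> 0" using order_gt_0_iff_finite fin by simp
  then obtain M where M: "Coset.order G = 2 ^ multiplicity 2 (Coset.order G) * M" "odd M"
    using multiplicity_decompose'[of "Coset.order G" 2] by auto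
  define j where "j = multiplicity 2 (Coset.order G)"
  define q where "q = (2::nat) ^ j"
  have o: "Coset.order G = q * M" using M(1) unfolding q_def j_def .
  have cop: "coprime q M" unfolding q_def using M(2) by simp
  have qM: "q \<noteq> 0" "M \<noteq> 0" unfolding q_def using M(2) by (auto intro: Nat.gr0I)
  \<comment> \<open>With |G| = q M, q a power of two and M odd, the exponent q a is 0 modulo q and 1
    modulo M; the exponent M c below has the roles exchanged.\<close>
  obtain a b where ab: "q * a = M * b + 1" using bezout_nat[OF qM(1), of M] cop by auto
  obtain c d where cd: "M * c = q * d + 1" using bezout_nat[OF qM(2), of q] cop by (auto simp: coprime_commute gcd.commute)
  have ss: "s [^] M = \<one>" if "s \<in> semisimple_elems G" for s
  proof -
    have "s \<in> carrier G" "odd (ord s)" using that unfolding semisimple_elems_def by auto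
    then have "coprime (ord s) q" unfolding q_def by simp
    moreover have "ord s dvd q * M" using ord_dvd_group_order \<open>s \<in> carrier G\<close> o by metis
    ultimately have "ord s dvd M" using coprime_dvd_mult_right_iff by blast
    then show ?thesis using pow_eq_id \<open>s \<in> carrier G\<close> by blast
  qed
  have uu: "u [^] q = \<one>" if mem: "u \<in> unipotent_elems G" for u
  proof -
    obtain j where j: "u \<in> carrier G" "ord u = 2 ^ j" using mem unfolding unipotent_elems_def by auto
    then have "coprime (ord u) M" using M(2) by simp
    moreover have "ord u dvd q * M" using ord_dvd_group_order \<open>u \<in> carrier G\<close> o by metis
    ultimately have "ord u dvd q" using coprime_dvd_mult_left_iff by blast
    then show ?thesis using pow_eq_id j by blast
  qed
  have su: "(s \<otimes> u) [^] (q * a) = s" "(s \<otimes> u) [^] (M * c) = u"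
    if s: "s \<in> semisimple_elems G" and u: "u \<in> unipotent_elems G" and c: "s \<otimes> u = u \<otimes> s" for s u
  proof -
    have C: "s \<in> carrier G" "u \<in> carrier G" using s u unfolding semisimple_elems_def unipotent_elems_def by auto
    have sM: "s [^] (M * t) = \<one>" and uq: "u [^] (q * t) = \<one>" for t
      using ss[OF s] uu[OF u] C by (simp_all flip: nat_pow_pow)
    have "s [^] (q * a) = s" unfolding ab using sM C by (simp flip: nat_pow_mult)
    moreover have "u [^] (M * c) = u" unfolding cd using uq C by (simp flip: nat_pow_mult)
    ultimately show "(s \<otimes> u) [^] (q * a) = s" "(s \<otimes> u) [^] (M * c) = u"
      using pow_mult_distrib[OF c] C sM uq by simp_all
  qed
  show thesis
  proof (rule that[of "q * a" "M * c"])
    fix x assume x: "x \<in> carrier G"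
    have xo: "x [^] (Coset.order G * t) = \<one>" for t using pow_order_eq_1[OF x] x by (simp flip: nat_pow_pow)
    show "x [^] (q * a) \<in> semisimple_elems G"
      unfolding semisimple_iff using x M(2) xo[of a] by (auto intro!: exI[of _ M] simp: nat_pow_pow o mult_ac)
    show "x [^] (M * c) \<in> unipotent_elems G"
      unfolding unipotent_iff using x xo[of c]
      by (auto intro!: exI[of _ j] simp: nat_pow_pow o mult_ac simp flip: q_def)
    \<comment> \<open>The two exponents sum to 1 + M (b + c), and coprimality makes b + c a multiple
      of q. So the sum is 1 modulo |G|.\<close>
    have "M * b + M * c = q * a + q * d" using ab cd by linarith
    then have "M * (b + c) = q * (a + d)" by (simp add: distrib_left)
    then have "q dvd M * (b + c)" by (metis dvd_triv_left)
    then have "q dvd b + c" using cop coprime_dvd_mult_right_iff by blast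
    then obtain t where "b + c = q * t" by blast
    then have "q * a + M * c = 1 + Coset.order G * t" using ab o by (simp add: algebra_simps flip: distrib_left)
    then show "x [^] (q * a) \<otimes> x [^] (M * c) = x"
      using xo[of t] x by (simp only: nat_pow_mult) (simp flip: nat_pow_mult)
  qed (use su in auto)
qed

end

section \<open>Passage to subgroups, centralizers and isomorphic groups\<close>

lemma subgroup_restrict_simps:
  assumes "group G" "subgroup H G"
  shows "group (G\<lparr>carrier := H\<rparr>)"
    "x \<in> H \<Longrightarrow> inv\<^bsub>G\<lparr>carrier := H\<rparr>\<^esub> x = inv\<^bsub>G\<^esub> x"
    "unipotent_elems (G\<lparr>carrier := H\<rparr>) = unipotent_elems G \<inter> H"
    "semisimple_elems (G\<lparr>carrier := H\<rparr>) = semisimple_elems G \<inter> H"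
proof -
  show g: "group (G\<lparr>carrier := H\<rparr>)" using assms subgroup.subgroup_is_group by blast
  show "x \<in> H \<Longrightarrow> inv\<^bsub>G\<lparr>carrier := H\<rparr>\<^esub> x = inv\<^bsub>G\<^esub> x" using group.m_inv_consistent assms by metis
  have p: "x [^]\<^bsub>G\<lparr>carrier := H\<rparr>\<^esub> k = x [^]\<^bsub>G\<^esub> k" for x and k :: nat
    using monoid.nat_pow_consistent[OF group.is_monoid[OF assms(1)]] by metis
  have "H \<subseteq> carrier G" using assms(2) subgroup.subset by blast
  then show "unipotent_elems (G\<lparr>carrier := H\<rparr>) = unipotent_elems G \<inter> H"
    "semisimple_elems (G\<lparr>carrier := H\<rparr>) = semisimple_elems G \<inter> H"
    using group.unipotent_iff[OF g] group.unipotent_iff[OF assms(1)]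
      group.semisimple_iff[OF g] group.semisimple_iff[OF assms(1)] p by auto
qed

lemma (in group) centralizer_subgroup:
  assumes x: "x \<in> carrier G"
  shows "subgroup {y \<in> carrier G. y \<otimes> x = x \<otimes> y} G"
proof (rule subgroupI)
  show "{y \<in> carrier G. y \<otimes> x = x \<otimes> y} \<noteq> {}" using x by (auto intro!: exI[of _ \<one>])
  fix a assume "a \<in> {y \<in> carrier G. y \<otimes> x = x \<otimes> y}"
  then have a: "a \<in> carrier G" "a \<otimes> x = x \<otimes> a" by auto
  have "inv a \<otimes> x = inv a \<otimes> (x \<otimes> a) \<otimes> inv a" using a(1) x by (simp add: m_assoc)
  also have "\<dots> = x \<otimes> inv a" unfolding a(2)[symmetric] using a(1) x by (simp add: m_assoc)
  finally show "inv a \<in> {y \<in> carrier G. y \<otimes> x = x \<otimes> y}" using a by simp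
  fix b assume "b \<in> {y \<in> carrier G. y \<otimes> x = x \<otimes> y}"
  then have b: "b \<in> carrier G" "b \<otimes> x = x \<otimes> b" by auto
  have "a \<otimes> b \<otimes> x = a \<otimes> (x \<otimes> b)" unfolding b(2)[symmetric] using a(1) b(1) x by (simp add: m_assoc)
  also have "\<dots> = (x \<otimes> a) \<otimes> b" unfolding a(2)[symmetric] using a(1) b(1) x by (simp add: m_assoc)
  also have "\<dots> = x \<otimes> (a \<otimes> b)" using a(1) b(1) x by (simp add: m_assoc)
  finally show "a \<otimes> b \<in> {y \<in> carrier G. y \<otimes> x = x \<otimes> y}" using a b by simp
qed auto

lemma (in group) group_centralizer: "x \<in> carrier G \<Longrightarrow> group (centralizer G x)"
  unfolding centralizer_def by (rule subgroup.subgroup_is_group[OF centralizer_subgroup is_group])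

lemma centralizer_simps:
  "carrier (centralizer G x) = {y \<in> carrier G. y \<otimes>\<^bsub>G\<^esub> x = x \<otimes>\<^bsub>G\<^esub> y}"
  "a \<otimes>\<^bsub>centralizer G x\<^esub> b = a \<otimes>\<^bsub>G\<^esub> b"
  "\<one>\<^bsub>centralizer G x\<^esub> = \<one>\<^bsub>G\<^esub>"
  unfolding centralizer_def by auto

lemma (in group) unipotent_centralizer:
  "x \<in> carrier G \<Longrightarrow> unipotent_elems (centralizer G x) = unipotent_elems G \<inter> carrier (centralizer G x)"
  unfolding centralizer_def
  using subgroup_restrict_simps(3)[OF is_group centralizer_subgroup] by simp

lemma iso_unipotent:
  assumes G: "group G" and H: "group H" and h: "h \<in> iso G H"
  shows "unipotent_elems H = h ` unipotent_elems G"
proof -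
  interpret group_hom G H h using assms by (simp add: group_hom_def group_hom_axioms_def iso_imp_homomorphism)
  have b: "bij_betw h (carrier G) (carrier H)" using h unfolding iso_def by blast
  have "h x \<in> unipotent_elems H \<longleftrightarrow> x \<in> unipotent_elems G" if x: "x \<in> carrier G" for x
  proof -
    have "h x [^]\<^bsub>H\<^esub> k = \<one>\<^bsub>H\<^esub> \<longleftrightarrow> x [^]\<^bsub>G\<^esub> k = \<one>\<^bsub>G\<^esub>" for k :: nat
      using x bij_betw_imp_inj_on[OF b] hom_nat_pow[OF x] by (metis G.nat_pow_closed G.one_closed hom_one inj_on_eq_iff)
    then show ?thesis using x by (simp add: G.unipotent_iff H.unipotent_iff)
  qed
  moreover have "unipotent_elems H \<subseteq> carrier H" "unipotent_elems G \<subseteq> carrier G" unfolding unipotent_elems_def by auto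
  moreover have "h ` carrier G = carrier H" using bij_betw_imp_surj_on[OF b] .
  ultimately show ?thesis by (auto simp: subset_iff set_eq_iff image_iff) metis+
qed

lemma iso_class_reps:
  assumes G: "group G" and H: "group H" and h: "h \<in> iso G H" and A: "A \<subseteq> carrier G" and W: "class_reps G A W"
  shows "class_reps H (h ` A) (h ` W)"
proof -
  interpret group_hom G H h using assms by (simp add: group_hom_def group_hom_axioms_def iso_imp_homomorphism)
  have b: "inj_on h (carrier G)" "h ` carrier G = carrier H" using h unfolding iso_def bij_betw_def by auto
  have hA: "h ` A \<subseteq> carrier H" using A by auto
  have WA: "W \<subseteq> A" using W unfolding class_reps_def by blast
  have eq: "(\<exists>g\<in>carrier H. g \<otimes>\<^bsub>H\<^esub> h a = h w \<otimes>\<^bsub>H\<^esub> g) \<longleftrightarrow> (\<exists>g\<in>carrier G. g \<otimes>\<^bsub>G\<^esub> a = w \<otimes>\<^bsub>G\<^esub> g)"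
    if "a \<in> A" "w \<in> A" for a w
  proof -
    have aw: "a \<in> carrier G" "w \<in> carrier G" using that A by auto
    have "h g \<otimes>\<^bsub>H\<^esub> h a = h w \<otimes>\<^bsub>H\<^esub> h g \<longleftrightarrow> g \<otimes>\<^bsub>G\<^esub> a = w \<otimes>\<^bsub>G\<^esub> g" if "g \<in> carrier G" for g
      using aw that b(1) by (simp flip: hom_mult add: inj_on_eq_iff)
    then show ?thesis unfolding b(2)[symmetric] by auto
  qed
  show ?thesis
    unfolding H.class_reps_iff[OF hA]
  proof (intro conjI ballI impI)
    show "h ` W \<subseteq> h ` A" using WA by blast
    fix v v' assume "v \<in> h ` W" "v' \<in> h ` W" and e: "\<exists>g\<in>carrier H. g \<otimes>\<^bsub>H\<^esub> v' = v \<otimes>\<^bsub>H\<^esub> g"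
    then obtain w w' where w: "w \<in> W" "w' \<in> W" "v = h w" "v' = h w'" by blast
    then have "w = w'" using W[unfolded G.class_reps_iff[OF A]] e eq[of w' w] WA by blast
    then show "v = v'" using w by simp
  next
    fix a assume "a \<in> h ` A"
    then obtain x where x: "x \<in> A" "a = h x" by blast
    then obtain w where w: "w \<in> W" "\<exists>g\<in>carrier G. g \<otimes>\<^bsub>G\<^esub> x = w \<otimes>\<^bsub>G\<^esub> g"
      using W[unfolded G.class_reps_iff[OF A]] by blast
    then show "\<exists>w\<in>h ` W. \<exists>g\<in>carrier H. g \<otimes>\<^bsub>H\<^esub> a = w \<otimes>\<^bsub>H\<^esub> g"
      using eq[of x w] x WA by blast
  qed
qed

lemma iso_centralizer:
  assumes G: "group G" and H: "group H" and h: "h \<in> iso G H" and x: "x \<in> carrier G"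
  shows "h \<in> iso (centralizer G x) (centralizer H (h x))"
proof -
  interpret group_hom G H h using assms by (simp add: group_hom_def group_hom_axioms_def iso_imp_homomorphism)
  have b: "inj_on h (carrier G)" "h ` carrier G = carrier H" using h unfolding iso_def bij_betw_def by auto
  have eq: "h g \<otimes>\<^bsub>H\<^esub> h x = h x \<otimes>\<^bsub>H\<^esub> h g \<longleftrightarrow> g \<otimes>\<^bsub>G\<^esub> x = x \<otimes>\<^bsub>G\<^esub> g" if "g \<in> carrier G" for g
    using x that b(1) by (simp flip: hom_mult add: inj_on_eq_iff)
  have "h ` {y \<in> carrier G. y \<otimes>\<^bsub>G\<^esub> x = x \<otimes>\<^bsub>G\<^esub> y} = {y \<in> carrier H. y \<otimes>\<^bsub>H\<^esub> h x = h x \<otimes>\<^bsub>H\<^esub> y}"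
    unfolding b(2)[symmetric] using eq by auto
  moreover have "inj_on h {y \<in> carrier G. y \<otimes>\<^bsub>G\<^esub> x = x \<otimes>\<^bsub>G\<^esub> y}"
    by (rule inj_on_subset[OF b(1)]) auto
  ultimately show ?thesis
    unfolding iso_def hom_def bij_betw_def centralizer_simps by auto
qed


text \<open>An N-class is determined by three data: the G-class of its semisimple part, represented
  by \<open>s r\<close>; the double coset of the centralizer of \<open>s r\<close> and N that
  contains the conjugating element; and a unipotent class of the centralizer of \<open>s r\<close>
  in N. The set \<open>D\<close> collects the indices with two double cosets, and these give rise to
  the second part of \<open>E\<close>.\<close>

theorem (in group) classes_index_two:
  fixes s z :: "'r \<Rightarrow> 'a" and U :: "'r \<Rightarrow> 'a set" and D R :: "'r set"
  defines "E \<equiv> {(r, s r \<otimes> u) | r u. r \<in> R \<and> u \<in> U r} \<union>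
    {(r, inv (z r) \<otimes> (s r \<otimes> u) \<otimes> z r) | r u. r \<in> R \<and> r \<in> D \<and> u \<in> U r}"
  assumes fin: "finite (carrier G)" and N: "subgroup N G"
    and index_two: "\<And>x y. x \<in> carrier G \<Longrightarrow> y \<in> carrier G \<Longrightarrow> x \<notin> N \<Longrightarrow> y \<notin> N \<Longrightarrow> x \<otimes> y \<in> N"
    and s: "\<And>r. r \<in> R \<Longrightarrow> s r \<in> semisimple_elems G"
    and s_bij: "bij_betw (\<lambda>r. conj_class G (s r)) R (conj_class G ` semisimple_elems G)"
    and U: "\<And>r. r \<in> R \<Longrightarrow> class_reps (centralizer (G\<lparr>carrier := N\<rparr>) (s r))
      (unipotent_elems (centralizer (G\<lparr>carrier := N\<rparr>) (s r))) (U r)"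
    and centralizer_meets: "\<And>r. r \<in> R \<Longrightarrow> r \<notin> D \<Longrightarrow> \<exists>t\<in>carrier G - N. t \<otimes> s r = s r \<otimes> t"
    and centralizer_inside: "\<And>r t. r \<in> R \<Longrightarrow> r \<in> D \<Longrightarrow> t \<in> carrier G \<Longrightarrow> t \<otimes> s r = s r \<otimes> t \<Longrightarrow> t \<in> N"
    and z: "\<And>r. r \<in> R \<Longrightarrow> r \<in> D \<Longrightarrow> z r \<in> carrier G - N"
  shows "\<And>r x. (r, x) \<in> E \<Longrightarrow> x \<in> N"
    and "bij_betw (\<lambda>(r, x). conj_class (G\<lparr>carrier := N\<rparr>) x) E (conj_class (G\<lparr>carrier := N\<rparr>) ` N)"
proof -
  let ?H = "G\<lparr>carrier := N\<rparr>"
  interpret N: subgroup N G by (rule N)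
  interpret H: group ?H by (rule N.subgroup_is_group[OF is_group])
  have NG: "x \<in> carrier G" if "x \<in> N" for x using that N.subset by blast
  have out_in: "x \<otimes> y \<notin> N" if "x \<in> carrier G" "x \<notin> N" "y \<in> N" for x y
  proof
    assume "x \<otimes> y \<in> N"
    then have "(x \<otimes> y) \<otimes> inv y \<in> N" using N.m_closed N.m_inv_closed[OF that(3)] by blast
    moreover have "(x \<otimes> y) \<otimes> inv y = x" using that(1) NG[OF that(3)] by (simp add: m_assoc)
    ultimately show False using that(2) by simp
  qed
  have in_out: "y \<otimes> x \<notin> N" if "x \<in> carrier G" "x \<notin> N" "y \<in> N" for x y
  proof
    assume "y \<otimes> x \<in> N"
    then have "inv y \<otimes> (y \<otimes> x) \<in> N" using N.m_closed N.m_inv_closed[OF that(3)] by blast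
    moreover have "inv y \<otimes> (y \<otimes> x) = x" using that(1) NG[OF that(3)] by simp
    ultimately show False using that(2) by simp
  qed
  have inv_out: "inv x \<notin> N" if "x \<in> carrier G" "x \<notin> N" for x
    using that N.m_inv_closed inv_inv by metis
  \<comment> \<open>Normality comes from the index: for \<open>x\<close> outside N the product x y
    is outside, and multiplying it by another outside element leads back into N.\<close>
  have normal: "x \<otimes> y \<otimes> inv x \<in> N" if "x \<in> carrier G" "y \<in> N" for x y
    using that index_two[of "x \<otimes> y" "inv x"] out_in[of x y] inv_out[of x] NG N.m_closed N.m_inv_closed
    by (cases "x \<in> N") auto
  have normal': "inv x \<otimes> y \<otimes> x \<in> N" if "x \<in> carrier G" "y \<in> N" for x y
    using normal[of "inv x" y] that by simp
  obtain k l :: nat where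
    kl: "\<And>x. x \<in> carrier G \<Longrightarrow> x [^] k \<in> semisimple_elems G"
    "\<And>x. x \<in> carrier G \<Longrightarrow> x [^] l \<in> unipotent_elems G"
    "\<And>x. x \<in> carrier G \<Longrightarrow> x [^] k \<otimes> x [^] l = x"
    and su: "\<And>s u. s \<in> semisimple_elems G \<Longrightarrow> u \<in> unipotent_elems G \<Longrightarrow> s \<otimes> u = u \<otimes> s \<Longrightarrow> (s \<otimes> u) [^] k = s"
    "\<And>s u. s \<in> semisimple_elems G \<Longrightarrow> u \<in> unipotent_elems G \<Longrightarrow> s \<otimes> u = u \<otimes> s \<Longrightarrow> (s \<otimes> u) [^] l = u"
    using jordan_exponents[OF fin] by blast
  \<comment> \<open>Odd powers of an element outside N stay outside N, but some odd power of a
    semisimple element is the identity.\<close>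
  have ssN: "x \<in> N" if "x \<in> semisimple_elems G" for x
  proof (rule ccontr)
    assume xN: "x \<notin> N"
    obtain m :: nat where x: "x \<in> carrier G" and m: "odd m" "x [^] m = \<one>" using \<open>x \<in> semisimple_elems G\<close> semisimple_iff by blast
    have sq: "x \<otimes> x \<in> N" using index_two x xN by blast
    have "x [^] (2 * j + 1) \<notin> N" for j :: nat
    proof (induction j)
      case 0
      then show ?case using x xN by simp
    next
      case (Suc j)
      have "x [^] (2 * Suc j + 1) = x [^] (2 * j + 1) \<otimes> (x \<otimes> x)" using x by (simp add: m_assoc)
      then show ?case using out_in[OF _ Suc sq] x by simp
    qed
    moreover obtain j where "m = 2 * j + 1" using m(1) oddE by blast
    ultimately show False using m(2) N.one_closed by metis
  qed
  have sN: "s r \<in> N" if "r \<in> R" for r using ssN s that by blast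
  have Hmult: "x \<otimes>\<^bsub>?H\<^esub> y = x \<otimes> y" for x y by simp
  define C where "C = (\<lambda>r. {y \<in> N. y \<otimes> s r = s r \<otimes> y})"
  have cC: "carrier (centralizer ?H (s r)) = C r" for r unfolding centralizer_simps C_def by simp
  have Cg: "group (centralizer ?H (s r))" if "r \<in> R" for r
    using H.group_centralizer sN[OF that] by simp
  have uC: "unipotent_elems (centralizer ?H (s r)) = unipotent_elems G \<inter> C r" if "r \<in> R" for r
    using H.unipotent_centralizer[of "s r"] sN[OF that] subgroup_restrict_simps(3)[OF is_group N]
    unfolding cC by (auto simp: C_def)
  have U': "U r \<subseteq> unipotent_elems G \<inter> C r"
    "\<And>w w' g. w \<in> U r \<Longrightarrow> w' \<in> U r \<Longrightarrow> g \<in> C r \<Longrightarrow> g \<otimes> w' = w \<otimes> g \<Longrightarrow> w = w'"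
    "\<And>a. a \<in> unipotent_elems G \<inter> C r \<Longrightarrow> \<exists>w\<in>U r. \<exists>g\<in>C r. g \<otimes> a = w \<otimes> g" if r: "r \<in> R" for r
  proof -
    have sub: "unipotent_elems (centralizer ?H (s r)) \<subseteq> carrier (centralizer ?H (s r))" unfolding unipotent_elems_def by auto
    note * = U[OF r, unfolded group.class_reps_iff[OF Cg[OF r] sub], unfolded cC uC[OF r] centralizer_simps(2) Hmult]
    show "U r \<subseteq> unipotent_elems G \<inter> C r" by (rule *[THEN conjunct1])
    show "w = w'" if "w \<in> U r" "w' \<in> U r" "g \<in> C r" "g \<otimes> w' = w \<otimes> g" for w w' g
    proof -
      have "\<exists>g\<in>C r. g \<otimes> w' = w \<otimes> g" by (rule bexI[of _ g]) (rule that(4), rule that(3))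
      moreover have "\<forall>w\<in>U r. \<forall>w'\<in>U r. (\<exists>g\<in>C r. g \<otimes> w' = w \<otimes> g) \<longrightarrow> w = w'"
        by (rule *[THEN conjunct2, THEN conjunct1])
      ultimately show ?thesis using that(1,2) by (metis (no_types))
    qed
    show "\<exists>w\<in>U r. \<exists>g\<in>C r. g \<otimes> a = w \<otimes> g" if "a \<in> unipotent_elems G \<inter> C r" for a
      by (rule *[THEN conjunct2, THEN conjunct2, THEN bspec, OF that])
  qed
  have Uu: "u \<in> unipotent_elems G" "u \<in> N" "u \<in> carrier G" "s r \<otimes> u = u \<otimes> s r"
    if "r \<in> R" "u \<in> U r" for r u
    using U'(1)[OF that(1)] that(2) NG unfolding C_def by auto
  \<comment> \<open>\<open>T r\<close> represents the double cosets of the centralizer of \<open>s r\<close> and \<open>N\<close> in \<open>G\<close>.\<close>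
  define T where "T = (\<lambda>r. if r \<in> D then {\<one>, z r} else {\<one>})"
  have TG: "g \<in> carrier G" if "r \<in> R" "g \<in> T r" for r g
    using that z unfolding T_def by (auto split: if_splits)
  have E_iff: "(r, x) \<in> E \<longleftrightarrow> r \<in> R \<and> (\<exists>g\<in>T r. \<exists>u\<in>U r. x = inv g \<otimes> (s r \<otimes> u) \<otimes> g)" for r x
  proof -
    have 1: "(r, x) \<in> E \<longleftrightarrow> r \<in> R \<and> ((\<exists>u\<in>U r. x = s r \<otimes> u) \<or>
        (r \<in> D \<and> (\<exists>u\<in>U r. x = inv (z r) \<otimes> (s r \<otimes> u) \<otimes> z r)))"
      unfolding E_def by blast
    have 2: "(\<exists>g\<in>T r. P g) \<longleftrightarrow> P \<one> \<or> (r \<in> D \<and> P (z r))" for P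
      unfolding T_def by auto
    have 3: "(\<exists>u\<in>U r. x = inv \<one> \<otimes> (s r \<otimes> u) \<otimes> \<one>) \<longleftrightarrow> (\<exists>u\<in>U r. x = s r \<otimes> u)" if "r \<in> R"
      using sN[OF that] Uu[OF that] NG by (intro bex_cong) simp_all
    show ?thesis unfolding 1 2 using 3 by blast
  qed
  show EN: "x \<in> N" if mem: "(r, x) \<in> E" for r x
  proof -
    obtain g u where *: "r \<in> R" "g \<in> T r" "u \<in> U r" "x = inv g \<otimes> (s r \<otimes> u) \<otimes> g" using iffD1[OF E_iff mem] by blast
    then show ?thesis using normal'[OF TG] N.m_closed sN Uu(2) by simp
  qed
  \<comment> \<open>The equation says that \<open>g\<close> and \<open>g'\<close> lie in the same
    double coset. For \<open>r\<close> in \<open>D\<close> the centralizer is inside N, so the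
    identity and \<open>z r\<close> are separated by their cosets of N.\<close>
  have T_unique: "g = g'"
    if r: "r \<in> R" and g: "g \<in> T r" "g' \<in> T r" and m: "m \<in> N" and c: "c \<in> carrier G" "c \<otimes> s r = s r \<otimes> c" and eq: "g \<otimes> m = c \<otimes> g'"
    for r g g' m c
  proof (cases "r \<in> D")
    case True
    have cN: "c \<in> N" using centralizer_inside r True c by blast
    have zG: "z r \<in> carrier G" "z r \<notin> N" using z[OF r True] by auto
    show ?thesis
    proof (rule ccontr)
      assume "g \<noteq> g'"
      then consider "g = \<one>" "g' = z r" | "g = z r" "g' = \<one>" using g True unfolding T_def by auto
      then show False
      proof cases
        case 1
        then show False using eq m in_out[OF zG cN] NG by simp
      next
        case 2
        then show False using eq cN c out_in[OF zG m] by simp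
      qed
    qed
  qed (use g T_def in simp)
  \<comment> \<open>An element outside N is brought into N by \<open>z r\<close> if \<open>r\<close>
    is in \<open>D\<close>, and otherwise by an element of the centralizer outside N.\<close>
  have T_cover: "\<exists>g\<in>T r. \<exists>c\<in>carrier G. \<exists>m\<in>N. c \<otimes> s r = s r \<otimes> c \<and> b = c \<otimes> g \<otimes> m"
    if r: "r \<in> R" and b: "b \<in> carrier G" for r b
  proof (cases "b \<in> N")
    case True
    then show ?thesis
      using r b sN NG by (intro bexI[of _ \<one>] bexI[of _ b]) (auto simp: T_def)
  next
    case False
    note bN = False
    show ?thesis
    proof (cases "r \<in> D")
      case True
      have zG: "z r \<in> carrier G" "z r \<notin> N" using z[OF r True] by auto
      have "inv (z r) \<otimes> b \<in> N" using index_two inv_out zG b bN by simp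
      then show ?thesis
        using r b sN NG zG True by (intro bexI[of _ "z r"] bexI[of _ \<one>] bexI[of _ "inv (z r) \<otimes> b"]) (auto simp: T_def)
    next
      case False
      obtain t where t: "t \<in> carrier G" "t \<notin> N" "t \<otimes> s r = s r \<otimes> t" using centralizer_meets[OF r False] by blast
      have "inv t \<otimes> b \<in> N" using index_two inv_out t b bN by simp
      then show ?thesis
        using r b sN NG t by (intro bexI[of _ \<one>] bexI[of _ t] bexI[of _ "inv t \<otimes> b"]) (auto simp: T_def)
    qed
  qed
  \<comment> \<open>Intertwining is inherited by powers, in particular by the powers
    \<open>k\<close> and \<open>l\<close> that give the two Jordan parts.\<close>
  have pow_conj: "a \<otimes> x' [^] j = x [^] j \<otimes> a"
    if "a \<in> carrier G" "x \<in> carrier G" "x' \<in> carrier G" "a \<otimes> x' = x \<otimes> a" for a x x' and j :: nat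
  proof (induction j)
    case (Suc j)
    have "a \<otimes> x' [^] Suc j = (a \<otimes> x' [^] j) \<otimes> x'" using that(1-3) by (simp add: m_assoc)
    also have "\<dots> = x [^] j \<otimes> (a \<otimes> x')" unfolding Suc using that(1-3) by (simp add: m_assoc)
    also have "\<dots> = x [^] Suc j \<otimes> a" unfolding that(4) using that(1-3) by (simp add: m_assoc)
    finally show ?case .
  qed (use that in simp)
  have s_inj: "r = r'" if "r \<in> R" "r' \<in> R" "a \<in> carrier G" "a \<otimes> s r' = s r \<otimes> a" for r r' a
  proof -
    have "conj_class G (s r) = conj_class G (s r')"
      using conj_class_eq_iff that sN NG by blast
    then show ?thesis using inj_onD[OF bij_betw_imp_inj_on[OF s_bij]] that by blast
  qed
  have cc: "conj_class ?H x = conj_class ?H y \<longleftrightarrow> (\<exists>m\<in>N. m \<otimes> y = x \<otimes> m)" if "x \<in> N" "y \<in> N" for x y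
    using H.conj_class_eq_iff[of x y] that by simp
  have inj: "p = p'" if p: "p \<in> E" "p' \<in> E" and eq: "conj_class ?H (snd p) = conj_class ?H (snd p')" for p p'
  proof -
    obtain r x r' x' where pp: "p = (r, x)" "p' = (r', x')" by (cases p, cases p')
    obtain g u where x: "r \<in> R" "g \<in> T r" "u \<in> U r" "x = inv g \<otimes> (s r \<otimes> u) \<otimes> g" using p pp E_iff by blast
    obtain g' u' where x': "r' \<in> R" "g' \<in> T r'" "u' \<in> U r'" "x' = inv g' \<otimes> (s r' \<otimes> u') \<otimes> g'" using p pp E_iff by blast
    obtain m where m: "m \<in> N" "m \<otimes> x' = x \<otimes> m" using eq cc EN p unfolding pp by auto
    note G = NG[OF m(1)] TG[OF x(1,2)] TG[OF x'(1,2)] NG[OF sN[OF x(1)]] NG[OF sN[OF x'(1)]] Uu(3)[OF x(1,3)] Uu(3)[OF x'(1,3)]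
    \<comment> \<open>If \<open>m\<close> conjugates one listed element to the other, then
      \<open>a\<close> does the same for the unconjugated products \<open>s r \<otimes> u\<close>;
      splitting these into Jordan parts recovers \<open>r\<close>, then \<open>g\<close>, then
      \<open>u\<close>.\<close>
    define a where "a = g \<otimes> m \<otimes> inv g'"
    have aG: "a \<in> carrier G" unfolding a_def using G by simp
    have "a \<otimes> (s r' \<otimes> u') = g \<otimes> (m \<otimes> x') \<otimes> inv g'" unfolding a_def x' using G by (simp add: m_assoc)
    also have "\<dots> = (s r \<otimes> u) \<otimes> a" unfolding m(2) unfolding a_def x using G by (simp add: m_assoc)
    finally have *: "a \<otimes> (s r' \<otimes> u') = (s r \<otimes> u) \<otimes> a" .
    have as: "a \<otimes> s r' = s r \<otimes> a"
      using pow_conj[OF aG _ _ *, of k] su(1)[OF s Uu(1) Uu(4)] x x' G by simp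
    have au: "a \<otimes> u' = u \<otimes> a"
      using pow_conj[OF aG _ _ *, of l] su(2)[OF s Uu(1) Uu(4)] x x' G by simp
    have rr: "r = r'" using s_inj x x' aG as by blast
    have "g \<otimes> m = a \<otimes> g'" unfolding a_def using G by (simp add: m_assoc)
    then have gg: "g = g'" using T_unique[OF x(1,2) _ m(1) aG] as x' rr by blast
    have "a \<in> N" unfolding a_def gg using normal G m by simp
    then have "a \<in> C r" using as rr unfolding C_def by simp
    then have "u = u'" using U'(2)[OF x(1,3) _ _ au] x' rr by blast
    then show ?thesis unfolding pp x x' rr gg by simp
  qed
  have surj: "\<exists>p\<in>E. conj_class ?H (snd p) = conj_class ?H x" if xN: "x \<in> N" for x
  proof -
    have xG: "x \<in> carrier G" using NG xN .
    obtain r where r: "r \<in> R" "conj_class G (s r) = conj_class G (x [^] k)"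
      using kl(1)[OF xG] bij_betw_imp_surj_on[OF s_bij] by (metis (no_types, lifting) image_iff)
    have sG: "s r \<in> carrier G" using NG sN r by blast
    obtain b where b: "b \<in> carrier G" "b \<otimes> x [^] k = s r \<otimes> b" using r(2) conj_class_eq_iff sG xG by auto
    obtain g c m where *: "g \<in> T r" "c \<in> carrier G" "m \<in> N" "c \<otimes> s r = s r \<otimes> c" "b = c \<otimes> g \<otimes> m"
      using T_cover[OF r(1) b(1)] by blast
    have G: "g \<in> carrier G" "m \<in> carrier G" using TG[OF r(1)] * NG by auto
    \<comment> \<open>With \<open>d = g \<otimes> m\<close>, which differs from \<open>b\<close>
      only by the factor \<open>c\<close> commuting with \<open>s r\<close>, this is d x^l d^-1: the
      unipotent part of \<open>x\<close> moved into the centralizer of \<open>s r\<close>.\<close>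
    define v where "v = inv c \<otimes> b \<otimes> x [^] l \<otimes> inv b \<otimes> c"
    have vG: "v \<in> carrier G" unfolding v_def using b xG * by simp
    define d where "d = g \<otimes> m"
    have dG: "d \<in> carrier G" unfolding d_def using G by simp
    have bd: "b = c \<otimes> d" unfolding d_def using * G by (simp add: m_assoc)
    have v': "v = d \<otimes> x [^] l \<otimes> inv d"
      unfolding v_def bd using * dG xG by (simp add: m_assoc inv_mult_group)
    have dk: "d \<otimes> x [^] k = s r \<otimes> d"
    proof -
      have "c \<otimes> (d \<otimes> x [^] k) = (s r \<otimes> c) \<otimes> d" using b(2) unfolding bd using * dG xG sG by (simp add: m_assoc)
      also have "\<dots> = c \<otimes> (s r \<otimes> d)" unfolding *(4)[symmetric] using *(2) dG sG by (simp add: m_assoc)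
      finally show ?thesis using * dG xG sG by simp
    qed
    have dv: "d \<otimes> x [^] l = v \<otimes> d" unfolding v' using dG xG by (simp add: m_assoc)
    have com: "x [^] l \<otimes> x [^] k = x [^] k \<otimes> x [^] l" using xG by (simp add: nat_pow_mult add.commute)
    have vs: "v \<otimes> s r = s r \<otimes> v"
    proof -
      have "(v \<otimes> s r) \<otimes> d = v \<otimes> (d \<otimes> x [^] k)" unfolding dk using vG sG dG by (simp add: m_assoc)
      also have "\<dots> = (v \<otimes> d) \<otimes> x [^] k" using vG dG xG by (simp add: m_assoc)
      also have "\<dots> = d \<otimes> (x [^] l \<otimes> x [^] k)" unfolding dv[symmetric] using dG xG by (simp add: m_assoc)
      also have "\<dots> = (d \<otimes> x [^] k) \<otimes> x [^] l" unfolding com using dG xG by (simp add: m_assoc)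
      also have "\<dots> = s r \<otimes> (d \<otimes> x [^] l)" unfolding dk using dG xG sG by (simp add: m_assoc)
      also have "\<dots> = (s r \<otimes> v) \<otimes> d" unfolding dv using vG sG dG by (simp add: m_assoc)
      finally show ?thesis using vG sG dG by simp
    qed
    have dx: "d \<otimes> x = (s r \<otimes> v) \<otimes> d"
    proof -
      have "d \<otimes> x = (d \<otimes> x [^] k) \<otimes> x [^] l" using kl(3)[OF xG] dG xG by (simp add: m_assoc)
      also have "\<dots> = s r \<otimes> (d \<otimes> x [^] l)" unfolding dk using dG xG sG by (simp add: m_assoc)
      finally show ?thesis unfolding dv using vG sG dG by (simp add: m_assoc)
    qed
    \<comment> \<open>Membership in N is seen from the product: \<open>v\<close> is the inverse of
      \<open>s r\<close> times a conjugate of \<open>x\<close>, and N is normal.\<close>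
    have "v = inv (s r) \<otimes> (d \<otimes> x \<otimes> inv d)" unfolding dx using vG sG dG by (simp add: m_assoc)
    then have vN: "v \<in> N" using N.m_closed N.m_inv_closed sN[OF r(1)] normal[OF dG xN] by simp
    have vu: "v \<in> unipotent_elems G"
    proof -
      obtain j where j: "(x [^] l) [^] ((2::nat) ^ j) = \<one>" using kl(2)[OF xG] unipotent_iff by blast
      have "d \<otimes> (x [^] l) [^] ((2::nat) ^ j) = v [^] ((2::nat) ^ j) \<otimes> d"
        by (rule pow_conj[OF dG vG _ dv]) (use xG in simp)
      then have "v [^] ((2::nat) ^ j) = \<one>" unfolding j using dG vG by simp
      then show ?thesis using unipotent_iff vG by blast
    qed
    obtain u h where u: "u \<in> U r" "h \<in> C r" "h \<otimes> v = u \<otimes> h"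
      using U'(3)[OF r(1), of v] vu vN vs unfolding C_def by blast
    have h: "h \<in> N" "h \<in> carrier G" "h \<otimes> s r = s r \<otimes> h" using u(2) NG unfolding C_def by auto
    have uG: "u \<in> carrier G" using Uu(3)[OF r(1) u(1)] .
    define e where "e = inv g \<otimes> (s r \<otimes> u) \<otimes> g"
    have eE: "(r, e) \<in> E" unfolding E_iff e_def using r * u by blast
    \<comment> \<open>This equals (g^-1 h g) m, so it lies in N; it conjugates \<open>x\<close> to
      the listed element \<open>e\<close>, first by \<open>d\<close>, then by \<open>h\<close>, then
      back by \<open>g\<close>.\<close>
    define n where "n = inv g \<otimes> h \<otimes> d"
    have "n = (inv g \<otimes> h \<otimes> g) \<otimes> m" unfolding n_def d_def using G h by (simp add: m_assoc)
    then have nN: "n \<in> N" using normal'[OF G(1) h(1)] * N.m_closed by simp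
    have "e \<otimes> n = inv g \<otimes> (s r \<otimes> (u \<otimes> h)) \<otimes> d" unfolding e_def n_def using G h uG sG dG by (simp add: m_assoc)
    also have "\<dots> = inv g \<otimes> ((s r \<otimes> h) \<otimes> v) \<otimes> d" unfolding u(3)[symmetric] using h vG sG by (simp add: m_assoc)
    also have "\<dots> = inv g \<otimes> h \<otimes> ((s r \<otimes> v) \<otimes> d)" unfolding h(3)[symmetric] using h(2) G vG sG dG by (simp add: m_assoc)
    also have "\<dots> = n \<otimes> x" unfolding dx[symmetric] n_def using h(2) G xG dG by (simp add: m_assoc)
    finally have "n \<otimes> x = e \<otimes> n" by simp
    then have "conj_class ?H e = conj_class ?H x" using cc[OF EN[OF eE] xN] nN by blast
    then show ?thesis using eE by force
  qed
  have *: "(\<lambda>(r, x). conj_class ?H x) = (\<lambda>p. conj_class ?H (snd p))" by auto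
  show "bij_betw (\<lambda>(r, x). conj_class ?H x) E (conj_class ?H ` N)"
    unfolding bij_betw_def
  proof (intro conjI)
    show "inj_on (\<lambda>(r, x). conj_class ?H x) E" unfolding * inj_on_def using inj by blast
    show "(\<lambda>(r, x). conj_class ?H x) ` E = conj_class ?H ` N"
      unfolding *
    proof (intro equalityI subsetI)
      fix c assume "c \<in> conj_class ?H ` N"
      then obtain x where "x \<in> N" "c = conj_class ?H x" by blast
      then obtain p where "p \<in> E" "c = conj_class ?H (snd p)" using surj by metis
      then show "c \<in> (\<lambda>p. conj_class ?H (snd p)) ` E" by blast
    qed (use EN in force)
  qed
qed

section \<open>Direct products and block diagonal matrices\<close>

lemma product_group_pow:
  assumes "\<And>i. i \<in> I \<Longrightarrow> group (G i)" "x \<in> carrier (product_group I G)"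
  shows "x [^]\<^bsub>product_group I G\<^esub> (k::nat) = (\<lambda>i\<in>I. x i [^]\<^bsub>G i\<^esub> k)"
proof -
  interpret P: group "product_group I G" using assms by simp
  show ?thesis by (induction k) (auto intro!: restrict_ext)
qed

text \<open>Finitely many powers of two have a common multiple that is again a power of two; this is
  where finiteness of the index set enters.\<close>

lemma unipotent_product_group:
  assumes fin: "finite I" and G: "\<And>i. i \<in> I \<Longrightarrow> group (G i)"
  shows "unipotent_elems (product_group I G) = (\<Pi>\<^sub>E i\<in>I. unipotent_elems (G i))"
proof -
  interpret P: group "product_group I G" using assms by simp
  have 1: "x \<in> unipotent_elems (product_group I G) \<longleftrightarrow> (\<forall>i\<in>I. x i \<in> unipotent_elems (G i))"
    if x: "x \<in> (\<Pi>\<^sub>E i\<in>I. carrier (G i))" for x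
  proof -
    have xc: "x \<in> carrier (product_group I G)" using x by simp
    have xi: "x i \<in> carrier (G i)" if "i \<in> I" for i using x that by (auto simp: PiE_iff)
    have p: "x [^]\<^bsub>product_group I G\<^esub> k = \<one>\<^bsub>product_group I G\<^esub> \<longleftrightarrow> (\<forall>i\<in>I. x i [^]\<^bsub>G i\<^esub> k = \<one>\<^bsub>G i\<^esub>)" for k :: nat
      by (subst product_group_pow[OF G xc]) (auto simp: fun_eq_iff restrict_def)
    have u: "x i \<in> unipotent_elems (G i) \<longleftrightarrow> (\<exists>k. x i [^]\<^bsub>G i\<^esub> ((2::nat) ^ k) = \<one>\<^bsub>G i\<^esub>)" if "i \<in> I" for i
      using group.unipotent_iff[OF G[OF that]] xi[OF that] by simp
    show ?thesis
    proof
      assume "x \<in> unipotent_elems (product_group I G)"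
      then show "\<forall>i\<in>I. x i \<in> unipotent_elems (G i)" unfolding P.unipotent_iff p using u by blast
    next
      assume "\<forall>i\<in>I. x i \<in> unipotent_elems (G i)"
      then have "\<forall>i\<in>I. \<exists>k. x i [^]\<^bsub>G i\<^esub> ((2::nat) ^ k) = \<one>\<^bsub>G i\<^esub>" using u by blast
      then obtain k where k: "\<And>i. i \<in> I \<Longrightarrow> x i [^]\<^bsub>G i\<^esub> ((2::nat) ^ k i) = \<one>\<^bsub>G i\<^esub>" by metis
      \<comment> \<open>The sum of the exponents is an upper bound for each of them.\<close>
      define K where "K = (\<Sum>i\<in>I. k i)"
      have "x i [^]\<^bsub>G i\<^esub> ((2::nat) ^ K) = \<one>\<^bsub>G i\<^esub>" if i: "i \<in> I" for i
      proof -
        interpret Gi: group "G i" by (rule G[OF i])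
        have "K = k i + (K - k i)" unfolding K_def using member_le_sum[OF i, of k] fin by simp
        then have "(2::nat) ^ K = 2 ^ k i * 2 ^ (K - k i)" by (metis power_add)
        then show ?thesis using k[OF i] xi[OF i] Gi.nat_pow_pow by (metis Gi.nat_pow_one)
      qed
      then show "x \<in> unipotent_elems (product_group I G)" unfolding P.unipotent_iff p using xc by blast
    qed
  qed
  have 2: "unipotent_elems (product_group I G) \<subseteq> (\<Pi>\<^sub>E i\<in>I. carrier (G i))"
    unfolding unipotent_elems_def by auto
  have 3: "(\<Pi>\<^sub>E i\<in>I. unipotent_elems (G i)) \<subseteq> (\<Pi>\<^sub>E i\<in>I. carrier (G i))"
    by (rule PiE_mono) (auto simp: unipotent_elems_def)
  show ?thesis
  proof (intro equalityI subsetI)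
    fix x assume x: "x \<in> unipotent_elems (product_group I G)"
    then have "x \<in> (\<Pi>\<^sub>E i\<in>I. carrier (G i))" using 2 by blast
    moreover from this have "\<forall>i\<in>I. x i \<in> unipotent_elems (G i)" using 1 x by blast
    ultimately show "x \<in> (\<Pi>\<^sub>E i\<in>I. unipotent_elems (G i))" by (simp add: PiE_iff)
  next
    fix x assume x: "x \<in> (\<Pi>\<^sub>E i\<in>I. unipotent_elems (G i))"
    then have "x \<in> (\<Pi>\<^sub>E i\<in>I. carrier (G i))" using 3 by blast
    moreover have "\<forall>i\<in>I. x i \<in> unipotent_elems (G i)" using x by (simp add: PiE_iff)
    ultimately show "x \<in> unipotent_elems (product_group I G)" using 1 by blast
  qed
qed

lemma class_reps_product_group:
  assumes G: "\<And>i. i \<in> I \<Longrightarrow> group (G i)" and A: "\<And>i. i \<in> I \<Longrightarrow> A i \<subseteq> carrier (G i)"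
    and W: "\<And>i. i \<in> I \<Longrightarrow> class_reps (G i) (A i) (W i)"
  shows "class_reps (product_group I G) (\<Pi>\<^sub>E i\<in>I. A i) (\<Pi>\<^sub>E i\<in>I. W i)"
proof -
  interpret P: group "product_group I G" using assms by simp
  have sub: "(\<Pi>\<^sub>E i\<in>I. A i) \<subseteq> carrier (product_group I G)" using PiE_mono[of I A "\<lambda>i. carrier (G i)"] A by simp
  have W1: "W i \<subseteq> A i" if "i \<in> I" for i using W[OF that] unfolding class_reps_def by blast
  have W2: "w = w'" if "i \<in> I" "w \<in> W i" "w' \<in> W i" "g \<in> carrier (G i)" "g \<otimes>\<^bsub>G i\<^esub> w' = w \<otimes>\<^bsub>G i\<^esub> g" for i w w' g
    using W[OF that(1)] that unfolding group.class_reps_iff[OF G[OF that(1)] A[OF that(1)]] by blast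
  have W3: "\<exists>w\<in>W i. \<exists>g\<in>carrier (G i). g \<otimes>\<^bsub>G i\<^esub> a = w \<otimes>\<^bsub>G i\<^esub> g" if "i \<in> I" "a \<in> A i" for i a
    using W[OF that(1)] that unfolding group.class_reps_iff[OF G[OF that(1)] A[OF that(1)]] by blast
  show ?thesis
    unfolding P.class_reps_iff[OF sub]
  proof (intro conjI ballI impI)
    show "(\<Pi>\<^sub>E i\<in>I. W i) \<subseteq> (\<Pi>\<^sub>E i\<in>I. A i)" using W1 by (rule PiE_mono)
    fix w w' assume w: "w \<in> (\<Pi>\<^sub>E i\<in>I. W i)" "w' \<in> (\<Pi>\<^sub>E i\<in>I. W i)"
      and "\<exists>g\<in>carrier (product_group I G). g \<otimes>\<^bsub>product_group I G\<^esub> w' = w \<otimes>\<^bsub>product_group I G\<^esub> g"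
    then obtain g where g: "g \<in> (\<Pi>\<^sub>E i\<in>I. carrier (G i))" "(\<lambda>i\<in>I. g i \<otimes>\<^bsub>G i\<^esub> w' i) = (\<lambda>i\<in>I. w i \<otimes>\<^bsub>G i\<^esub> g i)" by auto
    show "w = w'"
    proof (rule PiE_ext[OF w])
      fix i assume i: "i \<in> I"
      have "g i \<otimes>\<^bsub>G i\<^esub> w' i = w i \<otimes>\<^bsub>G i\<^esub> g i" using fun_cong[OF g(2), of i] i by simp
      then show "w i = w' i" using W2[OF i, of "w i" "w' i" "g i"] w g(1) i by (auto simp: PiE_iff)
    qed
  next
    fix a assume a: "a \<in> (\<Pi>\<^sub>E i\<in>I. A i)"
    have "\<forall>i\<in>I. \<exists>w g. w \<in> W i \<and> g \<in> carrier (G i) \<and> g \<otimes>\<^bsub>G i\<^esub> a i = w \<otimes>\<^bsub>G i\<^esub> g"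
      using W3 a by (meson PiE_mem)
    then obtain w g where wg: "\<And>i. i \<in> I \<Longrightarrow> w i \<in> W i \<and> g i \<in> carrier (G i) \<and> g i \<otimes>\<^bsub>G i\<^esub> a i = w i \<otimes>\<^bsub>G i\<^esub> g i" by metis
    show "\<exists>w\<in>\<Pi>\<^sub>E i\<in>I. W i. \<exists>g\<in>carrier (product_group I G). g \<otimes>\<^bsub>product_group I G\<^esub> a = w \<otimes>\<^bsub>product_group I G\<^esub> g"
      by (rule bexI[of _ "restrict w I"], rule bexI[of _ "restrict g I"]) (use wg in \<open>auto intro!: restrict_ext\<close>)
  qed
qed

text \<open>The orthogonal sum of two blocks, the step in which \<open>diag_block_mat\<close> is
  built; facts about lists of blocks follow by peeling off the head.\<close>

definition block_sum :: "'a::zero mat \<Rightarrow> 'a mat \<Rightarrow> 'a mat" where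
  "block_sum A D = four_block_mat A (0\<^sub>m (dim_row A) (dim_col D)) (0\<^sub>m (dim_row D) (dim_col A)) D"

lemma diag_block_mat_Cons: "diag_block_mat (A # As) = block_sum A (diag_block_mat As)"
  unfolding block_sum_def by (simp add: Let_def)

lemma block_sum_carrier: "A \<in> carrier_mat m m \<Longrightarrow> D \<in> carrier_mat k k \<Longrightarrow> block_sum A D \<in> carrier_mat (m + k) (m + k)"
  unfolding block_sum_def by simp

context
  fixes m k :: nat and A D :: "'a::field mat"
  assumes A: "A \<in> carrier_mat m m" and D: "D \<in> carrier_mat k k"
begin

lemma block_sum_alt: "block_sum A D = four_block_mat A (0\<^sub>m m k) (0\<^sub>m k m) D"
  unfolding block_sum_def using A D by simp

lemma row_mult_block_sum:
  assumes u: "u \<in> carrier_vec m" and v: "v \<in> carrier_vec k"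
  shows "(u @\<^sub>v v) \<lhd>\<^sub>m block_sum A D = (u \<lhd>\<^sub>m A) @\<^sub>v (v \<lhd>\<^sub>m D)"
proof -
  have "(block_sum A D)\<^sup>T = four_block_mat (A\<^sup>T) (0\<^sub>m m k) (0\<^sub>m k m) (D\<^sup>T)"
    unfolding block_sum_alt using transpose_four_block_mat[OF A _ _ D, of "0\<^sub>m m k" "0\<^sub>m k m"] by simp
  moreover have "0\<^sub>m m k *\<^sub>v v = 0\<^sub>v m" "0\<^sub>m k m *\<^sub>v u = 0\<^sub>v k" using u v by auto
  moreover have "A\<^sup>T *\<^sub>v u \<in> carrier_vec m" "D\<^sup>T *\<^sub>v v \<in> carrier_vec k"
    using A D row_mult_carrier unfolding row_mult_def by auto
  ultimately show ?thesis
    unfolding row_mult_def using A D u v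
    by (simp add: four_block_mat_mult_vec[of _ m m _ k _ k])
qed

lemma block_sum_mult:
  assumes A': "A' \<in> carrier_mat m m" and D': "D' \<in> carrier_mat k k"
  shows "block_sum A D * block_sum A' D' = block_sum (A * A') (D * D')"
  unfolding block_sum_alt unfolding block_sum_def
  using A D A' D' by (simp add: mult_four_block_mat[of _ m m _ k _ k _ _ m _ k])

lemma block_sum_eqD:
  assumes A': "A' \<in> carrier_mat m m" and D': "D' \<in> carrier_mat k k" and eq: "block_sum A D = block_sum A' D'"
  shows "A = A'" "D = D'"
proof -
  show "A = A'"
  proof (rule eq_matI)
    fix i j assume "i < dim_row A'" "j < dim_col A'"
    then have ij: "i < m" "j < m" using A' by auto
    then have "block_sum A D $$ (i, j) = A $$ (i, j)" "block_sum A' D' $$ (i, j) = A' $$ (i, j)"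
      unfolding block_sum_def using A D A' D' by auto
    then show "A $$ (i, j) = A' $$ (i, j)" using eq by simp
  qed (use A A' in auto)
  show "D = D'"
  proof (rule eq_matI)
    fix i j assume "i < dim_row D'" "j < dim_col D'"
    then have ij: "i < k" "j < k" using D' by auto
    then have "block_sum A D $$ (m + i, m + j) = D $$ (i, j)" "block_sum A' D' $$ (m + i, m + j) = D' $$ (i, j)"
      unfolding block_sum_def using A D A' D' by auto
    then show "D $$ (i, j) = D' $$ (i, j)" using eq by simp
  qed (use D D' in auto)
qed

lemma quad_block_sum:
  assumes u: "u \<in> carrier_vec m" and v: "v \<in> carrier_vec k"
  shows "quad (block_sum A D) (u @\<^sub>v v) = quad A u + quad D v"
  unfolding quad_def row_mult_block_sum[OF u v] using A D u v by (subst scalar_prod_append) auto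

lemma polar_block_sum:
  assumes u: "u \<in> carrier_vec m" "u' \<in> carrier_vec m" and v: "v \<in> carrier_vec k" "v' \<in> carrier_vec k"
  shows "polar (block_sum A D) (u @\<^sub>v v) (u' @\<^sub>v v') = polar A u u' + polar D v v'"
  unfolding polar_def append_vec_add[OF u(1) u(2) v(1) v(2)] using u v by (simp add: quad_block_sum)

text \<open>Invertibility is tested by the determinant, which is the product of those of the
  blocks.\<close>

lemma block_sum_GL_iff: "block_sum A D \<in> carrier (GL (m + k)) \<longleftrightarrow> A \<in> carrier (GL m) \<and> D \<in> carrier (GL k)"
proof -
  have GL_det: "X \<in> carrier (GL n) \<longleftrightarrow> det X \<noteq> 0" if "X \<in> carrier_mat n n" for n and X :: "'a mat"
    using that unit_imp_det_non_zero[of X n "()"] det_non_zero_imp_unit[of X n "()"]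
    unfolding GL_def units_of_def by auto
  have "det (block_sum A D) = det A * det D"
    unfolding block_sum_alt by (rule det_four_block_mat_upper_right_zero) (use A D in auto)
  then show ?thesis using GL_det[OF A] GL_det[OF D] GL_det[OF block_sum_carrier[OF A D]] by simp
qed

end

lemma append_zero_eq_zero: "0\<^sub>v (m + k) = 0\<^sub>v m @\<^sub>v 0\<^sub>v k"
  by (intro eq_vecI) auto

lemma quad_zero: "A \<in> carrier_mat m m \<Longrightarrow> quad A (0\<^sub>v m) = 0"
  unfolding quad_def by (rule scalar_prod_right_zero) auto

lemma polar_zero:
  assumes "A \<in> carrier_mat m m" "u \<in> carrier_vec m"
  shows "polar A u (0\<^sub>v m) = 0" "polar A (0\<^sub>v m) u = 0"
  using assms by (simp_all add: polar_def quad_zero)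

text \<open>The summands are orthogonal, so test vectors padded with zeros examine each of them
  separately.\<close>

lemma nonsingular_block_sum:
  assumes A: "A \<in> carrier_mat m m" and D: "D \<in> carrier_mat k k"
  shows "nonsingular (block_sum A D) \<longleftrightarrow> nonsingular A \<and> nonsingular D"
proof -
  note z = polar_zero(1)[OF A] and z' = polar_zero(1)[OF D] and z0 = polar_zero(2)[OF A] and z0' = polar_zero(2)[OF D]
  have dims: "dim_row (block_sum A D) = m + k" "dim_row A = m" "dim_row D = k"
    using block_sum_carrier[OF A D] A D by auto
  show ?thesis
    unfolding nonsingular_def dims all_vec_append append_zero_eq_zero
  proof (intro iffI conjI ballI impI)
    assume *: "\<forall>x1\<in>carrier_vec m. \<forall>x2\<in>carrier_vec k.
       (\<forall>y1\<in>carrier_vec m. \<forall>y2\<in>carrier_vec k. polar (block_sum A D) (x1 @\<^sub>v x2) (y1 @\<^sub>v y2) = 0) \<longrightarrow>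
       x1 @\<^sub>v x2 = 0\<^sub>v m @\<^sub>v 0\<^sub>v k"
    show "u = 0\<^sub>v m" if u: "u \<in> carrier_vec m" and "\<forall>v\<in>carrier_vec m. polar A u v = 0" for u
    proof -
      have "u @\<^sub>v 0\<^sub>v k = 0\<^sub>v m @\<^sub>v 0\<^sub>v k"
        using *[rule_format, OF u, of "0\<^sub>v k"] that z0' by (simp add: polar_block_sum[OF A D])
      then show ?thesis using append_vec_eq[OF u, of "0\<^sub>v m"] by simp
    qed
    show "u = 0\<^sub>v k" if u: "u \<in> carrier_vec k" and "\<forall>v\<in>carrier_vec k. polar D u v = 0" for u
    proof -
      have "0\<^sub>v m @\<^sub>v u = 0\<^sub>v m @\<^sub>v 0\<^sub>v k"
        using *[rule_format, of "0\<^sub>v m" u] that z0 by (simp add: polar_block_sum[OF A D])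
      then show ?thesis using append_vec_eq[OF zero_carrier_vec zero_carrier_vec, of m u "0\<^sub>v k"] by simp
    qed
  next
    fix x1 :: "'a vec" and x2 :: "'a vec"
    assume ns: "(\<forall>u\<in>carrier_vec m. (\<forall>v\<in>carrier_vec m. polar A u v = 0) \<longrightarrow> u = 0\<^sub>v m) \<and>
       (\<forall>u\<in>carrier_vec k. (\<forall>v\<in>carrier_vec k. polar D u v = 0) \<longrightarrow> u = 0\<^sub>v k)"
      and x: "x1 \<in> carrier_vec m" "x2 \<in> carrier_vec k"
      and 0: "\<forall>y1\<in>carrier_vec m. \<forall>y2\<in>carrier_vec k. polar (block_sum A D) (x1 @\<^sub>v x2) (y1 @\<^sub>v y2) = 0"
    have "polar A x1 v = 0" if "v \<in> carrier_vec m" for v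
      using 0[rule_format, OF that, of "0\<^sub>v k"] polar_block_sum[OF A D x(1) that x(2), of "0\<^sub>v k"] z'[OF x(2)] by simp
    moreover have "polar D x2 v = 0" if "v \<in> carrier_vec k" for v
      using 0[rule_format, OF _ that, of "0\<^sub>v m"] polar_block_sum[OF A D x(1) _ x(2) that, of "0\<^sub>v m"] z[OF x(1)] by simp
    ultimately show "x1 @\<^sub>v x2 = 0\<^sub>v m @\<^sub>v 0\<^sub>v k" using ns x by simp
  qed
qed

text \<open>Putting one component equal to zero separates the two conditions, since both forms
  vanish at zero.\<close>

lemma isometry_block_sum:
  assumes U: "U \<in> carrier_mat m m" and V: "V \<in> carrier_mat k k"
    and A: "A \<in> carrier_mat m m" and D: "D \<in> carrier_mat k k"
  shows "block_sum U V \<in> carrier (isometry_group (block_sum A D)) \<longleftrightarrow>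
    U \<in> carrier (isometry_group A) \<and> V \<in> carrier (isometry_group D)"
proof -
  have q: "quad (block_sum A D) ((u @\<^sub>v v) \<lhd>\<^sub>m block_sum U V) = quad A (u \<lhd>\<^sub>m U) + quad D (v \<lhd>\<^sub>m V)"
    "quad (block_sum A D) (u @\<^sub>v v) = quad A u + quad D v"
    if "u \<in> carrier_vec m" "v \<in> carrier_vec k" for u v
    using that U V by (simp_all add: row_mult_block_sum[OF U V] quad_block_sum[OF A D])
  have z: "quad A (0\<^sub>v m) = 0" "quad D (0\<^sub>v k) = 0"
    using quad_zero[OF A] quad_zero[OF D] by auto
  have zm: "0\<^sub>v m \<lhd>\<^sub>m U = 0\<^sub>v m" "0\<^sub>v k \<lhd>\<^sub>m V = 0\<^sub>v k"
    unfolding row_mult_def using U V by (auto intro!: eq_vecI)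
  have "(\<forall>u\<in>carrier_vec m. \<forall>v\<in>carrier_vec k. quad A (u \<lhd>\<^sub>m U) + quad D (v \<lhd>\<^sub>m V) = quad A u + quad D v) \<longleftrightarrow>
    (\<forall>u\<in>carrier_vec m. quad A (u \<lhd>\<^sub>m U) = quad A u) \<and> (\<forall>v\<in>carrier_vec k. quad D (v \<lhd>\<^sub>m V) = quad D v)" (is "?l \<longleftrightarrow> ?r")
  proof
    assume ?l
    then show ?r using z zm by (metis add.right_neutral add_0 zero_carrier_vec)
  qed auto
  moreover have "(\<forall>w\<in>carrier_vec (m + k). quad (block_sum A D) (w \<lhd>\<^sub>m block_sum U V) = quad (block_sum A D) w) \<longleftrightarrow>
     (\<forall>u\<in>carrier_vec m. \<forall>v\<in>carrier_vec k. quad A (u \<lhd>\<^sub>m U) + quad D (v \<lhd>\<^sub>m V) = quad A u + quad D v)"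
    unfolding all_vec_append using q by simp
  ultimately show ?thesis
    unfolding isometry_group_simps[OF A] isometry_group_simps[OF D] isometry_group_simps[OF block_sum_carrier[OF A D]]
    using block_sum_GL_iff[OF U V] by auto
qed

text \<open>Corresponding blocks are square of equal size; \<open>conform As As\<close> just says
  that all blocks are square.\<close>

definition conform :: "'a mat list \<Rightarrow> 'a mat list \<Rightarrow> bool" where
  "conform = list_all2 (\<lambda>A B. \<exists>m. A \<in> carrier_mat m m \<and> B \<in> carrier_mat m m)"

lemma conform_sym: "conform As Bs \<Longrightarrow> conform Bs As"
  unfolding conform_def by (auto simp: list_all2_conv_all_nth)

lemma conform_trans: "conform As Bs \<Longrightarrow> conform Bs Cs \<Longrightarrow> conform As Cs"
  unfolding conform_def list_all2_conv_all_nth by (metis carrier_matD(1))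

lemma diag_block_mat_carrier:
  "conform As As \<Longrightarrow> diag_block_mat As \<in> carrier_mat (sum_list (map dim_row As)) (sum_list (map dim_row As))"
proof (induction As)
  case (Cons A As)
  then obtain m where "A \<in> carrier_mat m m" unfolding conform_def by auto
  then show ?case using Cons unfolding conform_def by (auto simp: diag_block_mat_Cons intro!: block_sum_carrier)
qed simp

lemma conform_diag:
  assumes "conform As Bs"
  shows "\<exists>n. diag_block_mat As \<in> carrier_mat n n \<and> diag_block_mat Bs \<in> carrier_mat n n"
  using assms unfolding conform_def
proof (induction rule: list_all2_induct)
  case (Cons A As B Bs)
  then obtain m n where "A \<in> carrier_mat m m" "B \<in> carrier_mat m m"
    "diag_block_mat As \<in> carrier_mat n n" "diag_block_mat Bs \<in> carrier_mat n n" by blast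
  then show ?case unfolding diag_block_mat_Cons using block_sum_carrier by blast
qed (auto intro: exI[of _ 0])

lemma isometry_diag_block_mat:
  fixes Us Bs :: "'a::field mat list"
  assumes "conform Us Bs"
  shows "diag_block_mat Us \<in> carrier (isometry_group (diag_block_mat Bs)) \<longleftrightarrow>
    list_all2 (\<lambda>U B. U \<in> carrier (isometry_group B)) Us Bs"
  using assms unfolding conform_def
proof (induction rule: list_all2_induct)
  case Nil
  have Z: "0\<^sub>m 0 0 \<in> carrier_mat 0 (0::nat)" by simp
  have "0\<^sub>m 0 0 * 0\<^sub>m 0 0 = (1\<^sub>m 0 :: 'a mat)" by (intro eq_matI) auto
  then have "(0\<^sub>m 0 0 :: 'a mat) \<in> carrier (GL 0)" unfolding GL_simps using Z by blast
  moreover have "v \<lhd>\<^sub>m 0\<^sub>m 0 0 = v" if "v \<in> carrier_vec 0" for v :: "'a vec"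
    using that unfolding row_mult_def by (intro eq_vecI) auto
  ultimately show ?case by (simp add: isometry_group_simps[OF Z])
next
  case (Cons U Us B Bs)
  then obtain m where m: "U \<in> carrier_mat m m" "B \<in> carrier_mat m m" by blast
  obtain n where n: "diag_block_mat Us \<in> carrier_mat n n" "diag_block_mat Bs \<in> carrier_mat n n"
    using conform_diag[unfolded conform_def, OF Cons(2)] by blast
  show ?case unfolding diag_block_mat_Cons isometry_block_sum[OF m(1) n(1) m(2) n(2)] using Cons.IH by simp
qed

lemma diag_block_mat_mult:
  fixes Us Vs :: "'a::field mat list"
  assumes "conform Us Vs"
  shows "diag_block_mat Us * diag_block_mat Vs = diag_block_mat (map2 (*) Us Vs)"
  using assms unfolding conform_def
proof (induction rule: list_all2_induct)
  case Nil
  then show ?case by (auto intro!: eq_matI)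
next
  case (Cons U Us B Bs)
  then obtain m where m: "U \<in> carrier_mat m m" "B \<in> carrier_mat m m" by blast
  obtain n where n: "diag_block_mat Us \<in> carrier_mat n n" "diag_block_mat Bs \<in> carrier_mat n n"
    using conform_diag[unfolded conform_def, OF Cons(2)] by blast
  show ?case using block_sum_mult[OF m(1) n(1) m(2) n(2)] Cons.IH by (simp add: diag_block_mat_Cons del: diag_block_mat.simps)
qed

lemma diag_block_mat_inj:
  fixes Us Vs :: "'a::field mat list"
  assumes "conform Us Vs" "diag_block_mat Us = diag_block_mat Vs"
  shows "Us = Vs"
  using assms unfolding conform_def
proof (induction rule: list_all2_induct)
  case (Cons U Us B Bs)
  then obtain m where m: "U \<in> carrier_mat m m" "B \<in> carrier_mat m m" by blast
  obtain n where n: "diag_block_mat Us \<in> carrier_mat n n" "diag_block_mat Bs \<in> carrier_mat n n"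
    using conform_diag[unfolded conform_def, OF Cons(2)] by blast
  show ?case using block_sum_eqD[OF m(1) n(1) m(2) n(2)] Cons by (simp add: diag_block_mat_Cons del: diag_block_mat.simps)
qed simp

lemma nonsingular_diag_block_mat:
  fixes Bs :: "'a::field mat list"
  assumes "conform Bs Bs" "nonsingular (diag_block_mat Bs)" "B \<in> set Bs"
  shows "nonsingular B"
  using assms
proof (induction Bs)
  case (Cons A As)
  have c: "conform As As" using Cons.prems(1) unfolding conform_def by simp
  obtain m where m: "A \<in> carrier_mat m m" using Cons.prems(1) unfolding conform_def by auto
  have "nonsingular A \<and> nonsingular (diag_block_mat As)"
    using Cons.prems(2) nonsingular_block_sum[OF m diag_block_mat_carrier[OF c]] unfolding diag_block_mat_Cons by simp
  then show ?case using Cons.IH[OF c] Cons.prems(3) by auto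
qed simp

context even_field
begin

text \<open>The fixed space of the sum is the product of the two fixed spaces, so both n and d are
  additive.\<close>

lemma spinor_norm_block_sum:
  assumes A: "(A :: 'a mat) \<in> carrier_mat m m" and D: "D \<in> carrier_mat k k"
  shows "spinor_norm (block_sum A D) = (spinor_norm A + spinor_norm D) mod 2"
proof -
  obtain a where a: "card (fixed_vecs A) = CARD('a) ^ a" "spinor_norm A = (m + a) mod 2" using spinor_norm_fixed[OF A] by blast
  obtain d where d: "card (fixed_vecs D) = CARD('a) ^ d" "spinor_norm D = (k + d) mod 2" using spinor_norm_fixed[OF D] by blast
  note C = block_sum_carrier[OF A D]
  have eq: "(u @\<^sub>v v) \<lhd>\<^sub>m block_sum A D = u @\<^sub>v v \<longleftrightarrow> u \<lhd>\<^sub>m A = u \<and> v \<lhd>\<^sub>m D = v"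
    if "u \<in> carrier_vec m" "v \<in> carrier_vec k" for u v
    unfolding row_mult_block_sum[OF A D that] using that A D by (subst append_vec_eq[of _ m]) auto
  have "bij_betw (\<lambda>(u, v). u @\<^sub>v v) (fixed_vecs A \<times> fixed_vecs D) (fixed_vecs (block_sum A D))"
    unfolding bij_betw_def
  proof
    show "inj_on (\<lambda>(u, v). u @\<^sub>v v) (fixed_vecs A \<times> fixed_vecs D)"
      unfolding inj_on_def fixed_vecs_def using A D by (auto simp: append_vec_eq[of _ m])
    show "(\<lambda>(u, v). u @\<^sub>v v) ` (fixed_vecs A \<times> fixed_vecs D) = fixed_vecs (block_sum A D)"
    proof
      show "fixed_vecs (block_sum A D) \<subseteq> (\<lambda>(u, v). u @\<^sub>v v) ` (fixed_vecs A \<times> fixed_vecs D)"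
      proof
        fix w assume w: "w \<in> fixed_vecs (block_sum A D)"
        then have wc: "w \<in> carrier_vec (m + k)" unfolding fixed_vecs_def using C by simp
        define u v where "u = vec_first w m" and "v = vec_last w k"
        have uv: "u \<in> carrier_vec m" "v \<in> carrier_vec k" "w = u @\<^sub>v v"
          unfolding u_def v_def using wc by auto
        then have "u \<in> fixed_vecs A" "v \<in> fixed_vecs D" using w eq[OF uv(1,2)] A D unfolding fixed_vecs_def by auto
        then show "w \<in> (\<lambda>(u, v). u @\<^sub>v v) ` (fixed_vecs A \<times> fixed_vecs D)" using uv(3) by force
      qed
    qed (use eq A D C in \<open>auto simp: fixed_vecs_def\<close>)
  qed
  then have "card (fixed_vecs (block_sum A D)) = CARD('a) ^ (a + d)"
    using bij_betw_same_card a d by (fastforce simp: card_cartesian_product power_add)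
  then have "spinor_norm (block_sum A D) = (m + k + (a + d)) mod 2" by (rule spinor_norm_eqI[OF C])
  then show ?thesis unfolding a d by (simp add: mod_add_eq add_ac)
qed

lemma spinor_norm_diag_block_mat:
  fixes Us :: "'a mat list"
  assumes "conform Us Us"
  shows "spinor_norm (diag_block_mat Us) = sum_list (map spinor_norm Us) mod 2"
  using assms
proof (induction Us)
  case Nil
  have "fixed_vecs (0\<^sub>m 0 0 :: 'a mat) = carrier_vec 0"
    unfolding fixed_vecs_def row_mult_def by (auto intro!: eq_vecI)
  then have "spinor_norm (0\<^sub>m 0 0 :: 'a mat) = (0 + 0) mod 2"
    by (intro spinor_norm_eqI) (auto simp: card_carrier_vec')
  then show ?case by simp
next
  case (Cons A As)
  have c: "conform As As" using Cons.prems(1) unfolding conform_def by simp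
  obtain m where m: "A \<in> carrier_mat m m" using Cons.prems(1) unfolding conform_def by auto
  show ?case
    unfolding diag_block_mat_Cons spinor_norm_block_sum[OF m diag_block_mat_carrier[OF c]] Cons.IH[OF c]
    by (simp add: mod_add_right_eq)
qed

end

section \<open>The spinor norm on a centralizer, reflections and transport of forms\<close>

lemma spinor_norm_less_two: "spinor_norm X < 2"
  unfolding spinor_norm_def by simp

lemma Omega_simps:
  "carrier (Omega B) = {X \<in> carrier (isometry_group B). spinor_norm X = 0}"
  "Omega B = isometry_group B\<lparr>carrier := carrier (Omega B)\<rparr>"
  unfolding Omega_def by auto

context even_field
begin

context
  fixes B :: "'a mat" and n :: nat
  assumes B: "B \<in> carrier_mat n n" and ns: "nonsingular B"
begin

interpretation I: group "isometry_group B"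
  by (rule group_isometry_group[OF B])

lemma spinor_norm_one: "spinor_norm (1\<^sub>m n :: 'a mat) = 0"
proof -
  have "1\<^sub>m n \<in> carrier (isometry_group B)" using I.one_closed isometry_group_simps(3)[OF B] by simp
  from spinor_norm_mult[OF B ns this this] show ?thesis by (simp add: mult_2[symmetric])
qed

lemma Omega_subgroup: "subgroup (carrier (Omega B)) (isometry_group B)"
proof (rule I.subgroupI)
  show "carrier (Omega B) \<subseteq> carrier (isometry_group B)" unfolding Omega_simps(1) by blast
  show "carrier (Omega B) \<noteq> {}"
    using I.one_closed spinor_norm_one unfolding Omega_simps(1) isometry_group_simps(3)[OF B] by blast
  fix X assume X: "X \<in> carrier (Omega B)"
  have "spinor_norm (X * inv\<^bsub>isometry_group B\<^esub> X) = 0"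
    using X I.r_inv[of X] spinor_norm_one unfolding Omega_simps(1) isometry_group_simps[OF B] by simp
  then have "(spinor_norm X + spinor_norm (inv\<^bsub>isometry_group B\<^esub> X)) mod 2 = 0"
    using spinor_norm_mult[OF B ns, of X "inv\<^bsub>isometry_group B\<^esub> X"] X unfolding Omega_simps(1) by simp
  then show "inv\<^bsub>isometry_group B\<^esub> X \<in> carrier (Omega B)"
    using X spinor_norm_less_two[of "inv\<^bsub>isometry_group B\<^esub> X"] unfolding Omega_simps(1) by simp
  fix Y assume "Y \<in> carrier (Omega B)"
  then show "X \<otimes>\<^bsub>isometry_group B\<^esub> Y \<in> carrier (Omega B)"
    using X I.m_closed[of X Y] spinor_norm_mult[OF B ns, of X Y]
    unfolding Omega_simps(1) isometry_group_simps(2)[OF B] by simp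
qed

lemma group_Omega: "group (Omega B)"
  by (subst Omega_simps(2)) (rule subgroup.subgroup_is_group[OF Omega_subgroup I.is_group])

lemma Omega_index_two:
  assumes "X \<in> carrier (isometry_group B)" "Y \<in> carrier (isometry_group B)"
    "X \<notin> carrier (Omega B)" "Y \<notin> carrier (Omega B)"
  shows "X \<otimes>\<^bsub>isometry_group B\<^esub> Y \<in> carrier (Omega B)"
proof -
  have "spinor_norm X = 1" "spinor_norm Y = 1"
    using assms spinor_norm_less_two[of X] spinor_norm_less_two[of Y] unfolding Omega_simps(1) by auto
  then show ?thesis
    using assms(1,2) I.m_closed[OF assms(1,2)] spinor_norm_mult[OF B ns assms(1,2)]
    unfolding Omega_simps(1) isometry_group_simps(2)[OF B] by simp
qed

text \<open>A homomorphism to a group of order two kills every element of odd order: m times the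
  norm is even with m odd.\<close>

lemma spinor_norm_semisimple:
  assumes "X \<in> semisimple_elems (isometry_group B)"
  shows "spinor_norm X = 0"
proof -
  obtain m :: nat where X: "X \<in> carrier (isometry_group B)" and m: "odd m" "X [^]\<^bsub>isometry_group B\<^esub> m = \<one>\<^bsub>isometry_group B\<^esub>"
    using assms I.semisimple_iff by blast
  have "spinor_norm (X [^]\<^bsub>isometry_group B\<^esub> j) = (j * spinor_norm X) mod 2" for j :: nat
  proof (induction j)
    case 0
    then show ?case using spinor_norm_one isometry_group_simps(3)[OF B] by simp
  next
    case (Suc j)
    have "X [^]\<^bsub>isometry_group B\<^esub> Suc j = X [^]\<^bsub>isometry_group B\<^esub> j * X"
      using isometry_group_simps(2)[OF B] by simp
    then have "spinor_norm (X [^]\<^bsub>isometry_group B\<^esub> Suc j) = (spinor_norm (X [^]\<^bsub>isometry_group B\<^esub> j) + spinor_norm X) mod 2"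
      using spinor_norm_mult[OF B ns I.nat_pow_closed[OF X] X] by simp
    also have "\<dots> = (Suc j * spinor_norm X) mod 2"
      unfolding Suc mod_add_left_eq by (simp add: add.commute)
    finally show ?case .
  qed
  from this[of m] have "(m * spinor_norm X) mod 2 = 0"
    using m(2) spinor_norm_one isometry_group_simps(3)[OF B] by simp
  then have "even (m * spinor_norm X)" by (simp only: even_iff_mod_2_eq_zero)
  then have "even (spinor_norm X)" using m(1) by simp
  then show ?thesis using spinor_norm_less_two[of X] by (auto elim!: evenE)
qed

text \<open>If \<open>Y\<close> is unipotent, then \<open>S\<close> is a power of \<open>S Y\<close>, so \<open>S Y\<close> moves every non-zero vector as well and
  its spinor norm is the parity of \<open>n\<close>.\<close>

lemma spinor_norm_commuting:
  assumes S: "S \<in> semisimple_elems (isometry_group B)" and fix0: "fixed_vecs S = {0\<^sub>v n}"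
    and Y: "Y \<in> carrier (isometry_group B)" and comm: "Y * S = S * Y"
  shows "spinor_norm Y = 0"
proof -
  note mult = isometry_group_simps(2)[OF B]
  have SI: "S \<in> carrier (isometry_group B)" using S unfolding semisimple_elems_def by simp
  \<comment> \<open>The same exponent \<open>k\<close> serves twice: it isolates the semisimple part
    of \<open>Y\<close>, and it recovers \<open>S\<close> from the product of \<open>S\<close> with
    the unipotent part of \<open>Y\<close>.\<close>
  obtain k l :: nat where
    kl: "Y [^]\<^bsub>isometry_group B\<^esub> k \<in> semisimple_elems (isometry_group B)"
    "Y [^]\<^bsub>isometry_group B\<^esub> l \<in> unipotent_elems (isometry_group B)"
    "Y [^]\<^bsub>isometry_group B\<^esub> k * Y [^]\<^bsub>isometry_group B\<^esub> l = Y"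
    and su: "\<And>u. u \<in> unipotent_elems (isometry_group B) \<Longrightarrow> S * u = u * S \<Longrightarrow> (S * u) [^]\<^bsub>isometry_group B\<^esub> k = S"
    using I.jordan_exponents[OF finite_isometry_group[OF B]] Y S unfolding mult by metis
  define V where "V = Y [^]\<^bsub>isometry_group B\<^esub> l"
  have V: "V \<in> carrier (isometry_group B)" unfolding V_def using Y by simp
  have "S \<otimes>\<^bsub>isometry_group B\<^esub> Y [^]\<^bsub>isometry_group B\<^esub> l = Y [^]\<^bsub>isometry_group B\<^esub> l \<otimes>\<^bsub>isometry_group B\<^esub> S"
  proof (induction l)
    case (Suc j)
    have "S \<otimes>\<^bsub>isometry_group B\<^esub> Y [^]\<^bsub>isometry_group B\<^esub> Suc j =
        (Y [^]\<^bsub>isometry_group B\<^esub> j \<otimes>\<^bsub>isometry_group B\<^esub> S) \<otimes>\<^bsub>isometry_group B\<^esub> Y"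
      using SI Y by (simp add: I.m_assoc flip: Suc)
    also have "\<dots> = Y [^]\<^bsub>isometry_group B\<^esub> j \<otimes>\<^bsub>isometry_group B\<^esub> (Y \<otimes>\<^bsub>isometry_group B\<^esub> S)"
      using SI Y comm unfolding mult[of Y S] by (simp add: I.m_assoc mult[of S Y])
    finally show ?case using SI Y by (simp add: I.m_assoc)
  qed (use SI in simp)
  then have SV: "S * V = V * S" unfolding V_def mult .
  define T where "T = S * V"
  have T: "T \<in> carrier (isometry_group B)" unfolding T_def using I.m_closed[OF SI V] mult by simp
  have Tk: "T [^]\<^bsub>isometry_group B\<^esub> k = S" unfolding T_def using su[OF _ SV] kl(2) unfolding V_def by simp
  have Tc: "T \<in> carrier_mat n n" by (rule isometry_carrier_mat[OF B T])
  have "fixed_vecs T = {0\<^sub>v n}"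
  proof
    show "fixed_vecs T \<subseteq> {0\<^sub>v n}"
    proof
      fix v assume "v \<in> fixed_vecs T"
      then have v: "v \<in> carrier_vec n" "v \<lhd>\<^sub>m T = v" unfolding fixed_vecs_def using Tc by auto
      have "v \<lhd>\<^sub>m (T [^]\<^bsub>isometry_group B\<^esub> j) = v" for j :: nat
      proof (induction j)
        case 0
        then show ?case using v isometry_group_simps(3)[OF B] by simp
      next
        case (Suc j)
        have "T [^]\<^bsub>isometry_group B\<^esub> j \<in> carrier_mat n n"
          using isometry_carrier_mat[OF B I.nat_pow_closed[OF T]] .
        then show ?case using Suc v Tc mult by (simp add: row_mult_mult[of _ n n _ n])
      qed
      then have "v \<in> fixed_vecs S"
        using v Tk isometry_carrier_mat[OF B SI] unfolding fixed_vecs_def by (metis (mono_tags, lifting) carrier_matD(1) mem_Collect_eq)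
      then show "v \<in> {0\<^sub>v n}" using fix0 by simp
    qed
    show "{0\<^sub>v n} \<subseteq> fixed_vecs T" unfolding fixed_vecs_def row_mult_def using Tc by (auto intro!: eq_vecI)
  qed
  then have "spinor_norm T = (n + 0) mod 2" by (intro spinor_norm_eqI[OF Tc]) simp
  then have "spinor_norm T = 0" using nonsingular_even_dim[OF B ns] by simp
  moreover have "spinor_norm T = (spinor_norm S + spinor_norm V) mod 2"
    unfolding T_def by (rule spinor_norm_mult[OF B ns SI V])
  moreover have "spinor_norm Y = (spinor_norm (Y [^]\<^bsub>isometry_group B\<^esub> k) + spinor_norm V) mod 2"
    using spinor_norm_mult[OF B ns I.nat_pow_closed[OF Y] V, of k] kl(3) unfolding V_def by simp
  ultimately show ?thesis using spinor_norm_semisimple[OF S] spinor_norm_semisimple[OF kl(1)] by simp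
qed

text \<open>For \<open>w\<close> with non-zero value of the form, v \<mapsto> v + (polar(v, w) /
  Q(w)) w is an isometry fixing precisely the hyperplane orthogonal to \<open>w\<close>. Such a
  \<open>w\<close> exists because otherwise the polar form would vanish identically.\<close>

lemma reflection_exists:
  assumes n: "0 < n"
  shows "\<exists>t\<in>carrier (isometry_group B). spinor_norm t = 1"
proof -
  have "\<exists>w\<in>carrier_vec n. quad B w \<noteq> 0"
  proof (rule ccontr)
    assume "\<not> ?thesis"
    then have "polar B u v = 0" if "u \<in> carrier_vec n" "v \<in> carrier_vec n" for u v
      unfolding polar_def using that by simp
    then have "unit_vec n 0 = (0\<^sub>v n :: 'a vec)" using ns B unfolding nonsingular_def by simp
    then have "unit_vec n 0 $ 0 = (0\<^sub>v n :: 'a vec) $ 0" by simp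
    then show False using n by simp
  qed
  then obtain w where w: "w \<in> carrier_vec n" "quad B w \<noteq> 0" by blast
  \<comment> \<open>The coefficient vector of the functional v \<mapsto> polar(v, w); it turns the
    reflection into a rank-one change of the identity matrix.\<close>
  define z where "z = B *\<^sub>v w + B\<^sup>T *\<^sub>v w"
  have Bw: "B *\<^sub>v w \<in> carrier_vec n" "B\<^sup>T *\<^sub>v w \<in> carrier_vec n" using B by (auto intro: carrier_vecI)
  have z: "z \<in> carrier_vec n" unfolding z_def using Bw by simp
  have pz: "polar B v w = v \<bullet> z" if v: "v \<in> carrier_vec n" for v
  proof -
    have "bilin B v w = v \<bullet> (B *\<^sub>v w)"
      unfolding bilin_def row_mult_def using B v w by (intro transpose_vec_mult_scalar[of _ n n]) auto
    moreover have "bilin B w v = v \<bullet> (B\<^sup>T *\<^sub>v w)"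
      unfolding bilin_def row_mult_def using Bw v by (intro comm_scalar_prod[of _ n]) auto
    ultimately show ?thesis
      unfolding polar_bilin[OF B v w(1)] z_def using scalar_prod_add_distrib[OF v Bw] by simp
  qed
  define c where "c v = polar B v w / quad B w" for v
  define t where "t = mat n n (\<lambda>(i, j). (if i = j then 1 else 0) + z $ i * w $ j / quad B w)"
  have t: "t \<in> carrier_mat n n" unfolding t_def by simp
  have act: "v \<lhd>\<^sub>m t = v + c v \<cdot>\<^sub>v w" if v: "v \<in> carrier_vec n" for v
  proof (rule eq_vecI)
    fix j assume "j < dim_vec (v + c v \<cdot>\<^sub>v w)"
    then have j: "j < n" using w by simp
    have "(v \<lhd>\<^sub>m t) $ j = (\<Sum>i<n. ((if i = j then 1 else 0) + z $ i * w $ j / quad B w) * v $ i)"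
      unfolding row_mult_def t_def using v j by (simp add: scalar_prod_def atLeast0LessThan)
    also have "\<dots> = (\<Sum>i<n. (if i = j then v $ i else 0) + v $ i * z $ i * (w $ j / quad B w))"
      by (rule sum.cong) (auto simp: algebra_simps)
    also have "\<dots> = v $ j + (\<Sum>i<n. v $ i * z $ i) * (w $ j / quad B w)"
      using j by (simp add: sum.distrib sum_distrib_right sum_divide_distrib)
    also have "(\<Sum>i<n. v $ i * z $ i) = polar B v w"
      unfolding pz[OF v] using z by (simp add: scalar_prod_def atLeast0LessThan)
    finally show "(v \<lhd>\<^sub>m t) $ j = (v + c v \<cdot>\<^sub>v w) $ j" using v w j unfolding c_def by simp
  qed (use t v w in \<open>auto simp: row_mult_def\<close>)
  have ww: "polar B w w = 0" using polar_bilin[OF B w(1) w(1)] char_two by simp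
  have cc: "c (v \<lhd>\<^sub>m t) = c v" if v: "v \<in> carrier_vec n" for v
    unfolding c_def act[OF v] using v w ww by (simp add: polar_add[OF B] polar_scale[OF B])
  have "t * t = 1\<^sub>m n"
  proof (rule mat_eq_row_multI)
    fix v :: "'a vec" assume v: "v \<in> carrier_vec n"
    have "v \<lhd>\<^sub>m (t * t) = (v \<lhd>\<^sub>m t) + c v \<cdot>\<^sub>v w"
      using row_mult_mult[OF t t v] act[OF row_mult_carrier[OF t]] cc[OF v] by simp
    also have "\<dots> = v + (c v \<cdot>\<^sub>v w + c v \<cdot>\<^sub>v w)" unfolding act[OF v] using v w by (simp add: assoc_add_vec[of _ n])
    also have "\<dots> = v" using v w vec_double[of "c v \<cdot>\<^sub>v w" n] by simp
    finally show "v \<lhd>\<^sub>m (t * t) = v \<lhd>\<^sub>m 1\<^sub>m n" using v by simp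
  qed (use t in auto)
  then have "t \<in> carrier (GL n)" unfolding GL_simps using t by blast
  moreover have "quad B (v \<lhd>\<^sub>m t) = quad B v" if v: "v \<in> carrier_vec n" for v
  proof -
    \<comment> \<open>With c = polar(v, w) / Q(w), the two correction terms are both c^2 Q(w) and
      cancel in characteristic two.\<close>
    have "quad B (v \<lhd>\<^sub>m t) = quad B v + (c v * c v * quad B w + c v * polar B v w)"
      unfolding act[OF v] quad_add[OF B] using v w by (simp add: quad_scale[OF B] polar_scale[OF B])
    also have "c v * polar B v w = c v * c v * quad B w" unfolding c_def using w by simp
    finally show ?thesis using char_two by simp
  qed
  ultimately have tI: "t \<in> carrier (isometry_group B)" unfolding isometry_group_simps[OF B] by blast
  have w0: "w \<noteq> 0\<^sub>v n" using w quad_zero[OF B] by blast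
  have fixed: "fixed_vecs t = {v \<in> carrier_vec n. polar B v w = 0}"
  proof -
    have "v \<lhd>\<^sub>m t = v \<longleftrightarrow> polar B v w = 0" if v: "v \<in> carrier_vec n" for v
    proof
      assume "v \<lhd>\<^sub>m t = v"
      then have e: "v + c v \<cdot>\<^sub>v w = v" using act[OF v] by simp
      obtain j where j: "j < n" "w $ j \<noteq> 0" using w0 w by (metis carrier_vecD eq_vecI index_zero_vec)
      have "(v + c v \<cdot>\<^sub>v w) $ j = v $ j" using e by simp
      then have "c v * w $ j = 0" using j v w by simp
      then show "polar B v w = 0" using j w unfolding c_def by simp
    next
      assume "polar B v w = 0"
      then show "v \<lhd>\<^sub>m t = v" unfolding act[OF v] c_def using v w by (intro eq_vecI) auto
    qed
    then show ?thesis unfolding fixed_vecs_def using t by auto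
  qed
  interpret quadratic_space "fun_scale :: 'a \<Rightarrow> _" "fun_space n" "\<lambda>f. quad B (vec n f)" "\<lambda>f g. polar B (vec n f) (vec n g)"
    by (rule quadratic_space_vec[OF B ns])
  have wv: "vec n (fun_of_vec w) = w" by (rule vec_fun_of_vec[OF w(1)])
  obtain v where v: "v \<in> carrier_vec n" "polar B w v \<noteq> 0" using ns w0 w(1) B unfolding nonsingular_def by auto
  have lin: "lin_on (fun_scale :: 'a \<Rightarrow> _) (fun_space n) (\<lambda>f. polar B (vec n f) w)"
    using b_lin2[OF fun_of_vec_mem[OF w(1)]] unfolding wv .
  \<comment> \<open>The functional v \<mapsto> polar(v, w) is not zero, so the fixed hyperplane has
    dimension n - 1 and the norm is the parity of 2n - 1.\<close>
  have "card (fun_space n :: (nat \<Rightarrow> 'a) set) = CARD('a) * card {f \<in> fun_space n. polar B (vec n f) w = 0}"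
    by (rule card_kernel[OF lin fun_of_vec_mem[OF v(1)]])
      (use v w polar_sym[OF B] in \<open>simp add: vec_fun_of_vec\<close>)
  moreover have "card {f \<in> fun_space n. polar B (vec n f) w = 0} = card (fixed_vecs t)"
    unfolding fixed
    by (rule bij_betw_same_card[where f = "vec n"], rule bij_betwI[where g = fun_of_vec])
      (auto simp: fun_of_vec_mem vec_fun_of_vec fun_of_vec_vec)
  ultimately have "CARD('a) * card (fixed_vecs t) = CARD('a) * CARD('a) ^ (n - 1)"
    unfolding card_fun_space using n by (metis Suc_diff_1 power_Suc)
  then have "card (fixed_vecs t) = CARD('a) ^ (n - 1)" by simp
  then have "spinor_norm t = (n + (n - 1)) mod 2" by (rule spinor_norm_eqI[OF t])
  moreover have "n + (n - 1) = 2 * (n - 1) + 1" using n by simp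
  ultimately have "spinor_norm t = 1" by (simp only: mod_mult_self4) simp
  then show ?thesis using tI by blast
qed

end

end

section \<open>Alternating matrices and transport of forms\<close>

lemma sum_alternating:
  fixes f :: "nat \<Rightarrow> nat \<Rightarrow> 'a::ab_group_add"
  assumes "\<And>i j. i < n \<Longrightarrow> j < n \<Longrightarrow> f j i = - f i j" "\<And>i. i < n \<Longrightarrow> f i i = 0"
  shows "(\<Sum>i<n. \<Sum>j<n. f i j) = 0"
  using assms
proof (induction n)
  case (Suc n)
  have "(\<Sum>i<n. f i n) = - (\<Sum>j<n. f n j)"
    unfolding sum_negf[symmetric] by (rule sum.cong) (simp, rule Suc.prems(1), simp_all)
  moreover have "(\<Sum>i<n. \<Sum>j<n. f i j) = 0"
    by (rule Suc.IH) (rule Suc.prems(1), simp_all add: Suc.prems(2))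
  moreover have "f n n = 0" by (rule Suc.prems(2)) simp
  ultimately show ?case by (simp add: sum.distrib)
qed simp

text \<open>Off-diagonal terms cancel in pairs and the diagonal is zero; hence matrices differing by
  an alternating one define the same quadratic form.\<close>

lemma quad_alternating:
  assumes A: "(A :: 'a::field mat) \<in> carrier_mat n n" "alternating_mat A" and v: "v \<in> carrier_vec n"
  shows "quad A v = 0"
proof -
  have T: "A $$ (j, i) = - A $$ (i, j)" if "i < n" "j < n" for i j
  proof -
    have "A\<^sup>T $$ (i, j) = (- A) $$ (i, j)" using A(2) unfolding alternating_mat_def by simp
    then show ?thesis using that A(1) by simp
  qed
  have "quad A v = (\<Sum>j<n. (\<Sum>i<n. A $$ (i, j) * v $ i) * v $ j)"
    unfolding quad_def row_mult_def using A(1) v by (simp add: scalar_prod_def atLeast0LessThan)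
  also have "\<dots> = (\<Sum>j<n. \<Sum>i<n. A $$ (i, j) * v $ i * v $ j)" by (simp add: sum_distrib_right)
  also have "\<dots> = 0"
  proof (rule sum_alternating)
    fix i j assume "i < n" "j < n"
    then show "A $$ (i, j) * v $ i * v $ j = - (A $$ (j, i) * v $ j * v $ i)" by (subst T) (simp_all add: mult_ac)
    show "A $$ (i, i) * v $ i * v $ i = 0" using A \<open>i < n\<close> unfolding alternating_mat_def by simp
  qed
  finally show ?thesis .
qed

text \<open>\<open>P\<close> sends the space of \<open>B\<close> isometrically onto that of
  \<open>B0\<close>: the matrix P B0 P^T represents v \<mapsto> Q0(v P), and the alternating
  difference changes nothing.\<close>

lemma quad_transports:
  assumes B0: "(B0 :: 'a::field mat) \<in> carrier_mat n n" and tr: "transports B0 P B" and v: "v \<in> carrier_vec n"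
  shows "quad B v = quad B0 (v \<lhd>\<^sub>m P)"
proof -
  have P: "P \<in> carrier_mat n n" and B: "B \<in> carrier_mat n n" and alt: "alternating_mat (P * B0 * P\<^sup>T - B)"
    using tr B0 GL_carrier_mat unfolding transports_def by auto
  define M where "M = P * B0 * P\<^sup>T"
  have M: "M \<in> carrier_mat n n" unfolding M_def using P B0 by simp
  have MB: "M - B \<in> carrier_mat n n" using B by (rule minus_carrier_mat)
  have "M = (M - B) + B" using M B by (intro eq_matI) auto
  then have "v \<lhd>\<^sub>m M = v \<lhd>\<^sub>m (M - B) + v \<lhd>\<^sub>m B"
    using row_mult_mat_add[OF MB B v] by simp
  then have "quad M v = quad (M - B) v + quad B v"
    unfolding quad_def using MB B v by (simp add: add_scalar_prod_distrib[of _ n])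
  moreover have "quad (M - B) v = 0"
    by (rule quad_alternating[OF MB _ v]) (use alt in \<open>simp add: M_def\<close>)
  moreover have "quad M v = quad B0 (v \<lhd>\<^sub>m P)"
  proof -
    define u where "u = (v \<lhd>\<^sub>m P) \<lhd>\<^sub>m B0"
    have u: "u \<in> carrier_vec n" unfolding u_def using B0 by simp
    have "v \<lhd>\<^sub>m M = u \<lhd>\<^sub>m P\<^sup>T"
      unfolding M_def u_def using P B0 v by (simp add: row_mult_mult[of _ n n _ n])
    also have "\<dots> = P *\<^sub>v u" unfolding row_mult_def by simp
    finally have "quad M v = (P *\<^sub>v u) \<bullet> v" unfolding quad_def by simp
    also have "\<dots> = v \<bullet> (P *\<^sub>v u)" using P u v by (intro comm_scalar_prod[of _ n]) auto
    also have "\<dots> = (v \<lhd>\<^sub>m P) \<bullet> u"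
      unfolding row_mult_def using P u v by (intro transpose_vec_mult_scalar[symmetric, of _ n n]) auto
    also have "\<dots> = u \<bullet> (v \<lhd>\<^sub>m P)" using P u by (intro comm_scalar_prod[of _ n]) auto
    finally show ?thesis unfolding quad_def u_def .
  qed
  ultimately show ?thesis by simp
qed

lemma mat_conj_carrier:
  assumes "P \<in> carrier (GL n)" "X \<in> carrier_mat n n"
  shows "mat_conj X P = inv\<^bsub>GL n\<^esub> P * X * P" "mat_conj X P \<in> carrier_mat n n"
  using assms GL_carrier_mat[OF assms(1)] GL_inv(1)[OF assms(1)] unfolding mat_conj_def by auto

lemma row_mult_mat_conj:
  assumes "P \<in> carrier (GL n)" "X \<in> carrier_mat n n" "v \<in> carrier_vec n"
  shows "v \<lhd>\<^sub>m mat_conj X P = ((v \<lhd>\<^sub>m inv\<^bsub>GL n\<^esub> P) \<lhd>\<^sub>m X) \<lhd>\<^sub>m P"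
  using assms GL_carrier_mat[OF assms(1)] GL_inv(1)[OF assms(1)]
  by (simp add: mat_conj_carrier(1)[OF assms(1,2)] row_mult_mult[of _ n n _ n])

lemma mat_conj_mult:
  assumes P: "P \<in> carrier (GL n)" and X: "X \<in> carrier_mat n n" and Y: "Y \<in> carrier_mat n n"
  shows "mat_conj (X * Y) P = mat_conj X P * mat_conj Y P"
proof (rule mat_eq_row_multI)
  note c = mat_conj_carrier(2)[OF P]
  note GI = GL_inv(1)[OF P] GL_carrier_mat[OF P]
  fix v :: "'a vec" assume v: "v \<in> carrier_vec n"
  show "v \<lhd>\<^sub>m mat_conj (X * Y) P = v \<lhd>\<^sub>m (mat_conj X P * mat_conj Y P)"
    using v X Y P GI c[OF X] c[OF Y]
    by (simp add: row_mult_mult[of _ n n _ n] row_mult_mat_conj)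
next
  show "mat_conj (X * Y) P \<in> carrier_mat n n" by (rule mat_conj_carrier(2)[OF P mult_carrier_mat[OF X Y]])
  show "mat_conj X P * mat_conj Y P \<in> carrier_mat n n"
    by (rule mult_carrier_mat[OF mat_conj_carrier(2)[OF P X] mat_conj_carrier(2)[OF P Y]])
qed

lemma mat_conj_inverse:
  assumes P: "P \<in> carrier (GL n)" and X: "X \<in> carrier_mat n n"
  shows "mat_conj (mat_conj X P) (inv\<^bsub>GL n\<^esub> P) = X" "mat_conj (mat_conj X (inv\<^bsub>GL n\<^esub> P)) P = X"
proof -
  interpret group "GL n :: 'a mat monoid" by (rule group_GL)
  have P': "inv\<^bsub>GL n\<^esub> P \<in> carrier (GL n)" using P by simp
  have ii: "inv\<^bsub>GL n\<^esub> (inv\<^bsub>GL n\<^esub> P) = P" using P by simp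
  note GI = GL_inv(1)[OF P] GL_carrier_mat[OF P]
  note c = mat_conj_carrier(2)[OF P X] mat_conj_carrier(2)[OF P' X]
  note c' = mat_conj_carrier(2)[OF P' c(1)] mat_conj_carrier(2)[OF P c(2)]
  show "mat_conj (mat_conj X P) (inv\<^bsub>GL n\<^esub> P) = X"
  proof (rule mat_eq_row_multI[OF c'(1) X])
    fix v :: "'a vec" assume v: "v \<in> carrier_vec n"
    show "v \<lhd>\<^sub>m mat_conj (mat_conj X P) (inv\<^bsub>GL n\<^esub> P) = v \<lhd>\<^sub>m X"
      using v P X GI by (simp add: row_mult_mat_conj[OF P' c(1)] row_mult_mat_conj[OF P X] ii)
  qed
  show "mat_conj (mat_conj X (inv\<^bsub>GL n\<^esub> P)) P = X"
  proof (rule mat_eq_row_multI[OF c'(2) X])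
    fix v :: "'a vec" assume v: "v \<in> carrier_vec n"
    show "v \<lhd>\<^sub>m mat_conj (mat_conj X (inv\<^bsub>GL n\<^esub> P)) P = v \<lhd>\<^sub>m X"
      using v P X GI by (simp add: row_mult_mat_conj[OF P c(2)] row_mult_mat_conj[OF P' X] ii)
  qed
qed

lemma mat_conj_in_GL:
  assumes P: "P \<in> carrier (GL n)" and X: "X \<in> carrier (GL n)"
  shows "mat_conj X P \<in> carrier (GL n)"
proof -
  interpret group "GL n :: 'a mat monoid" by (rule group_GL)
  have "inv\<^bsub>GL n\<^esub> P \<otimes>\<^bsub>GL n\<^esub> X \<otimes>\<^bsub>GL n\<^esub> P \<in> carrier (GL n)" using P X by simp
  then show ?thesis unfolding mat_conj_carrier(1)[OF P GL_carrier_mat[OF X]] GL_simps(2) .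
qed

text \<open>Right multiplication by \<open>P\<close> carries the fixed vectors of \<open>X\<close>
  onto those of its conjugate, so both fixed spaces have the same dimension.\<close>

lemma (in even_field) spinor_norm_mat_conj:
  assumes P: "P \<in> carrier (GL n)" and X: "(X :: 'a mat) \<in> carrier_mat n n"
  shows "spinor_norm (mat_conj X P) = spinor_norm X"
proof -
  interpret group "GL n :: 'a mat monoid" by (rule group_GL)
  note GI = GL_inv(1)[OF P] GL_carrier_mat[OF P]
  note c = mat_conj_carrier(2)[OF P X]
  have eq: "v \<lhd>\<^sub>m P \<in> fixed_vecs (mat_conj X P) \<longleftrightarrow> v \<in> fixed_vecs X" if v: "v \<in> carrier_vec n" for v
  proof -
    have "(v \<lhd>\<^sub>m P) \<lhd>\<^sub>m mat_conj X P = (v \<lhd>\<^sub>m X) \<lhd>\<^sub>m P"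
      using row_mult_mat_conj[OF P X, of "v \<lhd>\<^sub>m P"] P GI v by simp
    moreover have "(v \<lhd>\<^sub>m X) \<lhd>\<^sub>m P = v \<lhd>\<^sub>m P \<longleftrightarrow> v \<lhd>\<^sub>m X = v"
      using row_mult_inv(1)[OF P, of "v \<lhd>\<^sub>m X"] row_mult_inv(1)[OF P v] X by (metis row_mult_carrier)
    ultimately show ?thesis unfolding fixed_vecs_def using c X GI v by simp
  qed
  have "card (fixed_vecs X) = card (fixed_vecs (mat_conj X P))"
  proof (rule bij_betw_same_card, rule bij_betwI)
    have fc: "fixed_vecs X \<subseteq> carrier_vec n" "fixed_vecs (mat_conj X P) \<subseteq> carrier_vec n"
      unfolding fixed_vecs_def using c X by auto
    show "(\<lambda>v. v \<lhd>\<^sub>m P) \<in> fixed_vecs X \<rightarrow> fixed_vecs (mat_conj X P)" using eq fc by auto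
    show "(\<lambda>v. v \<lhd>\<^sub>m inv\<^bsub>GL n\<^esub> P) \<in> fixed_vecs (mat_conj X P) \<rightarrow> fixed_vecs X"
    proof
      fix v assume v: "v \<in> fixed_vecs (mat_conj X P)"
      then have "v \<in> carrier_vec n" using fc by blast
      then show "v \<lhd>\<^sub>m inv\<^bsub>GL n\<^esub> P \<in> fixed_vecs X"
        using v eq[of "v \<lhd>\<^sub>m inv\<^bsub>GL n\<^esub> P"] P GI by simp
    qed
    show "v \<lhd>\<^sub>m P \<lhd>\<^sub>m inv\<^bsub>GL n\<^esub> P = v" if "v \<in> fixed_vecs X" for v using that fc P by auto
    show "v \<lhd>\<^sub>m inv\<^bsub>GL n\<^esub> P \<lhd>\<^sub>m P = v" if "v \<in> fixed_vecs (mat_conj X P)" for v using that fc P by auto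
  qed
  moreover obtain d where "card (fixed_vecs X) = CARD('a) ^ d" "spinor_norm X = (n + d) mod 2"
    using spinor_norm_fixed[OF X] by blast
  ultimately show ?thesis using spinor_norm_eqI[OF c] by simp
qed

lemma isometry_transports:
  assumes B0: "(B0 :: 'a::field mat) \<in> carrier_mat n n" and tr: "transports B0 P B"
  shows "(\<lambda>X. mat_conj X P) \<in> iso (isometry_group B) (isometry_group B0)"
proof -
  interpret group "GL n :: 'a mat monoid" by (rule group_GL)
  have P: "P \<in> carrier (GL n)" and B: "B \<in> carrier_mat n n" using tr B0 unfolding transports_def by auto
  have P': "inv\<^bsub>GL n\<^esub> P \<in> carrier (GL n)" using P by simp
  have ii: "inv\<^bsub>GL n\<^esub> (inv\<^bsub>GL n\<^esub> P) = P" using P by simp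
  note GI = GL_inv(1)[OF P] GL_carrier_mat[OF P]
  note q = quad_transports[OF B0 tr]
  have to: "mat_conj X P \<in> carrier (isometry_group B0)" if X: "X \<in> carrier (isometry_group B)" for X
  proof -
    have XG: "X \<in> carrier (GL n)" and XQ: "\<And>v. v \<in> carrier_vec n \<Longrightarrow> quad B (v \<lhd>\<^sub>m X) = quad B v"
      using X unfolding isometry_group_simps[OF B] by auto
    have "quad B0 (v \<lhd>\<^sub>m mat_conj X P) = quad B0 v" if v: "v \<in> carrier_vec n" for v
    proof -
      have "quad B0 (v \<lhd>\<^sub>m mat_conj X P) = quad B ((v \<lhd>\<^sub>m inv\<^bsub>GL n\<^esub> P) \<lhd>\<^sub>m X)"
        unfolding row_mult_mat_conj[OF P GL_carrier_mat[OF XG] v] using q GL_carrier_mat[OF XG] by simp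
      also have "\<dots> = quad B (v \<lhd>\<^sub>m inv\<^bsub>GL n\<^esub> P)" using XQ GI by simp
      also have "\<dots> = quad B0 v" using q[of "v \<lhd>\<^sub>m inv\<^bsub>GL n\<^esub> P"] GI P v by simp
      finally show ?thesis .
    qed
    then show ?thesis unfolding isometry_group_simps[OF B0] using mat_conj_in_GL[OF P XG] by blast
  qed
  have conv: "mat_conj X (inv\<^bsub>GL n\<^esub> P) \<in> carrier (isometry_group B)" if X: "X \<in> carrier (isometry_group B0)" for X
  proof -
    have XG: "X \<in> carrier (GL n)" and XQ: "\<And>v. v \<in> carrier_vec n \<Longrightarrow> quad B0 (v \<lhd>\<^sub>m X) = quad B0 v"
      using X unfolding isometry_group_simps[OF B0] by auto
    have "quad B (v \<lhd>\<^sub>m mat_conj X (inv\<^bsub>GL n\<^esub> P)) = quad B v" if v: "v \<in> carrier_vec n" for v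
    proof -
      have "quad B (v \<lhd>\<^sub>m mat_conj X (inv\<^bsub>GL n\<^esub> P)) = quad B0 ((v \<lhd>\<^sub>m P) \<lhd>\<^sub>m X)"
        unfolding row_mult_mat_conj[OF P' GL_carrier_mat[OF XG] v] ii using q GL_carrier_mat[OF XG] GI P by simp
      also have "\<dots> = quad B v" using XQ GI q[OF v] by simp
      finally show ?thesis .
    qed
    then show ?thesis unfolding isometry_group_simps[OF B] using mat_conj_in_GL[OF P' XG] by blast
  qed
  have "bij_betw (\<lambda>X. mat_conj X P) (carrier (isometry_group B)) (carrier (isometry_group B0))"
    by (rule bij_betwI[where g = "\<lambda>X. mat_conj X (inv\<^bsub>GL n\<^esub> P)"])
      (use to conv mat_conj_inverse[OF P] isometry_carrier_mat[OF B] isometry_carrier_mat[OF B0] in auto)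
  then show ?thesis
    unfolding iso_def hom_def
    using to mat_conj_mult[OF P] isometry_carrier_mat[OF B] isometry_group_simps(2)[OF B] isometry_group_simps(2)[OF B0] by simp
qed

text \<open>Conjugation preserves spinor norms, so the isomorphism of isometry groups matches the
  subgroups of norm zero in both directions.\<close>

lemma (in even_field) Omega_transports:
  assumes B0: "(B0 :: 'a mat) \<in> carrier_mat n n" and tr: "transports B0 P B"
  shows "(\<lambda>X. mat_conj X P) \<in> iso (Omega B) (Omega B0)"
    and "X \<in> carrier (isometry_group B) \<Longrightarrow> mat_conj X P \<in> carrier (Omega B0) \<longleftrightarrow> X \<in> carrier (Omega B)"
proof -
  have P: "P \<in> carrier (GL n)" and B: "B \<in> carrier_mat n n" using tr B0 unfolding transports_def by auto
  note i = isometry_transports[OF B0 tr]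
  have b: "inj_on (\<lambda>X. mat_conj X P) (carrier (isometry_group B))" "(\<lambda>X. mat_conj X P) ` carrier (isometry_group B) = carrier (isometry_group B0)"
    using i unfolding iso_def bij_betw_def by auto
  show eq: "mat_conj X P \<in> carrier (Omega B0) \<longleftrightarrow> X \<in> carrier (Omega B)" if "X \<in> carrier (isometry_group B)" for X
    using that b spinor_norm_mat_conj[OF P isometry_carrier_mat[OF B that]] unfolding Omega_simps(1) by auto
  have sub: "carrier (Omega B) \<subseteq> carrier (isometry_group B)" "carrier (Omega B0) \<subseteq> carrier (isometry_group B0)"
    unfolding Omega_simps(1) by auto
  have "(\<lambda>X. mat_conj X P) ` carrier (Omega B) = carrier (Omega B0)"
  proof
    show "carrier (Omega B0) \<subseteq> (\<lambda>X. mat_conj X P) ` carrier (Omega B)"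
    proof
      fix Y assume Y: "Y \<in> carrier (Omega B0)"
      then obtain X where "X \<in> carrier (isometry_group B)" "Y = mat_conj X P" using sub b(2) by blast
      then show "Y \<in> (\<lambda>X. mat_conj X P) ` carrier (Omega B)" using Y eq by blast
    qed
  qed (use eq sub in blast)
  moreover have "inj_on (\<lambda>X. mat_conj X P) (carrier (Omega B))" using b(1) sub(1) by (rule inj_on_subset)
  moreover have "mat_conj (X \<otimes>\<^bsub>Omega B\<^esub> Y) P = mat_conj X P \<otimes>\<^bsub>Omega B0\<^esub> mat_conj Y P"
    if "X \<in> carrier (Omega B)" "Y \<in> carrier (Omega B)" for X Y
    using that i sub unfolding Omega_def iso_def hom_def by auto
  ultimately show "(\<lambda>X. mat_conj X P) \<in> iso (Omega B) (Omega B0)"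
    unfolding iso_def hom_def bij_betw_def using eq sub by auto
qed

lemma nonsingular_transports:
  assumes B0: "(B0 :: 'a::field mat) \<in> carrier_mat n n" and tr: "transports B0 P B" and ns: "nonsingular B0"
  shows "nonsingular B"
proof -
  have P: "P \<in> carrier (GL n)" and B: "B \<in> carrier_mat n n" using tr B0 unfolding transports_def by auto
  note GI = GL_inv(1)[OF P] GL_carrier_mat[OF P]
  have p: "polar B u v = polar B0 (u \<lhd>\<^sub>m P) (v \<lhd>\<^sub>m P)" if "u \<in> carrier_vec n" "v \<in> carrier_vec n" for u v
    unfolding polar_def using that quad_transports[OF B0 tr] row_mult_add[OF GI(2)] by simp
  show ?thesis
    unfolding nonsingular_def
  proof (intro ballI impI)
    fix u :: "'a vec" assume u: "u \<in> carrier_vec (dim_row B)" and 0: "\<forall>v\<in>carrier_vec (dim_row B). polar B u v = 0"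
    have u: "u \<in> carrier_vec n" using u B by simp
    have "polar B0 (u \<lhd>\<^sub>m P) v = 0" if v: "v \<in> carrier_vec n" for v
    proof -
      have "polar B u (v \<lhd>\<^sub>m inv\<^bsub>GL n\<^esub> P) = 0" using 0 B GI by simp
      then show ?thesis using p[OF u, of "v \<lhd>\<^sub>m inv\<^bsub>GL n\<^esub> P"] GI P v by simp
    qed
    then have "u \<lhd>\<^sub>m P = 0\<^sub>v n" using ns B0 GI unfolding nonsingular_def by simp
    then have "u = 0\<^sub>v n \<lhd>\<^sub>m inv\<^bsub>GL n\<^esub> P" using row_mult_inv(1)[OF P u] by simp
    also have "\<dots> = 0\<^sub>v n" unfolding row_mult_def using GI by (intro eq_vecI) auto
    finally show "u = 0\<^sub>v (dim_row B)" using B by simp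
  qed
qed

section \<open>Block form of the centralizer of a semisimple element\<close>

lemma mat_poly_carrier: "A \<in> carrier_mat n n \<Longrightarrow> mat_poly f A \<in> carrier_mat n n"
  unfolding mat_poly_def by auto

lemma row_mult_index:
  assumes "X \<in> carrier_mat n m" "v \<in> carrier_vec n" "j < m"
  shows "(v \<lhd>\<^sub>m X) $ j = (\<Sum>i<n. X $$ (i, j) * v $ i)"
  using assms unfolding row_mult_def by (simp add: scalar_prod_def atLeast0LessThan)

context
  fixes A :: "'a::field mat" and n :: nat
  assumes A: "A \<in> carrier_mat n n"
begin

text \<open>Allowing any upper bound beyond the degree lets sums for polynomials of different
  degrees be added term by term.\<close>

lemma row_mult_mat_poly_bound:
  assumes v: "v \<in> carrier_vec n" and j: "j < n" and N: "degree f \<le> N"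
  shows "(v \<lhd>\<^sub>m mat_poly f A) $ j = (\<Sum>k\<le>N. coeff f k * (v \<lhd>\<^sub>m (A ^\<^sub>m k)) $ j)"
proof -
  have Ak: "A ^\<^sub>m k \<in> carrier_mat n n" for k by (rule pow_carrier_mat[OF A])
  have "(v \<lhd>\<^sub>m mat_poly f A) $ j = (\<Sum>i<n. (\<Sum>k\<le>degree f. coeff f k * (A ^\<^sub>m k) $$ (i, j)) * v $ i)"
    unfolding row_mult_index[OF mat_poly_carrier[OF A] v j] unfolding mat_poly_def using A j by simp
  also have "\<dots> = (\<Sum>i<n. \<Sum>k\<le>degree f. coeff f k * ((A ^\<^sub>m k) $$ (i, j) * v $ i))"
    by (simp add: sum_distrib_right mult.assoc)
  also have "\<dots> = (\<Sum>k\<le>degree f. \<Sum>i<n. coeff f k * ((A ^\<^sub>m k) $$ (i, j) * v $ i))" by (rule sum.swap)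
  also have "\<dots> = (\<Sum>k\<le>degree f. coeff f k * (v \<lhd>\<^sub>m (A ^\<^sub>m k)) $ j)"
    unfolding row_mult_index[OF Ak v j] by (simp add: sum_distrib_left)
  also have "\<dots> = (\<Sum>k\<le>N. coeff f k * (v \<lhd>\<^sub>m (A ^\<^sub>m k)) $ j)"
    by (rule sum.mono_neutral_left) (use N in \<open>auto simp: coeff_eq_0\<close>)
  finally show ?thesis .
qed

lemma row_mult_mat_poly_apply:
  assumes v: "v \<in> carrier_vec n" and j: "j < n" and Y: "Y \<in> carrier_mat n n"
  shows "((v \<lhd>\<^sub>m mat_poly f A) \<lhd>\<^sub>m Y) $ j = (\<Sum>k\<le>degree f. coeff f k * ((v \<lhd>\<^sub>m (A ^\<^sub>m k)) \<lhd>\<^sub>m Y) $ j)"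
proof -
  have Ak: "v \<lhd>\<^sub>m (A ^\<^sub>m k) \<in> carrier_vec n" for k using pow_carrier_mat[OF A, of k] by simp
  have "((v \<lhd>\<^sub>m mat_poly f A) \<lhd>\<^sub>m Y) $ j = (\<Sum>i<n. Y $$ (i, j) * (\<Sum>k\<le>degree f. coeff f k * (v \<lhd>\<^sub>m (A ^\<^sub>m k)) $ i))"
    unfolding row_mult_index[OF Y row_mult_carrier[OF mat_poly_carrier[OF A]] j]
    by (rule sum.cong) (simp_all add: row_mult_mat_poly_bound[OF v _ order_refl])
  also have "\<dots> = (\<Sum>i<n. \<Sum>k\<le>degree f. coeff f k * (Y $$ (i, j) * (v \<lhd>\<^sub>m (A ^\<^sub>m k)) $ i))"
    by (simp add: sum_distrib_left mult_ac)
  also have "\<dots> = (\<Sum>k\<le>degree f. \<Sum>i<n. coeff f k * (Y $$ (i, j) * (v \<lhd>\<^sub>m (A ^\<^sub>m k)) $ i))" by (rule sum.swap)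
  also have "\<dots> = (\<Sum>k\<le>degree f. coeff f k * ((v \<lhd>\<^sub>m (A ^\<^sub>m k)) \<lhd>\<^sub>m Y) $ j)"
    unfolding row_mult_index[OF Y Ak j] by (simp add: sum_distrib_left)
  finally show ?thesis .
qed

text \<open>A matrix commuting with \<open>A\<close> commutes with all its powers, hence preserves
  the kernel of every polynomial in \<open>A\<close>.\<close>

lemma mat_poly_commute:
  assumes v: "v \<in> carrier_vec n" and Y: "Y \<in> carrier_mat n n" and comm: "Y * A = A * Y"
  shows "(v \<lhd>\<^sub>m Y) \<lhd>\<^sub>m mat_poly f A = (v \<lhd>\<^sub>m mat_poly f A) \<lhd>\<^sub>m Y"
proof (rule eq_vecI)
  note M = mat_poly_carrier[OF A, of f]
  have Ak: "A ^\<^sub>m k \<in> carrier_mat n n" for k by (rule pow_carrier_mat[OF A])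
  have ck: "Y * A ^\<^sub>m k = A ^\<^sub>m k * Y" for k
  proof (induction k)
    case 0
    then show ?case using A Y by simp
  next
    case (Suc k)
    have "Y * A ^\<^sub>m Suc k = (Y * A ^\<^sub>m k) * A" using A Y Ak[of k] by (simp add: assoc_mult_mat[of _ n n _ n _ n])
    also have "\<dots> = A ^\<^sub>m k * (Y * A)" unfolding Suc using A Y Ak[of k] by (simp add: assoc_mult_mat[of _ n n _ n _ n])
    also have "\<dots> = A ^\<^sub>m Suc k * Y" unfolding comm using A Y Ak[of k] by (simp add: assoc_mult_mat[of _ n n _ n _ n])
    finally show ?case .
  qed
  fix j assume "j < dim_vec ((v \<lhd>\<^sub>m mat_poly f A) \<lhd>\<^sub>m Y)"
  then have j: "j < n" using Y unfolding row_mult_def by simp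
  have "((v \<lhd>\<^sub>m Y) \<lhd>\<^sub>m mat_poly f A) $ j = (\<Sum>k\<le>degree f. coeff f k * ((v \<lhd>\<^sub>m Y) \<lhd>\<^sub>m (A ^\<^sub>m k)) $ j)"
    by (rule row_mult_mat_poly_bound) (use Y j in auto)
  also have "\<dots> = (\<Sum>k\<le>degree f. coeff f k * ((v \<lhd>\<^sub>m (A ^\<^sub>m k)) \<lhd>\<^sub>m Y) $ j)"
    using row_mult_mult[OF Y Ak v] row_mult_mult[OF Ak Y v] ck by simp
  also have "\<dots> = ((v \<lhd>\<^sub>m mat_poly f A) \<lhd>\<^sub>m Y) $ j" by (rule row_mult_mat_poly_apply[OF v j Y, symmetric])
  finally show "((v \<lhd>\<^sub>m Y) \<lhd>\<^sub>m mat_poly f A) $ j = ((v \<lhd>\<^sub>m mat_poly f A) \<lhd>\<^sub>m Y) $ j" .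
qed (use Y mat_poly_carrier[OF A, of f] in \<open>auto simp: row_mult_def\<close>)

text \<open>Since (t + 1) g = g + t g, evaluation splits into g(A) and g(A) A. The factor t + 1 is
  the only one ever split off from the minimal polynomial.\<close>

lemma row_mult_mat_poly_linear:
  assumes v: "v \<in> carrier_vec n"
  shows "v \<lhd>\<^sub>m mat_poly ([:1, 1:] * g) A = v \<lhd>\<^sub>m mat_poly g A + (v \<lhd>\<^sub>m mat_poly g A) \<lhd>\<^sub>m A"
proof (rule eq_vecI)
  have Ak: "A ^\<^sub>m k \<in> carrier_mat n n" for k by (rule pow_carrier_mat[OF A])
  have vAk: "v \<lhd>\<^sub>m (A ^\<^sub>m k) \<in> carrier_vec n" for k using Ak[of k] by simp
  have e: "[:1, 1:] * g = g + pCons 0 g" by simp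
  fix j assume "j < dim_vec (v \<lhd>\<^sub>m mat_poly g A + (v \<lhd>\<^sub>m mat_poly g A) \<lhd>\<^sub>m A)"
  then have j: "j < n" using A unfolding row_mult_def by simp
  let ?N = "Suc (degree g)"
  have "(v \<lhd>\<^sub>m mat_poly (g + pCons 0 g) A) $ j = (\<Sum>k\<le>?N. coeff (g + pCons 0 g) k * (v \<lhd>\<^sub>m (A ^\<^sub>m k)) $ j)"
    by (rule row_mult_mat_poly_bound[OF v j]) (auto intro!: degree_add_le simp: degree_pCons_le)
  also have "\<dots> = (\<Sum>k\<le>?N. coeff g k * (v \<lhd>\<^sub>m (A ^\<^sub>m k)) $ j) + (\<Sum>k\<le>?N. coeff (pCons 0 g) k * (v \<lhd>\<^sub>m (A ^\<^sub>m k)) $ j)"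
    by (simp add: distrib_right sum.distrib del: sum.atMost_Suc)
  also have "(\<Sum>k\<le>?N. coeff g k * (v \<lhd>\<^sub>m (A ^\<^sub>m k)) $ j) = (v \<lhd>\<^sub>m mat_poly g A) $ j"
    by (rule row_mult_mat_poly_bound[OF v j, symmetric]) simp
  also have "(\<Sum>k\<le>?N. coeff (pCons 0 g) k * (v \<lhd>\<^sub>m (A ^\<^sub>m k)) $ j) = (\<Sum>k\<le>degree g. coeff g k * ((v \<lhd>\<^sub>m (A ^\<^sub>m k)) \<lhd>\<^sub>m A) $ j)"
    unfolding sum.atMost_Suc_shift using row_mult_mult[OF Ak A v] by simp
  also have "\<dots> = ((v \<lhd>\<^sub>m mat_poly g A) \<lhd>\<^sub>m A) $ j" by (rule row_mult_mat_poly_apply[OF v j A, symmetric])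
  finally show "(v \<lhd>\<^sub>m mat_poly ([:1, 1:] * g) A) $ j = (v \<lhd>\<^sub>m mat_poly g A + (v \<lhd>\<^sub>m mat_poly g A) \<lhd>\<^sub>m A) $ j"
    unfolding e using j A by (simp add: row_mult_def)
qed (use A mat_poly_carrier[OF A] in \<open>auto simp: row_mult_def mat_poly_def\<close>)

lemma row_mult_mat_poly_one: 
  assumes v: "v \<in> carrier_vec n" shows "v \<lhd>\<^sub>m mat_poly 1 A = v"
proof (rule eq_vecI)
  fix j assume "j < dim_vec v"
  then have j: "j < n" using v by simp
  show "(v \<lhd>\<^sub>m mat_poly 1 A) $ j = v $ j"
    using row_mult_mat_poly_bound[OF v j order_refl, of 1] v A by simp
qed (use A v mat_poly_carrier[OF A] in \<open>auto simp: row_mult_def mat_poly_def\<close>)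

lemma row_mult_mat_poly_linear_factor:
  "v \<in> carrier_vec n \<Longrightarrow> v \<lhd>\<^sub>m mat_poly [:1, 1:] A = v + v \<lhd>\<^sub>m A"
  using row_mult_mat_poly_linear[of v 1] row_mult_mat_poly_one by simp

text \<open>A fixed vector is an eigenvector of eigenvalue 1 for every power of \<open>A\<close>, so
  a polynomial acts on it through the sum of its coefficients.\<close>

lemma row_mult_mat_poly_fixed:
  assumes v: "v \<in> carrier_vec n" and fixed: "v \<lhd>\<^sub>m A = v"
  shows "v \<lhd>\<^sub>m mat_poly f A = poly f 1 \<cdot>\<^sub>v v"
proof (rule eq_vecI)
  have vk: "v \<lhd>\<^sub>m (A ^\<^sub>m k) = v" for k
  proof (induction k)
    case 0
    then show ?case using A v by simp
  next
    case (Suc k)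
    then show ?case using row_mult_mult[OF pow_carrier_mat[OF A] A v] fixed by simp
  qed
  fix j assume "j < dim_vec (poly f 1 \<cdot>\<^sub>v v)"
  then have j: "j < n" using v by simp
  show "(v \<lhd>\<^sub>m mat_poly f A) $ j = (poly f 1 \<cdot>\<^sub>v v) $ j"
    unfolding row_mult_mat_poly_bound[OF v j order_refl] vk using v j by (simp add: poly_altdef sum_distrib_right)
qed (use A v mat_poly_carrier[OF A] in \<open>auto simp: row_mult_def mat_poly_def\<close>)

end

section \<open>Coordinate intervals of a block decomposition\<close>

definition in_block :: "nat list \<Rightarrow> nat \<Rightarrow> nat \<Rightarrow> bool" where
  "in_block ms i j \<longleftrightarrow> sum_list (take i ms) \<le> j \<and> j < sum_list (take (Suc i) ms)"

lemma in_block_Cons: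
  "in_block (m # ms) 0 j \<longleftrightarrow> j < m" "in_block (m # ms) (Suc i) j \<longleftrightarrow> m \<le> j \<and> in_block ms i (j - m)"
  unfolding in_block_def by auto

lemma in_block_exists: "j < sum_list ms \<Longrightarrow> \<exists>i<length ms. in_block ms i j"
proof (induction ms arbitrary: j)
  case (Cons m ms)
  show ?case
  proof (cases "j < m")
    case True
    then show ?thesis by (intro exI[of _ 0]) (simp add: in_block_Cons)
  next
    case False
    then have "j - m < sum_list ms" using Cons.prems by simp
    then obtain i where "i < length ms" "in_block ms i (j - m)" using Cons.IH by blast
    then show ?thesis using False by (intro exI[of _ "Suc i"]) (simp add: in_block_Cons)
  qed
qed simp

text \<open>If the support of each row stays inside the interval of that row, both off-diagonal
  pieces of the splitting after the first block vanish, and the lower right piece satisfies the same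
  condition.\<close>

lemma block_diagonal_decomposition:
  fixes Y :: "'a::zero mat"
  assumes "Y \<in> carrier_mat (sum_list ms) (sum_list ms)"
    and "\<And>i a b. i < length ms \<Longrightarrow> in_block ms i a \<Longrightarrow> a < sum_list ms \<Longrightarrow> b < sum_list ms \<Longrightarrow> \<not> in_block ms i b \<Longrightarrow> Y $$ (a, b) = 0"
  shows "\<exists>Us. list_all2 (\<lambda>U m. U \<in> carrier_mat m m) Us ms \<and> Y = diag_block_mat Us"
  using assms
proof (induction ms arbitrary: Y)
  case Nil
  then have "Y = diag_block_mat []" by (auto intro!: eq_matI)
  then show ?case by (intro exI[of _ "[]"]) simp
next
  case (Cons m ms)
  let ?k = "sum_list ms"
  obtain Y1 Y2 Y3 Y4 where sp: "split_block Y m m = (Y1, Y2, Y3, Y4)" by (metis prod_cases4)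
  have dims: "dim_row Y = m + ?k" "dim_col Y = m + ?k" using Cons.prems(1) by auto
  note s = split_block[OF sp dims]
  have ent: "Y2 $$ (a, b) = Y $$ (a, m + b)" if "a < m" "b < ?k" for a b
    using s that by simp
  have Y2: "Y2 = 0\<^sub>m m ?k"
  proof (rule eq_matI)
    fix a b assume "a < dim_row (0\<^sub>m m ?k)" "b < dim_col (0\<^sub>m m ?k)"
    then have ab: "a < m" "b < ?k" by auto
    then have "Y $$ (a, m + b) = 0"
      by (intro Cons.prems(2)[of 0]) (simp_all add: in_block_Cons)
    then show "Y2 $$ (a, b) = 0\<^sub>m m ?k $$ (a, b)" using s ab by simp
  qed (use s in auto)
  have Y3: "Y3 = 0\<^sub>m ?k m"
  proof (rule eq_matI)
    fix a b assume "a < dim_row (0\<^sub>m ?k m)" "b < dim_col (0\<^sub>m ?k m)"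
    then have ab: "a < ?k" "b < m" by auto
    \<comment> \<open>A row of the lower part lies in some later block, whose interval avoids the
      first \<open>m\<close> columns; the index is shifted by one for the head.\<close>
    obtain i where i: "i < length ms" "in_block ms i a" using in_block_exists[OF ab(1)] by blast
    then have "Y $$ (m + a, b) = 0"
      using ab by (intro Cons.prems(2)[of "Suc i"]) (simp_all add: in_block_Cons)
    then show "Y3 $$ (a, b) = 0\<^sub>m ?k m $$ (a, b)" using s ab by simp
  qed (use s in auto)
  have "\<exists>Us. list_all2 (\<lambda>U m. U \<in> carrier_mat m m) Us ms \<and> Y4 = diag_block_mat Us"
  proof (rule Cons.IH[OF s(4)])
    fix i a b assume *: "i < length ms" "in_block ms i a" "a < ?k" "b < ?k" "\<not> in_block ms i b"
    then have "Y $$ (m + a, m + b) = 0"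
      by (intro Cons.prems(2)[of "Suc i"]) (simp_all add: in_block_Cons)
    then show "Y4 $$ (a, b) = 0" using s * by simp
  qed
  then obtain Us where Us: "list_all2 (\<lambda>U m. U \<in> carrier_mat m m) Us ms" "Y4 = diag_block_mat Us" by blast
  have "Y = diag_block_mat (Y1 # Us)"
    unfolding diag_block_mat_Cons block_sum_def Us(2)[symmetric] using s Y2 Y3 by simp
  then show ?case using Us s(1) by (intro exI[of _ "Y1 # Us"]) simp
qed

text \<open>The inclusion of the i-th summand into the whole space; it lets properties of
  \<open>S\<close> on a kernel be read on the single block.\<close>

definition embed_block :: "nat list \<Rightarrow> nat \<Rightarrow> 'a::zero vec \<Rightarrow> 'a vec" where
  "embed_block ms i v = vec (sum_list ms) (\<lambda>j. if in_block ms i j then v $ (j - sum_list (take i ms)) else 0)"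

lemma embed_block_Cons:
  "v \<in> carrier_vec m \<Longrightarrow> embed_block (m # ms) 0 v = v @\<^sub>v 0\<^sub>v (sum_list ms)"
  "embed_block (m # ms) (Suc i) v = 0\<^sub>v m @\<^sub>v embed_block ms i v"
  unfolding embed_block_def by (intro eq_vecI; auto simp: in_block_Cons)+

lemma embed_block_carrier: "embed_block ms i v \<in> carrier_vec (sum_list ms)"
  unfolding embed_block_def by simp

lemma embed_block_inj:
  "i < length ms \<Longrightarrow> u \<in> carrier_vec (ms ! i) \<Longrightarrow> v \<in> carrier_vec (ms ! i) \<Longrightarrow>
    embed_block ms i u = embed_block ms i v \<Longrightarrow> u = v"
proof (induction ms arbitrary: i)
  case (Cons m ms)
  show ?case
  proof (cases i)
    case 0
    then show ?thesis using Cons.prems by (simp add: embed_block_Cons append_vec_eq[of u m v])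
  next
    case (Suc i')
    then have "embed_block ms i' u = embed_block ms i' v"
      using Cons.prems append_vec_eq[OF zero_carrier_vec zero_carrier_vec, of m "embed_block ms i' u" "embed_block ms i' v"]
      by (simp add: embed_block_Cons)
    then show ?thesis using Cons.IH[of i'] Cons.prems Suc by simp
  qed
qed simp

lemma row_mult_embed_block:
  fixes As :: "'a::field mat list"
  assumes "conform As As" "i < length As" "v \<in> carrier_vec (dim_row (As ! i))"
  shows "embed_block (map dim_row As) i v \<lhd>\<^sub>m diag_block_mat As = embed_block (map dim_row As) i (v \<lhd>\<^sub>m As ! i)"
  using assms
proof (induction As arbitrary: i)
  case (Cons A As)
  have c: "conform As As" using Cons.prems(1) unfolding conform_def by simp
  obtain m where m: "A \<in> carrier_mat m m" using Cons.prems(1) unfolding conform_def by auto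
  have dm: "dim_row A = m" using m by simp
  note D = diag_block_mat_carrier[OF c]
  have z: "0\<^sub>v m \<lhd>\<^sub>m A = 0\<^sub>v m" "0\<^sub>v (sum_list (map dim_row As)) \<lhd>\<^sub>m diag_block_mat As = 0\<^sub>v (sum_list (map dim_row As))"
    unfolding row_mult_def using m D by (auto intro!: eq_vecI)
  show ?case
  proof (cases i)
    case 0
    then have v: "v \<in> carrier_vec m" using Cons.prems m by simp
    show ?thesis
      unfolding 0 list.map diag_block_mat_Cons dm nth_Cons_0
        embed_block_Cons(1)[OF v] embed_block_Cons(1)[OF row_mult_carrier[OF m]]
      by (simp add: row_mult_block_sum[OF m D v] z)
  next
    case (Suc i')
    have "embed_block (map dim_row As) i' v \<lhd>\<^sub>m diag_block_mat As = embed_block (map dim_row As) i' (v \<lhd>\<^sub>m As ! i')"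
      by (rule Cons.IH[OF c]) (use Cons.prems Suc in auto)
    then show ?thesis
      unfolding Suc list.map diag_block_mat_Cons dm nth_Cons_Suc embed_block_Cons(2)
      by (simp add: row_mult_block_sum[OF m D _ embed_block_carrier] z)
  qed
qed simp

lemma irreducible_root:
  fixes g :: "'a::field poly"
  assumes "irreducible g" "poly g c = 0"
  obtains a where "g = [:a:] * [:- c, 1:]"
proof -
  obtain h where h: "g = [:- c, 1:] * h" using assms(2) unfolding poly_eq_0_iff_dvd by blast
  have "\<not> is_unit [:- c, 1:]" by (simp add: is_unit_iff_degree)
  then have "is_unit h" using assms(1) h irreducibleD by blast
  then obtain a where "h = [:a:]" using is_unit_polyE by blast
  then show thesis using that h by (simp add: mult.commute)
qed

text \<open>An irreducible polynomial with root 1 is t + 1 up to a scalar. In \<open>Phi3\<close>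
  the degree excludes this. In \<open>Phi2\<close> the value of \<open>poly_star g\<close> at 1 is
  g(1) / g(0), so a root at 1 makes g = t + 1, which equals its own
  \<open>poly_star\<close>.\<close>

lemma (in even_field) poly_Phi_one:
  assumes "(f :: 'a poly) \<in> Phi2 \<union> Phi3"
  shows "poly f 1 \<noteq> 0"
proof
  assume 0: "poly f 1 = 0"
  have one: "- 1 = (1 :: 'a)" using char_two[of 1] by (simp add: eq_neg_iff_add_eq_0 flip: minus_equation_iff)
  consider "f \<in> Phi2" | "f \<in> Phi3" using assms by blast
  then show False
  proof cases
    case 1
    then obtain g where g: "f = g * poly_star g" "lead_coeff g = 1" "irreducible g" "poly g 0 \<noteq> 0" "g \<noteq> poly_star g"
      unfolding Phi2_def by blast
    have "poly (poly_star g) 1 = inverse (poly g 0) * poly g 1"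
      unfolding poly_star_def by (simp add: poly_reflect_poly_nz)
    then have "poly g 1 = 0" using 0 g(1,4) by auto
    then obtain a where a: "g = [:a:] * [:- 1, 1:]" using irreducible_root[OF g(3)] by blast
    then have "a = 1" using g(2) by (cases "a = 0") auto
    then have "g = [:1, 1:]" using a one by simp
    moreover have "poly_star [:1, 1:] = ([:1, 1:] :: 'a poly)"
      unfolding poly_star_def by (simp add: reflect_poly_def)
    ultimately show False using g(5) by simp
  next
    case 2
    then have "irreducible f" "degree f > 1" unfolding Phi3_def by auto
    moreover obtain a where "f = [:a:] * [:- 1, 1:]" using irreducible_root[OF \<open>irreducible f\<close> 0] by blast
    then have "degree f \<le> 1" by simp
    ultimately show False by simp
  qed
qed

section \<open>The blocks of an adapted pair\<close>

context
  fixes n :: nat and r :: "'a::field blocks"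
  assumes ad: "adapted n r"
begin

lemma adapted_blocks:
  assumes "i < length r"
  shows "r ! i = (eldivs r ! i, S_blocks r ! i, B_blocks r ! i)"
    "\<exists>m. S_blocks r ! i \<in> carrier_mat m m \<and> B_blocks r ! i \<in> carrier_mat m m"
proof -
  show e: "r ! i = (eldivs r ! i, S_blocks r ! i, B_blocks r ! i)"
    using assms unfolding eldivs_def S_blocks_def B_blocks_def by simp
  have "r ! i \<in> set r" using assms by simp
  moreover have "\<forall>(f, S, B)\<in>set r. \<exists>m. S \<in> carrier_mat m m \<and> B \<in> carrier_mat m m"
    using ad unfolding adapted_def by (rule conjunct1)
  ultimately have "case r ! i of (f, S, B) \<Rightarrow> \<exists>m. S \<in> carrier_mat m m \<and> B \<in> carrier_mat m m" by (rule bspec[rotated])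
  then show "\<exists>m. S_blocks r ! i \<in> carrier_mat m m \<and> B_blocks r ! i \<in> carrier_mat m m"
    unfolding e by (simp only: prod.case)
qed

lemma blocks_length: "length (eldivs r) = length r" "length (S_blocks r) = length r" "length (B_blocks r) = length r"
  unfolding eldivs_def S_blocks_def B_blocks_def by auto

lemma adapted_conform: "conform (S_blocks r) (B_blocks r)" "conform (S_blocks r) (S_blocks r)" "conform (B_blocks r) (B_blocks r)"
  unfolding conform_def list_all2_conv_all_nth blocks_length using adapted_blocks(2) by auto

lemma adapted_dims: "sum_list (map dim_row (S_blocks r)) = n" "S_mat r \<in> carrier_mat n n" "B_mat r \<in> carrier_mat n n"
proof -
  show S: "S_mat r \<in> carrier_mat n n" using ad unfolding adapted_def by blast
  then show "sum_list (map dim_row (S_blocks r)) = n" unfolding dim_diag_block_mat(1)[symmetric] by simp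
  show "B_mat r \<in> carrier_mat n n" using conform_diag[OF adapted_conform(1)] S by auto
qed

text \<open>Both directions are used: the basis vectors of a block lie in the kernel, and kernel
  vectors have their support in the block.\<close>

lemma adapted_kernel:
  assumes "i < length r" "v \<in> carrier_vec n"
  shows "v \<lhd>\<^sub>m mat_poly (eldivs r ! i) (S_mat r) = 0\<^sub>v n \<longleftrightarrow>
    (\<forall>j<n. \<not> in_block (map dim_row (S_blocks r)) i j \<longrightarrow> v $ j = 0)"
proof -
  have "{v \<in> carrier_vec n. v \<lhd>\<^sub>m mat_poly (eldivs r ! i) (S_mat r) = 0\<^sub>v n} = block_space r i"
    using ad assms(1) unfolding adapted_def by blast
  then have "v \<lhd>\<^sub>m mat_poly (eldivs r ! i) (S_mat r) = 0\<^sub>v n \<longleftrightarrow> v \<in> block_space r i" using assms(2) by blast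
  also have "\<dots> \<longleftrightarrow> (\<forall>j<n. \<not> in_block (map dim_row (S_blocks r)) i j \<longrightarrow> v $ j = 0)"
    unfolding block_space_def in_block_def using adapted_dims(2) assms(2) by (auto simp: take_map)
  finally show ?thesis .
qed

lemma embed_block_kernel:
  assumes "i < length r"
  shows "embed_block (map dim_row (S_blocks r)) i v \<lhd>\<^sub>m mat_poly (eldivs r ! i) (S_mat r) = 0\<^sub>v n"
  using adapted_kernel[OF assms, of "embed_block (map dim_row (S_blocks r)) i v"]
    embed_block_carrier[of "map dim_row (S_blocks r)" i v] adapted_dims(1)
  unfolding embed_block_def by simp

text \<open>A basis vector of block i lies in the kernel of f_i(S). \<open>Y\<close> commutes with
  \<open>S\<close> and so preserves this kernel, which forces the corresponding row of
  \<open>Y\<close> to be supported in block i.\<close>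

lemma centralizer_block_diagonal:
  assumes Y: "Y \<in> carrier_mat n n" and comm: "Y * S_mat r = S_mat r * Y"
  shows "\<exists>Us. conform Us (S_blocks r) \<and> Y = diag_block_mat Us"
proof -
  let ?ms = "map dim_row (S_blocks r)"
  have "\<exists>Us. list_all2 (\<lambda>U m. U \<in> carrier_mat m m) Us ?ms \<and> Y = diag_block_mat Us"
  proof (rule block_diagonal_decomposition; unfold adapted_dims(1))
    fix i a b assume *: "i < length ?ms" "in_block ?ms i a" "a < n" "b < n" "\<not> in_block ?ms i b"
    have i: "i < length r" using * blocks_length by simp
    have "\<forall>j<n. \<not> in_block ?ms i j \<longrightarrow> (unit_vec n a :: 'a vec) $ j = 0" using * by auto
    then have "unit_vec n a \<lhd>\<^sub>m mat_poly (eldivs r ! i) (S_mat r) = 0\<^sub>v n"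
      using adapted_kernel[OF i unit_vec_carrier] by blast
    then have "(unit_vec n a \<lhd>\<^sub>m Y) \<lhd>\<^sub>m mat_poly (eldivs r ! i) (S_mat r) = 0\<^sub>v n \<lhd>\<^sub>m Y"
      using mat_poly_commute[OF adapted_dims(2) unit_vec_carrier Y comm] by simp
    also have "\<dots> = 0\<^sub>v n" unfolding row_mult_def using Y by (intro eq_vecI) auto
    finally have "(unit_vec n a \<lhd>\<^sub>m Y) $ b = 0"
      using adapted_kernel[OF i row_mult_carrier[OF Y]] * by blast
    then show "Y $$ (a, b) = 0" unfolding row_mult_unit[OF Y *(3)] using Y * by simp
  qed (rule Y)
  then obtain Us where Us: "list_all2 (\<lambda>U m. U \<in> carrier_mat m m) Us ?ms" "Y = diag_block_mat Us" by blast
  have "conform Us (S_blocks r)"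
    unfolding conform_def list_all2_conv_all_nth
  proof (intro conjI allI impI)
    show l: "length Us = length (S_blocks r)" using Us(1) list_all2_lengthD by fastforce
    fix i assume i: "i < length Us"
    then have "Us ! i \<in> carrier_mat (dim_row (S_blocks r ! i)) (dim_row (S_blocks r ! i))"
      using list_all2_nthD[OF Us(1) i] l by simp
    moreover have "S_blocks r ! i \<in> carrier_mat (dim_row (S_blocks r ! i)) (dim_row (S_blocks r ! i))"
      using adapted_blocks(2)[of i] i l blocks_length by auto
    ultimately show "\<exists>m. Us ! i \<in> carrier_mat m m \<and> S_blocks r ! i \<in> carrier_mat m m" by blast
  qed
  then show ?thesis using Us(2) by blast
qed

lemma row_mult_S_embed:
  assumes "i < length r" "S_blocks r ! i \<in> carrier_mat m m" "v \<in> carrier_vec m"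
  shows "embed_block (map dim_row (S_blocks r)) i v \<lhd>\<^sub>m S_mat r
    = embed_block (map dim_row (S_blocks r)) i (v \<lhd>\<^sub>m S_blocks r ! i)"
  by (rule row_mult_embed_block[OF adapted_conform(2)]) (use assms blocks_length in auto)

lemma embed_zero: "embed_block ms i (0\<^sub>v m) = (0\<^sub>v (sum_list ms) :: 'a vec)"
  if "i < length ms" "ms ! i = m" for ms m i
  using that
proof (induction ms arbitrary: i)
  case (Cons k ms)
  then show ?case
    by (cases i) (auto simp: embed_block_Cons append_zero_eq_zero)
qed simp

text \<open>Embedded in the whole space, a fixed vector of the block is killed by f_i(S), while
  f_i(S) multiplies it by the non-zero scalar f_i(1).\<close>

lemma block_fixed_vecs:
  assumes i: "i < length r" and S: "S_blocks r ! i \<in> carrier_mat m m" and f: "poly (eldivs r ! i) 1 \<noteq> 0"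
  shows "fixed_vecs (S_blocks r ! i) = {0\<^sub>v m}"
proof
  let ?ms = "map dim_row (S_blocks r)"
  have msi: "i < length ?ms" "?ms ! i = m" using i S blocks_length by auto
  show "fixed_vecs (S_blocks r ! i) \<subseteq> {0\<^sub>v m}"
  proof
    fix v assume "v \<in> fixed_vecs (S_blocks r ! i)"
    then have v: "v \<in> carrier_vec m" "v \<lhd>\<^sub>m S_blocks r ! i = v" unfolding fixed_vecs_def using S by auto
    let ?e = "embed_block ?ms i v"
    have e: "?e \<in> carrier_vec n" using embed_block_carrier[of ?ms i v] adapted_dims(1) by simp
    have fe: "?e \<lhd>\<^sub>m S_mat r = ?e" using row_mult_S_embed[OF i S v(1)] v(2) by simp
    have "poly (eldivs r ! i) 1 \<cdot>\<^sub>v ?e = 0\<^sub>v n"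
      unfolding row_mult_mat_poly_fixed[OF adapted_dims(2) e fe, symmetric] by (rule embed_block_kernel[OF i])
    then have "?e = 0\<^sub>v n" using f e by (auto simp: vec_eq_iff)
    then have "?e = embed_block ?ms i (0\<^sub>v m)" using embed_zero[OF msi] adapted_dims(1) by simp
    then have "v = 0\<^sub>v m" using embed_block_inj[OF msi(1), of v "0\<^sub>v m"] v(1) msi(2) by simp
    then show "v \<in> {0\<^sub>v m}" by simp
  qed
  show "{0\<^sub>v m} \<subseteq> fixed_vecs (S_blocks r ! i)"
    unfolding fixed_vecs_def row_mult_def using S by (auto intro!: eq_vecI)
qed

text \<open>A reflection needs a block of positive dimension, and minimality of the minimal
  polynomial provides it: with trivial kernel the factor t + 1 could be cancelled.\<close>

lemma Phi1_block_nonempty: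
  assumes i: "i < length r" and S: "S_blocks r ! i \<in> carrier_mat m m" and f: "eldivs r ! i = [:1, 1:]"
  shows "0 < m"
proof (rule ccontr)
  assume "\<not> 0 < m"
  then have m: "m = 0" by simp
  let ?ms = "map dim_row (S_blocks r)"
  have msi: "i < length ?ms" "?ms ! i = 0" using i S m blocks_length by auto
  have nb: "\<not> in_block ?ms i j" for j
    unfolding in_block_def using msi by (simp add: take_Suc_conv_app_nth del: nth_map)
  have ker: "v = 0\<^sub>v n" if v: "v \<in> carrier_vec n" and k: "v \<lhd>\<^sub>m mat_poly [:1, 1:] (S_mat r) = 0\<^sub>v n" for v
  proof -
    have "\<forall>j<n. v $ j = 0" using adapted_kernel[OF i v] k nb unfolding f by blast
    then show ?thesis using v by (intro eq_vecI) auto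
  qed
  \<comment> \<open>The product of the other divisors; distinctness ensures that t + 1 is removed
    exactly once.\<close>
  let ?g = "\<Prod>(set (eldivs r) - {[:1, 1:]})"
  have d: "distinct (eldivs r)" and mp: "is_min_poly (S_mat r) (prod_list (eldivs r))" using ad unfolding adapted_def by auto
  have "[:1, 1:] \<in> set (eldivs r)" using f i blocks_length by (metis nth_mem)
  then have pg: "prod_list (eldivs r) = [:1, 1:] * ?g"
    using prod.remove[of "set (eldivs r)" "[:1, 1:]" "\<lambda>x. x"] prod.distinct_set_conv_list[OF d, of "\<lambda>x. x"] by simp
  have lc: "lead_coeff (prod_list (eldivs r)) = 1" and z: "mat_poly (prod_list (eldivs r)) (S_mat r) = 0\<^sub>m n n"
    and min: "\<And>g. g \<noteq> 0 \<Longrightarrow> mat_poly g (S_mat r) = 0\<^sub>m n n \<Longrightarrow> degree (prod_list (eldivs r)) \<le> degree g"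
    using mp adapted_dims(2) unfolding is_min_poly_def by auto
  have g0: "?g \<noteq> 0" using lc pg by (metis leading_coeff_0_iff mult_zero_right zero_neq_one)
  \<comment> \<open>Applying S + 1 after g(S) gives the full product, which is zero. So every vector
    v g(S) lies in the kernel of S + 1, which is trivial here.\<close>
  have "mat_poly ?g (S_mat r) = 0\<^sub>m n n"
  proof (rule mat_eq_row_multI[OF mat_poly_carrier[OF adapted_dims(2)]])
    fix v :: "'a vec" assume v: "v \<in> carrier_vec n"
    let ?w = "v \<lhd>\<^sub>m mat_poly ?g (S_mat r)"
    have w: "?w \<in> carrier_vec n" by (rule row_mult_carrier[OF mat_poly_carrier[OF adapted_dims(2)]])
    have z': "v \<lhd>\<^sub>m 0\<^sub>m n n = 0\<^sub>v n" unfolding row_mult_def using v by (intro eq_vecI) auto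
    have "?w \<lhd>\<^sub>m mat_poly [:1, 1:] (S_mat r) = v \<lhd>\<^sub>m mat_poly ([:1, 1:] * ?g) (S_mat r)"
      unfolding row_mult_mat_poly_linear_factor[OF adapted_dims(2) w] row_mult_mat_poly_linear[OF adapted_dims(2) v] ..
    also have "\<dots> = 0\<^sub>v n" using z z' unfolding pg by simp
    finally have "?w = 0\<^sub>v n" using ker[OF w] by blast
    then show "?w = v \<lhd>\<^sub>m 0\<^sub>m n n" using z' by simp
  qed simp
  then have "degree (prod_list (eldivs r)) \<le> degree ?g" by (rule min[OF g0])
  moreover have "degree (prod_list (eldivs r)) = Suc (degree ?g)"
    unfolding pg using g0 by (subst degree_mult_eq) auto
  ultimately show False by simp
qed

end

text \<open>On the kernel of S + 1 one has v + v S = 0, that is v S = v in characteristic two. Hence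
  every isometry of this block commutes with \<open>S\<close>.\<close>

lemma (in even_field) Phi1_block_one:
  assumes ad: "adapted n (r :: 'a blocks)" and i: "i < length r" and S: "S_blocks r ! i \<in> carrier_mat m m"
    and f: "eldivs r ! i = [:1, 1:]"
  shows "S_blocks r ! i = 1\<^sub>m m"
proof (rule mat_eq_row_multI[OF S one_carrier_mat])
  fix v :: "'a vec" assume v: "v \<in> carrier_vec m"
  let ?ms = "map dim_row (S_blocks r)"
  have msi: "i < length ?ms" "?ms ! i = m" using i S blocks_length[OF ad] by auto
  note d = adapted_dims[OF ad]
  have e: "embed_block ?ms i u \<in> carrier_vec n" for u :: "'a vec"
    using embed_block_carrier[of ?ms i u] d(1) by simp
  have "embed_block ?ms i v + embed_block ?ms i (v \<lhd>\<^sub>m S_blocks r ! i) = 0\<^sub>v n"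
    using row_mult_mat_poly_linear_factor[OF d(2) e[of v]] embed_block_kernel[OF ad i, of v]
    unfolding f row_mult_S_embed[OF ad i S v] by (rule trans[OF sym])
  then have "embed_block ?ms i v = embed_block ?ms i (v \<lhd>\<^sub>m S_blocks r ! i)"
    using vec_add_eq_0_iff[OF e e] by blast
  then have "v = v \<lhd>\<^sub>m S_blocks r ! i" using embed_block_inj[OF msi(1), of v "v \<lhd>\<^sub>m S_blocks r ! i"] v S msi(2) by simp
  then show "v \<lhd>\<^sub>m S_blocks r ! i = v \<lhd>\<^sub>m 1\<^sub>m m" using v by simp
qed

section \<open>The centralizer as a direct product\<close>

text \<open>Blocks indexed by a function match the elements of \<open>product_group\<close>, for
  which this map is to be the isomorphism; values outside the index range are irrelevant.\<close>

definition diag_of :: "nat \<Rightarrow> (nat \<Rightarrow> 'a::zero mat) \<Rightarrow> 'a mat" where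
  "diag_of h x = diag_block_mat (map x [0..<h])"

lemma diag_of_restrict: "diag_of h (restrict x {..<h}) = diag_of h x"
  unfolding diag_of_def by (intro arg_cong[of _ _ diag_block_mat] map_cong) auto

lemma diag_of_nth: "diag_of (length As) (\<lambda>i. As ! i) = diag_block_mat As"
  unfolding diag_of_def by (simp add: map_nth)

context even_field
begin

context
  fixes n :: nat and r :: "'a blocks"
  assumes ad: "adapted n r" and ns: "nonsingular (B_mat r)"
    and ss: "S_mat r \<in> semisimple_elems (isometry_group (B_mat r))"
begin

abbreviation (input) "BB \<equiv> \<lambda>i. B_blocks r ! i"
abbreviation (input) "SS \<equiv> \<lambda>i. S_blocks r ! i"
abbreviation (input) "h \<equiv> length r"

lemma block_dims:
  assumes "i < h"
  obtains m where "SS i \<in> carrier_mat m m" "BB i \<in> carrier_mat m m"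
  using adapted_blocks(2)[OF ad assms] by blast

lemma block_nonsingular: "i < h \<Longrightarrow> nonsingular (BB i)"
  using nonsingular_diag_block_mat[OF adapted_conform(3)[OF ad] ns] blocks_length[OF ad] by simp

lemma block_conform:
  assumes "\<And>i. i < h \<Longrightarrow> x i \<in> carrier (isometry_group (BB i))"
  shows "conform (map x [0..<h]) (B_blocks r)"
  unfolding conform_def list_all2_conv_all_nth
proof (intro conjI allI impI)
  fix i assume "i < length (map x [0..<h])"
  then have i: "i < h" by simp
  obtain m where "BB i \<in> carrier_mat m m" using block_dims[OF i] .
  then show "\<exists>m. map x [0..<h] ! i \<in> carrier_mat m m \<and> BB i \<in> carrier_mat m m"
    using isometry_carrier_mat assms[OF i] i by auto
qed (use blocks_length[OF ad] in simp)

lemma diag_of_isometry: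
  assumes "\<And>i. i < h \<Longrightarrow> x i \<in> carrier (isometry_group (BB i))"
  shows "diag_of h x \<in> carrier (isometry_group (B_mat r))"
proof -
  have "conform (map x [0..<h]) (B_blocks r)" by (rule block_conform) (rule assms)
  moreover have "list_all2 (\<lambda>U B. U \<in> carrier (isometry_group B)) (map x [0..<h]) (B_blocks r)"
    using assms blocks_length[OF ad] by (simp add: list_all2_conv_all_nth)
  ultimately show ?thesis unfolding diag_of_def using isometry_diag_block_mat by blast
qed

lemma diag_of_mult:
  assumes x: "\<And>i. i < h \<Longrightarrow> x i \<in> carrier (isometry_group (BB i))"
    and y: "\<And>i. i < h \<Longrightarrow> y i \<in> carrier (isometry_group (BB i))"
  shows "diag_of h x * diag_of h y = diag_of h (\<lambda>i. x i * y i)"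
proof -
  have "conform (map x [0..<h]) (map y [0..<h])"
    using conform_trans[OF block_conform[OF x] conform_sym[OF block_conform[OF y]]] by simp
  then have "diag_of h x * diag_of h y = diag_block_mat (map2 (*) (map x [0..<h]) (map y [0..<h]))"
    unfolding diag_of_def by (rule diag_block_mat_mult)
  also have "map2 (*) (map x [0..<h]) (map y [0..<h]) = map (\<lambda>i. x i * y i) [0..<h]"
    by (rule nth_equalityI) auto
  finally show ?thesis unfolding diag_of_def .
qed

lemma diag_of_inj:
  assumes x: "\<And>i. i < h \<Longrightarrow> x i \<in> carrier (isometry_group (BB i))"
    and y: "\<And>i. i < h \<Longrightarrow> y i \<in> carrier (isometry_group (BB i))"
    and eq: "diag_of h x = diag_of h y" and i: "i < h"
  shows "x i = y i"
proof -
  have "conform (map x [0..<h]) (map y [0..<h])"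
    using conform_trans[OF block_conform[OF x] conform_sym[OF block_conform[OF y]]] by simp
  then have "map x [0..<h] = map y [0..<h]" using eq unfolding diag_of_def by (rule diag_block_mat_inj)
  then have "map x [0..<h] ! i = map y [0..<h] ! i" by (rule arg_cong)
  then show ?thesis using i by simp
qed

lemma spinor_norm_diag_of:
  assumes x: "\<And>i. i < h \<Longrightarrow> x i \<in> carrier (isometry_group (BB i))"
  shows "spinor_norm (diag_of h x) = (\<Sum>i<h. spinor_norm (x i)) mod 2"
proof -
  have "conform (map x [0..<h]) (map x [0..<h])"
    using conform_trans[OF block_conform[OF x] conform_sym[OF block_conform[OF x]]] by simp
  then show ?thesis
    unfolding diag_of_def using spinor_norm_diag_block_mat by (simp add: o_def interv_sum_list_conv_sum_set_nat atLeast0LessThan)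
qed

lemma S_diag_of: "S_mat r = diag_of h SS"
  using diag_of_nth[of "S_blocks r"] blocks_length[OF ad] by simp

lemma S_isometry: "S_mat r \<in> carrier (isometry_group (B_mat r))"
  using ss unfolding semisimple_elems_def by blast

lemma S_block_isometry: "i < h \<Longrightarrow> SS i \<in> carrier (isometry_group (BB i))"
  using S_isometry blocks_length[OF ad]
  unfolding isometry_diag_block_mat[OF adapted_conform(1)[OF ad]] list_all2_conv_all_nth by simp

lemma group_block_isometry: "i < h \<Longrightarrow> group (isometry_group (BB i))"
  using block_dims group_isometry_group by metis

text \<open>Powers of a block diagonal matrix are formed blockwise, so the odd exponent that
  trivializes \<open>S\<close> trivializes each block.\<close>

lemma S_block_semisimple:
  assumes i: "i < h"
  shows "SS i \<in> semisimple_elems (isometry_group (BB i))"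
proof -
  interpret I: group "isometry_group (B_mat r)" by (rule group_isometry_group[OF adapted_dims(3)[OF ad]])
  interpret Ii: group "isometry_group (BB i)" by (rule group_block_isometry[OF i])
  obtain m :: nat where m: "odd m" "S_mat r [^]\<^bsub>isometry_group (B_mat r)\<^esub> m = \<one>\<^bsub>isometry_group (B_mat r)\<^esub>"
    using ss I.semisimple_iff by blast
  have pw: "SS j [^]\<^bsub>isometry_group (BB j)\<^esub> k \<in> carrier (isometry_group (BB j))" if "j < h" for j and k :: nat
    using monoid.nat_pow_closed[OF group.is_monoid[OF group_block_isometry[OF that]] S_block_isometry[OF that]] .
  have one: "\<one>\<^bsub>isometry_group (BB j)\<^esub> \<in> carrier (isometry_group (BB j))" if "j < h" for j
    using monoid.one_closed[OF group.is_monoid[OF group_block_isometry[OF that]]] .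
  have mult: "x \<otimes>\<^bsub>isometry_group (BB j)\<^esub> y = x * y" if "j < h" for x y j
    using block_dims[OF that] isometry_group_simps(2) by metis
  \<comment> \<open>The block sum of the identities is idempotent, and in a group only the identity
    is.\<close>
  have D1: "diag_of h (\<lambda>j. \<one>\<^bsub>isometry_group (BB j)\<^esub>) = \<one>\<^bsub>isometry_group (B_mat r)\<^esub>"
  proof -
    let ?E = "diag_of h (\<lambda>j. \<one>\<^bsub>isometry_group (BB j)\<^esub>)"
    have E: "?E \<in> carrier (isometry_group (B_mat r))" by (rule diag_of_isometry) (rule one)
    have "?E * ?E = diag_of h (\<lambda>j. \<one>\<^bsub>isometry_group (BB j)\<^esub> * \<one>\<^bsub>isometry_group (BB j)\<^esub>)"
      by (rule diag_of_mult) (rule one, assumption)+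
    also have "\<dots> = ?E"
    proof -
      have "\<one>\<^bsub>isometry_group (BB j)\<^esub> * \<one>\<^bsub>isometry_group (BB j)\<^esub> = \<one>\<^bsub>isometry_group (BB j)\<^esub>" if "j < h" for j
        using mult[OF that] monoid.l_one[OF group.is_monoid[OF group_block_isometry[OF that]] one[OF that]] by simp
      then show ?thesis unfolding diag_of_def by (intro arg_cong[of _ _ diag_block_mat] map_cong) auto
    qed
    finally have "?E \<otimes>\<^bsub>isometry_group (B_mat r)\<^esub> ?E = ?E" unfolding isometry_group_simps(2)[OF adapted_dims(3)[OF ad]] .
    then show ?thesis using E I.l_cancel_one by blast
  qed
  have "S_mat r [^]\<^bsub>isometry_group (B_mat r)\<^esub> k = diag_of h (\<lambda>j. SS j [^]\<^bsub>isometry_group (BB j)\<^esub> k)" for k :: nat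
  proof (induction k)
    case 0
    then show ?case using D1 by simp
  next
    case (Suc k)
    have "S_mat r [^]\<^bsub>isometry_group (B_mat r)\<^esub> Suc k = diag_of h (\<lambda>j. SS j [^]\<^bsub>isometry_group (BB j)\<^esub> k) * diag_of h SS"
      using Suc S_diag_of isometry_group_simps(2)[OF adapted_dims(3)[OF ad]] by simp
    also have "\<dots> = diag_of h (\<lambda>j. SS j [^]\<^bsub>isometry_group (BB j)\<^esub> k * SS j)"
      by (rule diag_of_mult) (use pw S_block_isometry in auto)
    also have "\<dots> = diag_of h (\<lambda>j. SS j [^]\<^bsub>isometry_group (BB j)\<^esub> Suc k)"
      unfolding diag_of_def by (intro arg_cong[of _ _ diag_block_mat] map_cong) (use mult in auto)
    finally show ?case .
  qed
  then have "diag_of h (\<lambda>j. SS j [^]\<^bsub>isometry_group (BB j)\<^esub> m) = diag_of h (\<lambda>j. \<one>\<^bsub>isometry_group (BB j)\<^esub>)"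
    using m(2) D1 by simp
  then have "SS i [^]\<^bsub>isometry_group (BB i)\<^esub> m = \<one>\<^bsub>isometry_group (BB i)\<^esub>"
    using diag_of_inj[of "\<lambda>j. SS j [^]\<^bsub>isometry_group (BB j)\<^esub> m" "\<lambda>j. \<one>\<^bsub>isometry_group (BB j)\<^esub>", OF pw one _ i] by simp
  then show ?thesis using Ii.semisimple_iff S_block_isometry[OF i] m(1) by blast
qed

lemma Phi1_iff: "f \<in> Phi1 \<longleftrightarrow> f = [:1, 1:]"
  unfolding Phi1_def by simp

lemma eldivs_Phi:
  assumes "i < h" "eldivs r ! i \<notin> Phi1"
  shows "eldivs r ! i \<in> Phi2 \<union> Phi3"
proof -
  have "set (eldivs r) \<subseteq> Phi" using ad unfolding adapted_def by blast
  moreover have "eldivs r ! i \<in> set (eldivs r)" using assms(1) blocks_length[OF ad] by simp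
  ultimately show ?thesis using assms(2) unfolding Phi_def by blast
qed

lemma commuting_block_spinor_norm:
  assumes i: "i < h" and f: "eldivs r ! i \<notin> Phi1" and Y: "Y \<in> carrier (isometry_group (BB i))" and comm: "Y * SS i = SS i * Y"
  shows "spinor_norm Y = 0"
proof -
  obtain m where m: "SS i \<in> carrier_mat m m" "BB i \<in> carrier_mat m m" using block_dims[OF i] .
  have "fixed_vecs (SS i) = {0\<^sub>v m}"
    by (rule block_fixed_vecs[OF ad i m(1)]) (rule poly_Phi_one[OF eldivs_Phi[OF i f]])
  then show ?thesis
    by (rule spinor_norm_commuting[OF m(2) block_nonsingular[OF i] S_block_semisimple[OF i] _ Y comm])
qed

text \<open>Once \<open>Y\<close> is block diagonal, comparing the blocks of Y S and S Y turns
  commutation with \<open>S\<close> into commutation on each block.\<close>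

lemma centralizer_decomposition:
  assumes Y: "Y \<in> carrier (isometry_group (B_mat r))" and comm: "Y * S_mat r = S_mat r * Y"
  obtains x where "\<And>i. i < h \<Longrightarrow> x i \<in> carrier (isometry_group (BB i)) \<and> x i * SS i = SS i * x i" "Y = diag_of h x"
proof -
  obtain Us where Us: "conform Us (S_blocks r)" "Y = diag_block_mat Us"
    using centralizer_block_diagonal[OF ad isometry_carrier_mat[OF adapted_dims(3)[OF ad] Y] comm] by blast
  have l: "length Us = h" using Us(1) blocks_length[OF ad] unfolding conform_def by (simp add: list_all2_lengthD)
  note cB = conform_trans[OF Us(1) adapted_conform(1)[OF ad]]
  have iso: "Us ! i \<in> carrier (isometry_group (BB i))" if "i < h" for i
    using Y that l unfolding Us(2) isometry_diag_block_mat[OF cB] list_all2_conv_all_nth by simp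
  have YD: "Y = diag_of h (\<lambda>i. Us ! i)" unfolding Us(2) using diag_of_nth[of Us] l by simp
  have "diag_of h (\<lambda>i. Us ! i * SS i) = diag_of h (\<lambda>i. SS i * Us ! i)"
    using comm diag_of_mult[of "\<lambda>i. Us ! i" SS, OF iso S_block_isometry] diag_of_mult[of SS "\<lambda>i. Us ! i", OF S_block_isometry iso]
    unfolding YD S_diag_of by simp
  moreover have prod_in: "Us ! i * SS i \<in> carrier (isometry_group (BB i))" "SS i * Us ! i \<in> carrier (isometry_group (BB i))" if i: "i < h" for i
  proof -
    interpret group "isometry_group (BB i)" by (rule group_block_isometry[OF i])
    obtain m where m: "BB i \<in> carrier_mat m m" using block_dims[OF i] .
    show "Us ! i * SS i \<in> carrier (isometry_group (BB i))" "SS i * Us ! i \<in> carrier (isometry_group (BB i))"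
      using m_closed[OF iso[OF i] S_block_isometry[OF i]] m_closed[OF S_block_isometry[OF i] iso[OF i]]
      unfolding isometry_group_simps(2)[OF m] by auto
  qed
  ultimately have "Us ! i * SS i = SS i * Us ! i" if "i < h" for i
    using diag_of_inj[of "\<lambda>i. Us ! i * SS i" "\<lambda>i. SS i * Us ! i"] that by blast
  then show thesis using that iso YD by blast
qed

text \<open>The case distinction in \<open>block_group\<close> disappears: for a divisor other than
  t + 1 everything commuting with the block of \<open>S\<close> already has spinor norm
  zero.\<close>

lemma block_group_eq:
  assumes i: "i < h"
  shows "block_group (r ! i) = centralizer (Omega (BB i)) (SS i)"
proof -
  have "carrier (centralizer (isometry_group (BB i)) (SS i)) = carrier (centralizer (Omega (BB i)) (SS i))"
    if f: "eldivs r ! i \<notin> Phi1"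
  proof -
    obtain m where m: "BB i \<in> carrier_mat m m" using block_dims[OF i] .
    have "x \<otimes>\<^bsub>Omega (BB i)\<^esub> y = x * y" for x y
      unfolding Omega_def using isometry_group_simps(2)[OF m] by simp
    then show ?thesis
      unfolding centralizer_simps isometry_group_simps(2)[OF m] Omega_simps(1)
      using commuting_block_spinor_norm[OF i f] by auto
  qed
  then have "centralizer (isometry_group (BB i)) (SS i) = centralizer (Omega (BB i)) (SS i)" if "eldivs r ! i \<notin> Phi1"
    using that unfolding centralizer_def Omega_def by simp
  then show ?thesis using adapted_blocks(1)[OF ad i] by simp
qed

lemma block_group_carrier:
  assumes i: "i < h"
  shows "carrier (block_group (r ! i)) = {X \<in> carrier (isometry_group (BB i)). spinor_norm X = 0 \<and> X * SS i = SS i * X}"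
    "X \<otimes>\<^bsub>block_group (r ! i)\<^esub> Y = X * Y" "group (block_group (r ! i))"
proof -
  obtain m where m: "BB i \<in> carrier_mat m m" using block_dims[OF i] .
  have O: "x \<otimes>\<^bsub>Omega (BB i)\<^esub> y = x * y" for x y
    unfolding Omega_def using isometry_group_simps(2)[OF m] by simp
  show "carrier (block_group (r ! i)) = {X \<in> carrier (isometry_group (BB i)). spinor_norm X = 0 \<and> X * SS i = SS i * X}"
    "X \<otimes>\<^bsub>block_group (r ! i)\<^esub> Y = X * Y"
    unfolding block_group_eq[OF i] centralizer_simps O Omega_simps(1) by auto
  have "SS i \<in> carrier (Omega (BB i))"
    unfolding Omega_simps(1) using S_block_isometry[OF i] spinor_norm_semisimple[OF m block_nonsingular[OF i] S_block_semisimple[OF i]] by simp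
  then show "group (block_group (r ! i))"
    unfolding block_group_eq[OF i] by (rule group.group_centralizer[OF group_Omega[OF m block_nonsingular[OF i]]])
qed

lemma Phi1_index_unique: "i < h \<Longrightarrow> j < h \<Longrightarrow> eldivs r ! i \<in> Phi1 \<Longrightarrow> eldivs r ! j \<in> Phi1 \<Longrightarrow> i = j"
  using ad blocks_length[OF ad] nth_eq_iff_index_eq[of "eldivs r" i j] unfolding adapted_def Phi1_iff by simp

text \<open>The product of the subgroups of norm zero could be smaller than the block diagonal
  elements of total norm zero, since non-zero norms might cancel. Here at most one block can have
  non-zero norm, so the two agree.\<close>

lemma centralizer_iso:
  "diag_of h \<in> iso (product_group {..<h} (\<lambda>i. block_group (r ! i))) (centralizer (Omega (B_mat r)) (S_mat r))"
proof -
  let ?P = "product_group {..<h} (\<lambda>i. block_group (r ! i))"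
  let ?C = "centralizer (Omega (B_mat r)) (S_mat r)"
  note Bd = adapted_dims(3)[OF ad]
  have O: "x \<otimes>\<^bsub>Omega (B_mat r)\<^esub> y = x * y" for x y
    unfolding Omega_def using isometry_group_simps(2)[OF Bd] by simp
  have Cc: "carrier ?C = {Y \<in> carrier (isometry_group (B_mat r)). spinor_norm Y = 0 \<and> Y * S_mat r = S_mat r * Y}"
    unfolding centralizer_simps O Omega_simps(1) by auto
  have Cm: "x \<otimes>\<^bsub>?C\<^esub> y = x * y" for x y unfolding centralizer_simps O ..
  have Pc: "x i \<in> carrier (isometry_group (BB i))" "spinor_norm (x i) = 0" "x i * SS i = SS i * x i"
    if "x \<in> carrier ?P" "i < h" for x i
    using that block_group_carrier(1)[OF that(2)] by (auto simp: PiE_iff simp del: block_group.simps)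
  have to: "diag_of h x \<in> carrier ?C" if x: "x \<in> carrier ?P" for x
  proof -
    have "spinor_norm (diag_of h x) = 0"
      using spinor_norm_diag_of[of x] Pc[OF x] by simp
    moreover have "diag_of h x * S_mat r = S_mat r * diag_of h x"
    proof -
      have "diag_of h (\<lambda>i. x i * SS i) = diag_of h (\<lambda>i. SS i * x i)"
        unfolding diag_of_def by (intro arg_cong[of _ _ diag_block_mat] map_cong) (use Pc(3)[OF x] in auto)
      then show ?thesis
        unfolding S_diag_of using diag_of_mult[of x SS, OF Pc(1)[OF x] S_block_isometry]
          diag_of_mult[of SS x, OF S_block_isometry Pc(1)[OF x]] by simp
    qed
    ultimately show ?thesis unfolding Cc using diag_of_isometry[of x] Pc(1)[OF x] by simp
  qed
  have onto: "Y \<in> diag_of h ` carrier ?P" if Y: "Y \<in> carrier ?C" for Y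
  proof -
    have YI: "Y \<in> carrier (isometry_group (B_mat r))" "spinor_norm Y = 0" "Y * S_mat r = S_mat r * Y" using Y unfolding Cc by auto
    obtain x where x: "\<And>i. i < h \<Longrightarrow> x i \<in> carrier (isometry_group (BB i)) \<and> x i * SS i = SS i * x i" "Y = diag_of h x"
      using centralizer_decomposition[OF YI(1,3)] by blast
    \<comment> \<open>If block i belongs to t + 1, no other block does, so the vanishing total is
      the norm of this block alone.\<close>
    have sp: "spinor_norm (x i) = 0" if i: "i < h" for i
    proof (cases "eldivs r ! i \<in> Phi1")
      case True
      have "spinor_norm (x j) = 0" if "j \<in> {..<h} - {i}" for j
        using that Phi1_index_unique[of i j] True i commuting_block_spinor_norm[of j "x j"] x(1)[of j] by auto
      then have "(\<Sum>j<h. spinor_norm (x j)) = spinor_norm (x i)"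
        using sum.remove[of "{..<h}" i "\<lambda>j. spinor_norm (x j)"] i by simp
      then have "spinor_norm (x i) mod 2 = 0" using YI(2) spinor_norm_diag_of[of x] x by simp
      then show ?thesis using spinor_norm_less_two[of "x i"] by simp
    qed (use commuting_block_spinor_norm[OF i] x(1)[OF i] in blast)
    have "restrict x {..<h} \<in> carrier ?P"
      using x(1) sp block_group_carrier(1) by (auto simp del: block_group.simps)
    moreover have "Y = diag_of h (restrict x {..<h})" unfolding diag_of_restrict by (rule x(2))
    ultimately show ?thesis by blast
  qed
  have "inj_on (diag_of h) (carrier ?P)"
  proof
    fix x y assume x: "x \<in> carrier ?P" and y: "y \<in> carrier ?P" and eq: "diag_of h x = diag_of h y"
    have "x i = y i" if "i < h" for i by (rule diag_of_inj[OF Pc(1)[OF x] Pc(1)[OF y] eq that])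
    then show "x = y"
      using x y by (intro PiE_ext[of x "{..<h}" "\<lambda>i. carrier (block_group (r ! i))" y]) (auto simp del: block_group.simps)
  qed
  moreover have "diag_of h ` carrier ?P = carrier ?C" using to onto by blast
  moreover have "diag_of h (x \<otimes>\<^bsub>?P\<^esub> y) = diag_of h x \<otimes>\<^bsub>?C\<^esub> diag_of h y" if x: "x \<in> carrier ?P" and y: "y \<in> carrier ?P" for x y
  proof -
    have "diag_of h (x \<otimes>\<^bsub>?P\<^esub> y) = diag_of h (\<lambda>i. x i * y i)"
      unfolding diag_of_def by (intro arg_cong[of _ _ diag_block_mat] map_cong) (use block_group_carrier(2) in \<open>auto simp del: block_group.simps\<close>)
    then show ?thesis unfolding Cm using diag_of_mult[OF Pc(1)[OF x] Pc(1)[OF y]] by simp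
  qed
  ultimately show ?thesis unfolding iso_def hom_def bij_betw_def using to by blast
qed

text \<open>In a direct product, unipotency and conjugacy are decided coordinatewise; this is why
  the unipotent blocks may be chosen independently.\<close>

lemma class_reps_centralizer:
  assumes W: "\<And>i. i < h \<Longrightarrow> class_reps (block_group (r ! i)) (unipotent_elems (block_group (r ! i))) (W i)"
  shows "class_reps (centralizer (Omega (B_mat r)) (S_mat r)) (unipotent_elems (centralizer (Omega (B_mat r)) (S_mat r)))
    (diag_of h ` (\<Pi>\<^sub>E i\<in>{..<h}. W i))"
proof -
  have g: "group (block_group (r ! i))" if "i \<in> {..<h}" for i using block_group_carrier(3) that by simp
  have G: "group (product_group {..<h} (\<lambda>i. block_group (r ! i)))" using product_group g .
  have SO: "S_mat r \<in> carrier (Omega (B_mat r))"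
    unfolding Omega_simps(1) using S_isometry spinor_norm_semisimple[OF adapted_dims(3)[OF ad] ns ss] by simp
  have H: "group (centralizer (Omega (B_mat r)) (S_mat r))"
    by (rule group.group_centralizer[OF group_Omega[OF adapted_dims(3)[OF ad] ns] SO])
  have u: "unipotent_elems (block_group (r ! i)) \<subseteq> carrier (block_group (r ! i))" for i
    unfolding unipotent_elems_def by blast
  have "class_reps (product_group {..<h} (\<lambda>i. block_group (r ! i)))
      (\<Pi>\<^sub>E i\<in>{..<h}. unipotent_elems (block_group (r ! i))) (\<Pi>\<^sub>E i\<in>{..<h}. W i)"
    by (rule class_reps_product_group[OF g u]) (use W in simp_all)
  moreover have e: "unipotent_elems (product_group {..<h} (\<lambda>i. block_group (r ! i))) = (\<Pi>\<^sub>E i\<in>{..<h}. unipotent_elems (block_group (r ! i)))"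
    by (rule unipotent_product_group[OF _ g]) simp_all
  moreover have "unipotent_elems (product_group {..<h} (\<lambda>i. block_group (r ! i))) \<subseteq> carrier (product_group {..<h} (\<lambda>i. block_group (r ! i)))"
    unfolding unipotent_elems_def by blast
  ultimately show ?thesis
    unfolding iso_unipotent[OF G H centralizer_iso]
    using iso_class_reps[OF G H centralizer_iso] by metis
qed

lemma centralizer_spinor_norm_zero:
  assumes "set (eldivs r) \<subseteq> Phi2 \<union> Phi3" and Y: "Y \<in> carrier (isometry_group (B_mat r))" "Y * S_mat r = S_mat r * Y"
  shows "spinor_norm Y = 0"
proof -
  obtain x where x: "\<And>i. i < h \<Longrightarrow> x i \<in> carrier (isometry_group (BB i)) \<and> x i * SS i = SS i * x i" "Y = diag_of h x"
    using centralizer_decomposition[OF Y] by blast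
  have "eldivs r ! i \<notin> Phi1" if "i < h" for i
  proof
    assume "eldivs r ! i \<in> Phi1"
    then have "poly (eldivs r ! i) 1 = 0" unfolding Phi1_iff using char_two[of 1] by simp
    moreover have "eldivs r ! i \<in> Phi2 \<union> Phi3" using assms(1) that blocks_length[OF ad] by (metis nth_mem subsetD)
    ultimately show False using poly_Phi_one by blast
  qed
  then have "spinor_norm (x i) = 0" if "i < h" for i using commuting_block_spinor_norm[OF that] x(1)[OF that] that by blast
  then show ?thesis using spinor_norm_diag_of[of x] x by simp
qed

text \<open>Some divisor is t + 1. Its block is non-empty and \<open>S\<close> is the identity
  there, so a reflection of that block commutes with \<open>S\<close>.\<close>

lemma centralizer_spinor_norm_one:
  assumes "\<not> set (eldivs r) \<subseteq> Phi2 \<union> Phi3"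
  shows "\<exists>Y\<in>carrier (isometry_group (B_mat r)). Y * S_mat r = S_mat r * Y \<and> spinor_norm Y = 1"
proof -
  obtain i where i: "i < h" "eldivs r ! i \<notin> Phi2 \<union> Phi3"
    using assms blocks_length[OF ad] by (metis in_set_conv_nth subsetI)
  then have f: "eldivs r ! i = [:1, 1:]" using eldivs_Phi Phi1_iff by blast
  obtain m where m: "SS i \<in> carrier_mat m m" "BB i \<in> carrier_mat m m" using block_dims[OF i(1)] .
  have S1: "SS i = 1\<^sub>m m" by (rule Phi1_block_one[OF ad i(1) m(1) f])
  have "0 < m" by (rule Phi1_block_nonempty[OF ad i(1) m(1) f])
  then obtain t where t: "t \<in> carrier (isometry_group (BB i))" "spinor_norm t = 1"
    using reflection_exists[OF m(2) block_nonsingular[OF i(1)]] by blast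
  \<comment> \<open>The remaining blocks are those of \<open>S\<close> itself: they commute with
    \<open>S\<close> and, being semisimple, contribute norm zero.\<close>
  define x where "x j = (if j = i then t else SS j)" for j
  have x: "x j \<in> carrier (isometry_group (BB j))" if "j < h" for j
    using t S_block_isometry that unfolding x_def by simp
  have tm: "t \<in> carrier_mat m m" using isometry_carrier_mat[OF m(2)] t by blast
  have "diag_of h (\<lambda>j. x j * SS j) = diag_of h (\<lambda>j. SS j * x j)"
    unfolding diag_of_def x_def using S1 tm by (intro arg_cong[of _ _ diag_block_mat] map_cong) auto
  then have "diag_of h x * S_mat r = S_mat r * diag_of h x"
    unfolding S_diag_of using diag_of_mult[of x SS, OF x S_block_isometry] diag_of_mult[of SS x, OF S_block_isometry x] by simp
  moreover have "spinor_norm (diag_of h x) = 1"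
  proof -
    have "spinor_norm (x j) = 0" if j: "j \<in> {..<h} - {i}" for j
    proof -
      have "j < h" using j by simp
      then obtain k where "BB j \<in> carrier_mat k k" using block_dims by blast
      then show ?thesis
        using spinor_norm_semisimple block_nonsingular[OF \<open>j < h\<close>] S_block_semisimple[OF \<open>j < h\<close>] j unfolding x_def by auto
    qed
    then have "(\<Sum>j<h. spinor_norm (x j)) = 1"
      using sum.remove[of "{..<h}" i "\<lambda>j. spinor_norm (x j)"] i(1) t(2) unfolding x_def by simp
    then show ?thesis using spinor_norm_diag_of[of x, OF x] by simp
  qed
  ultimately show ?thesis using diag_of_isometry[of x, OF x] by blast
qed

end

end

text \<open>Each pair lives in the isometry group of its own matrix. Conjugation by
  \<open>P r\<close> moves all data into the single group of \<open>B0\<close>, where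
  \<open>classes_index_two\<close> applies with N the group \<open>Omega B0\<close>; the resulting
  bijection is then pulled back.\<close>

theorem theorem6p1p13:
  fixes B0 :: "'a::{field, finite} mat" and n :: nat and \<epsilon> :: form_type
    and R :: "'a blocks set" and P Z :: "'a blocks \<Rightarrow> 'a mat"
    and W :: "'a blocks \<Rightarrow> nat \<Rightarrow> 'a mat set"
  assumes "even CARD('a)" and "even n" and "0 < n"
    and "B0 \<in> carrier_mat n n" and "nonsingular B0" and "has_type \<epsilon> B0"
    and "semisimple_reps B0 R P"
    and "\<And>r i. r \<in> R \<Longrightarrow> i < length r \<Longrightarrow>
           class_reps (block_group (r ! i)) (unipotent_elems (block_group (r ! i))) (W r i)"
    and "\<And>r. r \<in> R \<Longrightarrow> set (eldivs r) \<subseteq> Phi2 \<union> Phi3 \<Longrightarrow>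
           Z r \<in> carrier (isometry_group (B_mat r)) - carrier (Omega (B_mat r))"
  shows "(\<forall>(r, X)\<in>class_pairs R W Z. X \<in> carrier (Omega (B_mat r))) \<and>
    bij_betw (\<lambda>(r, X). conj_class (Omega B0) (mat_conj X (P r)))
      (class_pairs R W Z) (conj_class (Omega B0) ` carrier (Omega B0))"
proof -
  interpret even_field "TYPE('a)" by unfold_locales (rule assms(1))
  note B0 = assms(4) and ns0 = assms(5)
  let ?G = "isometry_group B0"
  let ?phi = "\<lambda>r X. mat_conj X (P r)"
  \<comment> \<open>For these representatives the centralizer of \<open>S\<close> lies inside
    \<Omega>, so the class splits and the conjugate by \<open>Z r\<close> is required.\<close>
  define D where "D = {r. set (eldivs r) \<subseteq> (Phi2 :: 'a poly set) \<union> Phi3}"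
  interpret G: group ?G by (rule group_isometry_group[OF B0])
  have dim: "dim_row B0 = n" using B0 by simp
  have ad: "adapted n r" and tr: "transports B0 (P r) (B_mat r)"
    and ss: "S_mat r \<in> semisimple_elems (isometry_group (B_mat r))" if "r \<in> R" for r
    using assms(7) that unfolding semisimple_reps_def dim by auto
  have ns: "nonsingular (B_mat r)" if "r \<in> R" for r by (rule nonsingular_transports[OF B0 tr[OF that] ns0])
  have Bm: "B_mat r \<in> carrier_mat n n" if "r \<in> R" for r by (rule adapted_dims(3)[OF ad[OF that]])
  have I: "group (isometry_group (B_mat r))" if "r \<in> R" for r by (rule group_isometry_group[OF Bm[OF that]])
  have iso: "?phi r \<in> iso (isometry_group (B_mat r)) ?G" if "r \<in> R" for r
    by (rule isometry_transports[OF B0 tr[OF that]])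
  have isoO: "?phi r \<in> iso (Omega (B_mat r)) (Omega B0)" if "r \<in> R" for r
    by (rule Omega_transports(1)[OF B0 tr[OF that]])
  have phi_closed: "?phi r X \<in> carrier ?G" if "r \<in> R" "X \<in> carrier (isometry_group (B_mat r))" for r X
    using iso[OF that(1)] that(2) unfolding iso_def bij_betw_def by blast
  have phi_inj: "X = Y" if "r \<in> R" "X \<in> carrier (isometry_group (B_mat r))" "Y \<in> carrier (isometry_group (B_mat r))" "?phi r X = ?phi r Y" for r X Y
    using iso[OF that(1)] that(2-) unfolding iso_def bij_betw_def inj_on_def by blast
  have phi_surj: "\<exists>X\<in>carrier (isometry_group (B_mat r)). t = ?phi r X" if "r \<in> R" "t \<in> carrier ?G" for r t
    using iso[OF that(1)] that(2) unfolding iso_def bij_betw_def by blast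
  have phi_mult: "?phi r (X * Y) = ?phi r X \<otimes>\<^bsub>?G\<^esub> ?phi r Y"
    if "r \<in> R" "X \<in> carrier (isometry_group (B_mat r))" "Y \<in> carrier (isometry_group (B_mat r))" for r X Y
    using iso[OF that(1)] that(2-) isometry_group_simps(2)[OF Bm[OF that(1)]] unfolding iso_def hom_def by auto
  have phi_Omega: "?phi r X \<in> carrier (Omega B0) \<longleftrightarrow> X \<in> carrier (Omega (B_mat r))"
    if "r \<in> R" "X \<in> carrier (isometry_group (B_mat r))" for r X
    by (rule Omega_transports(2)[OF B0 tr[OF that(1)] that(2)])
  have I_closed: "X * Y \<in> carrier (isometry_group (B_mat r))"
    if "r \<in> R" "X \<in> carrier (isometry_group (B_mat r))" "Y \<in> carrier (isometry_group (B_mat r))" for r X Y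
    using monoid.m_closed[OF group.is_monoid[OF I[OF that(1)]] that(2,3)] isometry_group_simps(2)[OF Bm[OF that(1)]] by simp
  have SI: "S_mat r \<in> carrier (isometry_group (B_mat r))" if "r \<in> R" for r
    using ss[OF that] unfolding semisimple_elems_def by blast
  have OB0: "?G\<lparr>carrier := carrier (Omega B0)\<rparr> = Omega B0" by (rule Omega_simps(2)[symmetric])
  have subI: "carrier (Omega B) \<subseteq> carrier (isometry_group B)" for B :: "'a mat" unfolding Omega_simps(1) by blast

  \<comment> \<open>The block diagonal unipotent matrices built from the chosen representatives;
    they represent the unipotent classes of the whole centralizer of \<open>S\<close> in
    \<Omega>.\<close>
  define V where "V r = diag_of (length r) ` (\<Pi>\<^sub>E i\<in>{..<length r}. W r i)" for r
  have V_reps: "class_reps (centralizer (Omega (B_mat r)) (S_mat r))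
      (unipotent_elems (centralizer (Omega (B_mat r)) (S_mat r))) (V r)" if "r \<in> R" for r
    unfolding V_def by (rule class_reps_centralizer[OF ad[OF that] ns[OF that] ss[OF that] assms(8)[OF that]])
  have VO: "v \<in> carrier (Omega (B_mat r))" "v \<in> carrier (isometry_group (B_mat r))" if "r \<in> R" "v \<in> V r" for r v
  proof -
    have "v \<in> carrier (centralizer (Omega (B_mat r)) (S_mat r))"
      using V_reps[OF that(1)] that(2) unfolding class_reps_def unipotent_elems_def by blast
    then show "v \<in> carrier (Omega (B_mat r))" unfolding centralizer_simps by blast
    then show "v \<in> carrier (isometry_group (B_mat r))" using subI by blast
  qed
  \<comment> \<open>Lists of blocks and extensional functions on the index set produce the same
    matrices.\<close>
  have SU: "SU_set r (W r) = {S_mat r * v | v. v \<in> V r}" for r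
  proof -
    have "{diag_block_mat Us | Us. length Us = length r \<and> (\<forall>i<length r. Us ! i \<in> W r i)} = V r"
    proof (intro equalityI subsetI)
      fix X assume "X \<in> {diag_block_mat Us | Us. length Us = length r \<and> (\<forall>i<length r. Us ! i \<in> W r i)}"
      then obtain Us where Us: "X = diag_block_mat Us" "length Us = length r" "\<forall>i<length r. Us ! i \<in> W r i" by blast
      have "X = diag_of (length r) (restrict (\<lambda>i. Us ! i) {..<length r})"
        unfolding diag_of_restrict Us(1) Us(2)[symmetric] diag_of_nth ..
      moreover have "restrict (\<lambda>i. Us ! i) {..<length r} \<in> (\<Pi>\<^sub>E i\<in>{..<length r}. W r i)" using Us(3) by auto
      ultimately show "X \<in> V r" unfolding V_def by blast
    next
      fix X assume "X \<in> V r"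
      then obtain x where x: "X = diag_of (length r) x" "x \<in> (\<Pi>\<^sub>E i\<in>{..<length r}. W r i)" unfolding V_def by blast
      then have "X = diag_block_mat (map x [0..<length r])" "length (map x [0..<length r]) = length r"
        "\<forall>i<length r. map x [0..<length r] ! i \<in> W r i" unfolding diag_of_def by (auto simp: PiE_iff)
      then show "X \<in> {diag_block_mat Us | Us. length Us = length r \<and> (\<forall>i<length r. Us ! i \<in> W r i)}" by blast
    qed
    moreover have "SU_set r (W r) = (\<lambda>v. S_mat r * v) ` {diag_block_mat Us | Us. length Us = length r \<and> (\<forall>i<length r. Us ! i \<in> W r i)}"
      unfolding SU_set_def by blast
    ultimately show ?thesis by (simp only: Setcompr_eq_image Collect_mem_eq)
  qed

  \<comment> \<open>The images under \<open>P r\<close> of the semisimple parts, of the unipotent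
    representatives and of the elements outside \<Omega>, now all in the isometry group of
    \<open>B0\<close>.\<close>
  define s where "s r = ?phi r (S_mat r)" for r
  define U where "U r = ?phi r ` V r" for r
  define z where "z r = ?phi r (Z r)" for r
  have sG: "s r \<in> carrier ?G" if "r \<in> R" for r unfolding s_def using phi_closed[OF that SI[OF that]] .
  have s_ss: "s r \<in> semisimple_elems ?G" if r: "r \<in> R" for r
  proof -
    obtain m :: nat where m: "odd m" "S_mat r [^]\<^bsub>isometry_group (B_mat r)\<^esub> m = \<one>\<^bsub>isometry_group (B_mat r)\<^esub>"
      using ss[OF r] group.semisimple_iff[OF I[OF r]] by blast
    interpret h: group_hom "isometry_group (B_mat r)" ?G "?phi r"
      using I[OF r] iso[OF r] G.is_group by (simp add: group_hom_def group_hom_axioms_def iso_imp_homomorphism)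
    have "s r [^]\<^bsub>?G\<^esub> m = \<one>\<^bsub>?G\<^esub>"
      unfolding s_def using h.hom_nat_pow[OF SI[OF r], of m] m(2) h.hom_one by simp
    then show ?thesis using G.semisimple_iff sG[OF r] m(1) by blast
  qed
  define E where "E = {(r, s r \<otimes>\<^bsub>?G\<^esub> u) | r u. r \<in> R \<and> u \<in> U r} \<union>
    {(r, inv\<^bsub>?G\<^esub> (z r) \<otimes>\<^bsub>?G\<^esub> (s r \<otimes>\<^bsub>?G\<^esub> u) \<otimes>\<^bsub>?G\<^esub> z r) | r u. r \<in> R \<and> r \<in> D \<and> u \<in> U r}"
  have main: "(r, x) \<in> E \<Longrightarrow> x \<in> carrier (Omega B0)"
    "bij_betw (\<lambda>(r, x). conj_class (Omega B0) x) E (conj_class (Omega B0) ` carrier (Omega B0))" for r x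
  proof -
    have U_reps: "class_reps (centralizer (?G\<lparr>carrier := carrier (Omega B0)\<rparr>) (s r))
      (unipotent_elems (centralizer (?G\<lparr>carrier := carrier (Omega B0)\<rparr>) (s r))) (U r)" if r: "r \<in> R" for r
    proof -
      have SO: "S_mat r \<in> carrier (Omega (B_mat r))"
        unfolding Omega_simps(1) using SI[OF r] spinor_norm_semisimple[OF Bm[OF r] ns[OF r] ss[OF r]] by simp
      have sO: "s r \<in> carrier (Omega B0)" unfolding s_def using phi_Omega[OF r SI[OF r]] SO by simp
      note g1 = group.group_centralizer[OF group_Omega[OF Bm[OF r] ns[OF r]] SO]
      note g2 = group.group_centralizer[OF group_Omega[OF B0 ns0] sO]
      have i: "?phi r \<in> iso (centralizer (Omega (B_mat r)) (S_mat r)) (centralizer (Omega B0) (s r))"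
        unfolding s_def by (rule iso_centralizer[OF group_Omega[OF Bm[OF r] ns[OF r]] group_Omega[OF B0 ns0] isoO[OF r] SO])
      have "class_reps (centralizer (Omega B0) (s r)) (?phi r ` unipotent_elems (centralizer (Omega (B_mat r)) (S_mat r))) (U r)"
        unfolding U_def by (rule iso_class_reps[OF g1 g2 i _ V_reps[OF r]]) (auto simp: unipotent_elems_def)
      then show ?thesis unfolding OB0 iso_unipotent[OF g1 g2 i] .
    qed
    have meets: "\<exists>t\<in>carrier ?G - carrier (Omega B0). t \<otimes>\<^bsub>?G\<^esub> s r = s r \<otimes>\<^bsub>?G\<^esub> t" if r: "r \<in> R" "r \<notin> D" for r
    proof -
      obtain Y where Y: "Y \<in> carrier (isometry_group (B_mat r))" "Y * S_mat r = S_mat r * Y" "spinor_norm Y = 1"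
        using centralizer_spinor_norm_one[OF ad[OF r(1)] ns[OF r(1)] ss[OF r(1)]] r(2) unfolding D_def by blast
      have "?phi r Y \<notin> carrier (Omega B0)" using phi_Omega[OF r(1) Y(1)] Y(3) unfolding Omega_simps(1)[of "B_mat r"] by simp
      moreover have "?phi r Y \<otimes>\<^bsub>?G\<^esub> s r = s r \<otimes>\<^bsub>?G\<^esub> ?phi r Y"
        unfolding s_def phi_mult[OF r(1) Y(1) SI[OF r(1)], symmetric] phi_mult[OF r(1) SI[OF r(1)] Y(1), symmetric] Y(2) ..
      ultimately show ?thesis using phi_closed[OF r(1) Y(1)] by blast
    qed
    have inside: "t \<in> carrier (Omega B0)" if r: "r \<in> R" "r \<in> D" and t: "t \<in> carrier ?G" "t \<otimes>\<^bsub>?G\<^esub> s r = s r \<otimes>\<^bsub>?G\<^esub> t" for r t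
    proof -
      obtain Y where Y: "Y \<in> carrier (isometry_group (B_mat r))" "t = ?phi r Y" using phi_surj[OF r(1) t(1)] by blast
      have "?phi r (Y * S_mat r) = ?phi r (S_mat r * Y)"
        using t(2) unfolding Y(2) s_def phi_mult[OF r(1) Y(1) SI[OF r(1)]] phi_mult[OF r(1) SI[OF r(1)] Y(1)] .
      then have "Y * S_mat r = S_mat r * Y"
        by (rule phi_inj[OF r(1) I_closed[OF r(1) Y(1) SI[OF r(1)]] I_closed[OF r(1) SI[OF r(1)] Y(1)]])
      then have "spinor_norm Y = 0"
        using centralizer_spinor_norm_zero[OF ad[OF r(1)] ns[OF r(1)] ss[OF r(1)] _ Y(1)] r(2) unfolding D_def by blast
      then show ?thesis unfolding Y(2) phi_Omega[OF r(1) Y(1)] using Y(1) unfolding Omega_simps(1) by blast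
    qed
    have s_bij: "bij_betw (\<lambda>r. conj_class ?G (s r)) R (conj_class ?G ` semisimple_elems ?G)"
      using assms(7) unfolding semisimple_reps_def s_def by blast
    have zN: "z r \<in> carrier ?G - carrier (Omega B0)" if "r \<in> R" "r \<in> D" for r
      using assms(9)[OF that(1)] that phi_closed[OF that(1)] phi_Omega[OF that(1)] unfolding D_def z_def by blast
    note cls = G.classes_index_two[OF finite_isometry_group[OF B0] Omega_subgroup[OF B0 ns0] Omega_index_two[OF B0 ns0]
        s_ss s_bij U_reps meets inside zN, unfolded OB0]
    show "(r, x) \<in> E \<Longrightarrow> x \<in> carrier (Omega B0)" unfolding E_def by (rule cls(1))
    show "bij_betw (\<lambda>(r, x). conj_class (Omega B0) x) E (conj_class (Omega B0) ` carrier (Omega B0))" unfolding E_def by (rule cls(2))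
  qed

  \<comment> \<open>The tag \<open>r\<close> is kept, so \<open>F\<close> is injective as soon as
    conjugation by each single \<open>P r\<close> is; it carries the listed pairs exactly onto
    \<open>E\<close>.\<close>
  define F where "F = (\<lambda>(r, X). (r, ?phi r X))"
  have ZI: "Z r \<in> carrier (isometry_group (B_mat r))" if "r \<in> R" "r \<in> D" for r
    using assms(9)[OF that(1)] that(2) unfolding D_def by blast
  have conj_in: "mat_conj X (Z r) \<in> carrier (isometry_group (B_mat r))"
    "?phi r (mat_conj X (Z r)) = inv\<^bsub>?G\<^esub> (z r) \<otimes>\<^bsub>?G\<^esub> ?phi r X \<otimes>\<^bsub>?G\<^esub> z r"
    if r: "r \<in> R" "r \<in> D" and X: "X \<in> carrier (isometry_group (B_mat r))" for r X
  proof -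
    interpret h: group_hom "isometry_group (B_mat r)" ?G "?phi r"
      using I[OF r(1)] iso[OF r(1)] G.is_group by (simp add: group_hom_def group_hom_axioms_def iso_imp_homomorphism)
    note Zr = ZI[OF r]
    have Zd: "dim_row (Z r) = n" using isometry_carrier_mat[OF Bm[OF r(1)] Zr] by simp
    have e: "mat_conj X (Z r) = inv\<^bsub>isometry_group (B_mat r)\<^esub> (Z r) * X * Z r"
      unfolding mat_conj_def Zd isometry_inv[OF Bm[OF r(1)] Zr] ..
    have iZ: "inv\<^bsub>isometry_group (B_mat r)\<^esub> (Z r) \<in> carrier (isometry_group (B_mat r))" using Zr by simp
    note c1 = I_closed[OF r(1) iZ X]
    show "mat_conj X (Z r) \<in> carrier (isometry_group (B_mat r))" unfolding e by (rule I_closed[OF r(1) c1 Zr])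
    show "?phi r (mat_conj X (Z r)) = inv\<^bsub>?G\<^esub> (z r) \<otimes>\<^bsub>?G\<^esub> ?phi r X \<otimes>\<^bsub>?G\<^esub> z r"
      unfolding e phi_mult[OF r(1) c1 Zr] phi_mult[OF r(1) iZ X] z_def h.hom_inv[OF Zr] ..
  qed
  have SV: "S_mat r * v \<in> carrier (isometry_group (B_mat r))" "?phi r (S_mat r * v) = s r \<otimes>\<^bsub>?G\<^esub> ?phi r v"
    if "r \<in> R" "v \<in> V r" for r v
    using I_closed[OF that(1) SI[OF that(1)] VO(2)[OF that]] phi_mult[OF that(1) SI[OF that(1)] VO(2)[OF that]]
    unfolding s_def by auto
  have cp: "class_pairs R W Z = {(r, S_mat r * v) | r v. r \<in> R \<and> v \<in> V r} \<union>
     {(r, mat_conj (S_mat r * v) (Z r)) | r v. r \<in> R \<and> r \<in> D \<and> v \<in> V r}"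
    unfolding class_pairs_def SU D_def by blast
  have cpI: "r \<in> R \<and> X \<in> carrier (isometry_group (B_mat r))" if "(r, X) \<in> class_pairs R W Z" for r X
    using that SV(1) conj_in(1) unfolding cp by blast
  have inj: "inj_on F (class_pairs R W Z)"
  proof
    fix p q assume p: "p \<in> class_pairs R W Z" and q: "q \<in> class_pairs R W Z" and eq: "F p = F q"
    obtain r X r' Y where pq: "p = (r, X)" "q = (r', Y)" by (cases p, cases q)
    have "r = r'" "?phi r X = ?phi r Y" using eq unfolding F_def pq by auto
    then show "p = q" using phi_inj[of r X Y] cpI p q unfolding pq by blast
  qed
  have FE: "F ` class_pairs R W Z = E"
  proof -
    have "F ` {(r, S_mat r * v) | r v. r \<in> R \<and> v \<in> V r} = {(r, s r \<otimes>\<^bsub>?G\<^esub> u) | r u. r \<in> R \<and> u \<in> U r}" (is "F ` ?A = ?A'")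
    proof (intro equalityI subsetI)
      fix p assume "p \<in> F ` ?A"
      then obtain r v where *: "r \<in> R" "v \<in> V r" "p = F (r, S_mat r * v)" by blast
      then have "p = (r, s r \<otimes>\<^bsub>?G\<^esub> ?phi r v)" "?phi r v \<in> U r" using SV(2) unfolding F_def U_def by auto
      then show "p \<in> ?A'" using *(1) by blast
    next
      fix p assume "p \<in> ?A'"
      then obtain r v where *: "r \<in> R" "v \<in> V r" "p = (r, s r \<otimes>\<^bsub>?G\<^esub> ?phi r v)" unfolding U_def by blast
      then have "p = F (r, S_mat r * v)" using SV(2) unfolding F_def by simp
      then show "p \<in> F ` ?A" using *(1,2) by blast
    qed
    moreover have "F ` {(r, mat_conj (S_mat r * v) (Z r)) | r v. r \<in> R \<and> r \<in> D \<and> v \<in> V r} =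
      {(r, inv\<^bsub>?G\<^esub> (z r) \<otimes>\<^bsub>?G\<^esub> (s r \<otimes>\<^bsub>?G\<^esub> u) \<otimes>\<^bsub>?G\<^esub> z r) | r u. r \<in> R \<and> r \<in> D \<and> u \<in> U r}" (is "F ` ?B = ?B'")
    proof (intro equalityI subsetI)
      fix p assume "p \<in> F ` ?B"
      then obtain r v where *: "r \<in> R" "r \<in> D" "v \<in> V r" "p = F (r, mat_conj (S_mat r * v) (Z r))" by blast
      then have "p = (r, inv\<^bsub>?G\<^esub> (z r) \<otimes>\<^bsub>?G\<^esub> (s r \<otimes>\<^bsub>?G\<^esub> ?phi r v) \<otimes>\<^bsub>?G\<^esub> z r)" "?phi r v \<in> U r"
        using conj_in(2)[OF *(1,2) SV(1)[OF *(1,3)]] SV(2)[OF *(1,3)] unfolding F_def U_def by auto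
      then show "p \<in> ?B'" using *(1,2) by blast
    next
      fix p assume "p \<in> ?B'"
      then obtain r v where *: "r \<in> R" "r \<in> D" "v \<in> V r" "p = (r, inv\<^bsub>?G\<^esub> (z r) \<otimes>\<^bsub>?G\<^esub> (s r \<otimes>\<^bsub>?G\<^esub> ?phi r v) \<otimes>\<^bsub>?G\<^esub> z r)"
        unfolding U_def by blast
      then have "p = F (r, mat_conj (S_mat r * v) (Z r))"
        using conj_in(2)[OF *(1,2) SV(1)[OF *(1,3)]] SV(2)[OF *(1,3)] unfolding F_def by simp
      then show "p \<in> F ` ?B" using *(1,2,3) by blast
    qed
    ultimately show ?thesis unfolding cp E_def image_Un by simp
  qed
  have "bij_betw ((\<lambda>(r, x). conj_class (Omega B0) x) \<circ> F) (class_pairs R W Z) (conj_class (Omega B0) ` carrier (Omega B0))"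
    by (rule bij_betw_trans[OF _ main(2)]) (simp add: bij_betw_def inj FE)
  moreover have "(\<lambda>(r, x). conj_class (Omega B0) x) \<circ> F = (\<lambda>(r, X). conj_class (Omega B0) (mat_conj X (P r)))"
    unfolding F_def by (auto simp: fun_eq_iff)
  ultimately have "bij_betw (\<lambda>(r, X). conj_class (Omega B0) (mat_conj X (P r)))
      (class_pairs R W Z) (conj_class (Omega B0) ` carrier (Omega B0))" by simp
  moreover have "X \<in> carrier (Omega (B_mat r))" if p: "(r, X) \<in> class_pairs R W Z" for r X
  proof -
    have "(r, ?phi r X) \<in> E" using imageI[OF p, of F] unfolding FE by (simp add: F_def)
    then have "?phi r X \<in> carrier (Omega B0)" by (rule main(1))
    then show ?thesis using phi_Omega cpI[OF p] by blast
  qed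
  ultimately show ?thesis by blast
qed

end
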